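(* Let $N$ be a positive integer and suppose $f(z) \in M_k(\Gamma_0(N)) \cap \mathbb{Z}[[q]]$ has the property that $f$ is non-zero (has no zeros) on $\mathbb{H}$. Then $f(z) = c\,g(z)$, where $c \in \mathbb{Z}$ and $g(z)$ is an eta-quotient.
   Context: $\mathbb{H}$ is the upper half plane and $q = e^{2\pi i z}$. $M_k(\Gamma_0(N))$ is the space of holomorphic modular forms of weight $k$ (trivial character) for $\Gamma_0(N)$; $f \in \mathbb{Z}[[q]]$ means that the Fourier expansion of $f$ at infinity has integer coefficients. $\eta(z) = q^{1/24}\prod_{n\ge 1}(1-q^n)$. An eta-quotient is a function of the form $\prod_{\delta \mid M}\eta(\delta z)^{r_\delta}$ with $r_\delta\in\mathbb{Z}$, for some positive integer $M$. *)

theory Defs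
  imports "HOL-Complex_Analysis.Complex_Analysis"
begin

definition upper_half_plane :: "complex set" where
  "upper_half_plane = {z. Im z > 0}"

definition SL2Z :: "(int^2^2) set" where
  "SL2Z = {A. det A = 1}"

definition Gamma0 :: "nat \<Rightarrow> (int^2^2) set" where
  "Gamma0 N = {A \<in> SL2Z. int N dvd A $ 2 $ 1}"

definition moebius_act :: "int^2^2 \<Rightarrow> complex \<Rightarrow> complex" where
  "moebius_act A z =
     moebius (of_int (A $ 1 $ 1)) (of_int (A $ 1 $ 2)) (of_int (A $ 2 $ 1)) (of_int (A $ 2 $ 2)) z"

(* No power of the determinant: the operator is only used for matrices of determinant 1. *)
definition slash :: "int \<Rightarrow> (complex \<Rightarrow> complex) \<Rightarrow> int^2^2 \<Rightarrow> complex \<Rightarrow> complex" where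
  "slash k f A z =
     (of_int (A $ 2 $ 1) * z + of_int (A $ 2 $ 2)) powi (- k) * f (moebius_act A z)"

(* F has the expansion \<Sum>n\<ge>0. a n * q_h ^ n with q_h = exp (2 pi i z / h),
   convergent on all of the upper half plane. *)
definition has_q_expansion :: "(complex \<Rightarrow> complex) \<Rightarrow> nat \<Rightarrow> (nat \<Rightarrow> complex) \<Rightarrow> bool" where
  "has_q_expansion F h a \<longleftrightarrow>
     (\<forall>z\<in>upper_half_plane. (\<lambda>n. a n * exp (2 * of_real pi * \<i> * z / of_nat h) ^ n) sums F z)"

(* The last clause is holomorphy at every cusp, with an expansion in some q_h, h > 0.
   Functions are total; their values off the upper half plane are irrelevant. *)
definition modular_forms :: "int \<Rightarrow> nat \<Rightarrow> (complex \<Rightarrow> complex) set" where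
  "modular_forms k N = {f. f holomorphic_on upper_half_plane \<and>
     (\<forall>A\<in>Gamma0 N. \<forall>z\<in>upper_half_plane. slash k f A z = f z) \<and>
     (\<forall>A\<in>SL2Z. \<exists>h>0. \<exists>a. has_q_expansion (slash k f A) h a)}"

definition integral_q_expansion :: "(complex \<Rightarrow> complex) \<Rightarrow> bool" where
  "integral_q_expansion f \<longleftrightarrow> (\<exists>a. range a \<subseteq> \<int> \<and> has_q_expansion f 1 a)"

(* q^(1/24) is exp (2 pi i z / 24), not a principal root of q. *)
definition dedekind_eta :: "complex \<Rightarrow> complex" where
  "dedekind_eta z = exp (2 * of_real pi * \<i> * z / 24) *
     (\<Prod>n. 1 - exp (2 * of_real pi * \<i> * z) ^ Suc n)"

definition eta_quotient :: "(complex \<Rightarrow> complex) \<Rightarrow> bool" where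
  "eta_quotient g \<longleftrightarrow> (\<exists>M>0. \<exists>r :: nat \<Rightarrow> int. \<forall>z\<in>upper_half_plane.
     g z = (\<Prod>\<delta> | \<delta> dvd M. dedekind_eta (of_nat \<delta> * z) powi r \<delta>))"

end

theory Submission
  imports Defs
begin

text \<open>
  Write $f = c\,q^m \prod_n (1 - q^n)^{b(n)}$ with $c$ the leading coefficient.  A form without zeros on the
  upper half plane is determined up to a constant by its weight and its orders at the cusps, so
  relations between orders become relations between the numbers $a(n) = \sum_{d \mid n} d\,b(d)$.

  The multiplicative Hecke operator $T_p f(z) = f(pz) \prod_{j<p} f((z+j)/p)$, $p \nmid N$, acts on the orders
  as $p \langle p \rangle^{-1} + \langle p \rangle$, where $\langle p \rangle$ permutes the cusps and depends only on $p$ modulo $N$.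
  For primes $p, p', r$ in one residue class this yields a linear relation between $T_p f$, $T_{p'} f$
  and $T_r f$.  Integrality gives $T_r f \equiv f(q) f(q^r)$ modulo $r$, up to the denominator $c$; letting
  $r$ tend to infinity, the relation forces $\langle p \rangle$ to fix all orders.  Hence $T_p f$ is a constant
  times $f^{p+1}$ for $p \nmid N$, and a similar relation holds between iterates of $U_p$ for $p \mid N$.  In terms of the
  exponents this says that $b(n)$ depends only on $\gcd(n, N^2)$, which is an eta-quotient with rational
  exponents; a Gauss lemma for integral power series makes the exponents integral.  Finally $m$ is
  computed from the growth of the product at the cusp $1/N^2$, so that the transformation law of
  $\eta$ is never needed.
\<close>

section \<open>Slash operators and orders at infinity\<close>

text \<open>The dictionary between orders and coefficients is used in both directions. At a fixed
  cusp the order of T_p f is p A + B, where A and B depend only on the class of p, so three primes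
  p, q, r of a class always satisfy a relation with the coefficients q - r, r - p, p - q. Modulo r
  the transform T_r f may be replaced by f, and what remains is a fixed integer divisible by
  infinitely many primes, hence 0. Read back at the cusps, this exact relation says that B is the
  order of f itself.

  The constant c shapes the arithmetic. It need not be a unit, so n l(n) is integral only after
  multiplication by c^n, and Fermat's theorem has to absorb a factor c^(rn). For the same reason the
  exponents come out rational first; as they take finitely many values they have one common
  denominator.

  For p dividing N the relation between the iterates of U_p has the characteristic roots 1 and p.
  The root 1 disappears on passing from divisor sums to their terms n b(n), and the root p is
  accounted for by the factor n. So all cases say that b(n) does not change when n is multiplied by
  p.\<close>

text \<open>The entries are separate integers and the determinant may be any positive number, as the
  Hecke matrices require. Leaving out a power of the determinant changes the transforms only by
  constant factors.\<close>

definition mslash ::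
  "int \<Rightarrow> (complex \<Rightarrow> complex) \<Rightarrow> int \<Rightarrow> int \<Rightarrow> int \<Rightarrow> int \<Rightarrow> complex \<Rightarrow> complex" where
  "mslash k F a b c d z =
     (of_int c * z + of_int d) powi (- k) *
     F ((of_int a * z + of_int b) / (of_int c * z + of_int d))"

definition qh :: "nat \<Rightarrow> complex \<Rightarrow> complex" where
  "qh h z = exp (2 * of_real pi * \<i> * z / of_nat h)"

lemma in_H: "z \<in> upper_half_plane \<longleftrightarrow> Im z > 0"
  by (simp add: upper_half_plane_def)

lemma open_H: "open upper_half_plane"
  unfolding upper_half_plane_def by (rule open_halfspace_Im_gt)

lemma convex_H: "convex upper_half_plane"
  unfolding upper_half_plane_def by (rule convex_halfspace_Im_gt)

lemma norm_qh: "norm (qh h z) = exp (- 2 * pi * Im z / of_nat h)"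
  by (simp add: qh_def Re_divide_of_nat)

lemma qh_in_ball: "z \<in> upper_half_plane \<Longrightarrow> h > 0 \<Longrightarrow> qh h z \<in> ball 0 1"
  by (simp add: norm_qh in_H)

lemma qh_nonzero [simp]: "qh h z \<noteq> 0"
  by (simp add: qh_def)

lemma qh_surj:
  assumes "w \<in> ball 0 1" "w \<noteq> 0" "h > 0"
  obtains z where "z \<in> upper_half_plane" "w = qh h z"
proof
  define z where "z = of_nat h * Ln w / (2 * of_real pi * \<i>)"
  show "w = qh h z" using assms by (simp add: z_def qh_def)
  then have "norm (qh h z) < 1" using assms by auto
  then show "z \<in> upper_half_plane" using assms
    by (simp add: norm_qh in_H zero_less_mult_iff zero_less_divide_iff)
qed

lemma cz_d_nonzero:
  assumes "Im z > 0" "a * d - b * c > (0::int)"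
  shows "of_int c * z + of_int d \<noteq> 0"
proof
  assume *: "of_int c * z + of_int d = 0"
  then have "Im (of_int c * z + of_int d) = 0" by simp
  then have "c = 0" using assms by simp
  with * show False using assms by auto
qed

lemma Im_moebius_int:
  assumes "Im z > 0" "a * d - b * c > (0::int)"
  shows "Im ((of_int a * z + of_int b) / (of_int c * z + of_int d)) =
    of_int (a * d - b * c) * Im z / (norm (of_int c * z + of_int d))\<^sup>2"
  by (simp add: Im_divide cmod_power2 algebra_simps)

lemma moebius_int_in_H:
  assumes "z \<in> upper_half_plane" "a * d - b * c > (0::int)"
  shows "(of_int a * z + of_int b) / (of_int c * z + of_int d) \<in> upper_half_plane"
  using Im_moebius_int[of z a d b c] cz_d_nonzero[of z a d b c] assms
  unfolding in_H by (simp del: of_int_diff of_int_mult)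

lemma mslash_mslash:
  assumes "z \<in> upper_half_plane" "a' * d' - b' * c' > 0"
  shows "mslash k (mslash k F a b c d) a' b' c' d' z =
    mslash k F (a * a' + b * c') (a * b' + b * d') (c * a' + d * c') (c * b' + d * d') z"
proof -
  let ?D = "of_int c' * z + of_int d'"
  have nz: "?D \<noteq> 0" using cz_d_nonzero assms in_H by blast
  have 1: "of_int c * ((of_int a' * z + of_int b') / ?D) + of_int d =
      (of_int (c * a' + d * c') * z + of_int (c * b' + d * d')) / ?D"
    using nz by (simp add: field_simps)
  have 2: "of_int a * ((of_int a' * z + of_int b') / ?D) + of_int b =
      (of_int (a * a' + b * c') * z + of_int (a * b' + b * d')) / ?D"
    using nz by (simp add: field_simps)
  have 3: "X / ?D / (Y / ?D) = X / Y" for X Y using nz by simp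
  have 4: "?D powi (- k) * ((Y / ?D) powi (- k) * w) = Y powi (- k) * w" for Y w
    using nz by (simp add: power_int_divide_distrib)
  show ?thesis
    unfolding mslash_def 1 2 3 4 ..
qed

lemma mslash_cong:
  assumes "\<And>z. z \<in> upper_half_plane \<Longrightarrow> F z = G z" "z \<in> upper_half_plane" "a * d - b * c > 0"
  shows "mslash k F a b c d z = mslash k G a b c d z"
  using assms moebius_int_in_H by (simp add: mslash_def)

lemma mslash_mult:
  assumes "z \<in> upper_half_plane" "a * d - b * c > 0"
  shows "mslash (k + l) (\<lambda>z. F z * G z) a b c d z = mslash k F a b c d z * mslash l G a b c d z"
proof -
  have "of_int c * z + of_int d \<noteq> 0" using cz_d_nonzero assms in_H by blast
  then have "(of_int c * z + of_int d) powi (- (k + l)) =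
      (of_int c * z + of_int d) powi (- k) * (of_int c * z + of_int d) powi (- l)"
    by (subst power_int_add[symmetric]) auto
  then show ?thesis by (simp add: mslash_def)
qed

lemma mslash_powi:
  assumes "z \<in> upper_half_plane" "a * d - b * c > 0"
  shows "mslash (n * k) (\<lambda>z. F z powi n) a b c d z = mslash k F a b c d z powi n"
proof -
  have "(of_int c * z + of_int d) powi (- (n * k)) = ((of_int c * z + of_int d) powi (- k)) powi n"
    by (subst power_int_mult[symmetric]) (simp add: mult.commute)
  then show ?thesis by (simp add: mslash_def power_int_mult_distrib)
qed

lemma mslash_nonzero:
  assumes "\<And>z. z \<in> upper_half_plane \<Longrightarrow> F z \<noteq> 0" "z \<in> upper_half_plane" "a * d - b * c > 0"
  shows "mslash k F a b c d z \<noteq> 0"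
  using assms moebius_int_in_H cz_d_nonzero by (simp add: mslash_def in_H)

lemma mslash_holomorphic:
  assumes "F holomorphic_on upper_half_plane" "a * d - b * c > 0"
  shows "mslash k F a b c d holomorphic_on upper_half_plane"
proof -
  have nz: "of_int c * z + of_int d \<noteq> 0" if "z \<in> upper_half_plane" for z
    using cz_d_nonzero assms that in_H by blast
  have "(\<lambda>z. F ((of_int a * z + of_int b) / (of_int c * z + of_int d))) holomorphic_on upper_half_plane"
    by (rule holomorphic_on_compose_gen[OF _ assms(1), unfolded o_def])
       (use nz moebius_int_in_H assms in \<open>auto intro!: holomorphic_intros\<close>)
  then show ?thesis unfolding mslash_def[abs_def]
    using nz by (intro holomorphic_intros) auto
qed

section \<open>Orders of zero-free functions at infinity\<close>

text \<open>The exponent is measured in q and not in q_h, so that the width h disappears from the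
  statement and orders for different widths can be added. \<Phi> is zero-free on the whole disc,
  including 0; this makes e the exact order and admits negative powers.\<close>

definition has_ord :: "(complex \<Rightarrow> complex) \<Rightarrow> real \<Rightarrow> bool" where
  "has_ord F e \<longleftrightarrow> (\<exists>h>0. \<exists>\<Phi>. \<Phi> holomorphic_on ball 0 1 \<and> (\<forall>w\<in>ball 0 1. \<Phi> w \<noteq> 0) \<and>
     (\<forall>z\<in>upper_half_plane. F z = exp (2 * of_real pi * \<i> * of_real e * z) * \<Phi> (qh h z)))"

lemma has_ordI:
  assumes "h > 0" "\<Phi> holomorphic_on ball 0 1" "\<And>w. w \<in> ball 0 1 \<Longrightarrow> \<Phi> w \<noteq> 0"
    "\<And>z. z \<in> upper_half_plane \<Longrightarrow> F z = exp (2 * of_real pi * \<i> * of_real e * z) * \<Phi> (qh h z)"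
  shows "has_ord F e"
  using assms unfolding has_ord_def by blast

lemma has_ord_cong:
  assumes "has_ord F e" "\<And>z. z \<in> upper_half_plane \<Longrightarrow> F z = G z"
  shows "has_ord G e"
  using assms unfolding has_ord_def by (metis (no_types, lifting))

lemma qh_mult: "h > 0 \<Longrightarrow> qh h' z = qh (h' * h) z ^ h"
  by (simp add: qh_def flip: exp_of_nat_mult)

lemma power_in_ball: "w \<in> ball 0 1 \<Longrightarrow> n > 0 \<Longrightarrow> w ^ n \<in> ball (0::complex) 1"
  by (simp add: norm_power power_less_one_iff)

lemma has_ord_mult:
  assumes "has_ord F e" "has_ord G e'"
  shows "has_ord (\<lambda>z. F z * G z) (e + e')"
proof -
  obtain h \<Phi> where h: "h > 0" "\<Phi> holomorphic_on ball 0 1" "\<And>w. w \<in> ball 0 1 \<Longrightarrow> \<Phi> w \<noteq> 0"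
    "\<And>z. z \<in> upper_half_plane \<Longrightarrow> F z = exp (2 * of_real pi * \<i> * of_real e * z) * \<Phi> (qh h z)"
    using assms(1) unfolding has_ord_def by blast
  obtain h' \<Psi> where h': "h' > 0" "\<Psi> holomorphic_on ball 0 1" "\<And>w. w \<in> ball 0 1 \<Longrightarrow> \<Psi> w \<noteq> 0"
    "\<And>z. z \<in> upper_half_plane \<Longrightarrow> G z = exp (2 * of_real pi * \<i> * of_real e' * z) * \<Psi> (qh h' z)"
    using assms(2) unfolding has_ord_def by blast
  show ?thesis
  \<comment> \<open>Both local parameters are powers of the one of width
    \<open>h * h'\<close>.\<close>
  proof (rule has_ordI[where h = "h * h'" and \<Phi> = "\<lambda>w. \<Phi> (w ^ h') * \<Psi> (w ^ h)"])
    show "(\<lambda>w. \<Phi> (w ^ h') * \<Psi> (w ^ h)) holomorphic_on ball 0 1"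
      using h h' power_in_ball
      by (intro holomorphic_on_mult holomorphic_on_compose_gen[OF _ h(2), unfolded o_def]
          holomorphic_on_compose_gen[OF _ h'(2), unfolded o_def] holomorphic_intros) auto
    show "\<Phi> (w ^ h') * \<Psi> (w ^ h) \<noteq> 0" if "w \<in> ball 0 1" for w
      using h h' power_in_ball[OF that] by auto
    show "F z * G z = exp (2 * complex_of_real pi * \<i> * complex_of_real (e + e') * z) *
         (\<Phi> (qh (h * h') z ^ h') * \<Psi> (qh (h * h') z ^ h))" if "z \<in> upper_half_plane" for z
      using h h' that qh_mult[of h' h z] qh_mult[of h h' z]
      by (simp add: mult.commute ring_distribs exp_add)
  qed (use h h' in auto)
qed

lemma has_ord_powi:
  assumes "has_ord F e"
  shows "has_ord (\<lambda>z. F z powi n) (of_int n * e)"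
proof -
  obtain h \<Phi> where h: "h > 0" "\<Phi> holomorphic_on ball 0 1" "\<And>w. w \<in> ball 0 1 \<Longrightarrow> \<Phi> w \<noteq> 0"
    "\<And>z. z \<in> upper_half_plane \<Longrightarrow> F z = exp (2 * of_real pi * \<i> * of_real e * z) * \<Phi> (qh h z)"
    using assms unfolding has_ord_def by blast
  show ?thesis
  proof (rule has_ordI[where h = h and \<Phi> = "\<lambda>w. \<Phi> w powi n"])
    show "F z powi n = exp (2 * of_real pi * \<i> * of_real (of_int n * e) * z) * \<Phi> (qh h z) powi n"
      if "z \<in> upper_half_plane" for z
    proof -
      have "exp (2 * of_real pi * \<i> * of_real e * z) powi n =
          exp (2 * of_real pi * \<i> * of_real (of_int n * e) * z)"
        by (subst exp_power_int) (simp add: mult_ac)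
      then show ?thesis using h(4)[OF that] by (simp add: power_int_mult_distrib)
    qed
  qed (use h in \<open>auto intro!: holomorphic_intros\<close>)
qed

lemma has_ord_const: "c \<noteq> 0 \<Longrightarrow> has_ord (\<lambda>z. c) 0"
  by (rule has_ordI[where h = 1 and \<Phi> = "\<lambda>_. c"]) auto

lemma has_ord_cmult: "has_ord F e \<Longrightarrow> c \<noteq> 0 \<Longrightarrow> has_ord (\<lambda>z. c * F z) e"
  using has_ord_mult[OF has_ord_const] by fastforce

lemma has_ord_affine:
  assumes "has_ord F e" "a > 0" "d > 0"
  shows "has_ord (\<lambda>z. F ((of_int a * z + of_int b) / of_int d)) (e * of_int a / of_int d)"
proof -
  obtain h \<Phi> where h: "h > 0" "\<Phi> holomorphic_on ball 0 1" "\<And>w. w \<in> ball 0 1 \<Longrightarrow> \<Phi> w \<noteq> 0"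
    "\<And>z. z \<in> upper_half_plane \<Longrightarrow> F z = exp (2 * of_real pi * \<i> * of_real e * z) * \<Phi> (qh h z)"
    using assms(1) unfolding has_ord_def by blast
  \<comment> \<open>A translation in z becomes a rotation of the local parameter; its effect on the
    factor exp(2 pi i e z) is the constant \<open>C\<close>.\<close>
  define \<zeta> where "\<zeta> = exp (\<i> * of_real (2 * pi * of_int b / (of_int d * of_nat h)))"
  define C where "C = exp (2 * of_real pi * \<i> * of_real e * of_int b / of_int d)"
  have "norm \<zeta> = 1" unfolding \<zeta>_def by (rule norm_exp_i_times)
  then have in_ball: "\<zeta> * w ^ nat a \<in> ball 0 1" if "w \<in> ball 0 1" for w
    using power_in_ball[OF that, of "nat a"] assms by (simp add: norm_mult)
  show ?thesis
  proof (rule has_ordI[where h = "nat d * h" and \<Phi> = "\<lambda>w. C * \<Phi> (\<zeta> * w ^ nat a)"])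
    show "(\<lambda>w. C * \<Phi> (\<zeta> * w ^ nat a)) holomorphic_on ball 0 1"
      using in_ball by (intro holomorphic_intros holomorphic_on_compose_gen[OF _ h(2), unfolded o_def]) auto
    show "C * \<Phi> (\<zeta> * w ^ nat a) \<noteq> 0" if "w \<in> ball 0 1" for w
      using in_ball[OF that] h(3) by (simp add: C_def)
    show "F ((of_int a * z + of_int b) / of_int d) =
      exp (2 * of_real pi * \<i> * of_real (e * of_int a / of_int d) * z) * (C * \<Phi> (\<zeta> * qh (nat d * h) z ^ nat a))"
      if z: "z \<in> upper_half_plane" for z
    proof -
      let ?z = "(of_int a * z + of_int b) / of_int d"
      have "?z \<in> upper_half_plane" using moebius_int_in_H[OF z, of a d b 0] assms by simp
      moreover have "qh h ?z = \<zeta> * qh (nat d * h) z ^ nat a"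
        using assms(2,3) h(1) unfolding qh_def \<zeta>_def
        by (simp flip: exp_of_nat_mult exp_add add: field_simps of_nat_nat)
      moreover have "exp (2 * of_real pi * \<i> * of_real e * ?z) =
          exp (2 * of_real pi * \<i> * of_real (e * of_int a / of_int d) * z) * C"
        using assms(2,3) unfolding C_def by (simp flip: exp_add add: field_simps)
      ultimately show ?thesis using h(4) by simp
    qed
  qed (use h assms in auto)
qed

text \<open>Up the imaginary axis the local parameter tends to 0 and \<Phi> to a finite value,
  whereas a positive e would make exp(2 pi e y) unbounded.\<close>

lemma has_ord_one_nonpos:
  assumes "has_ord (\<lambda>_. 1) e"
  shows "e \<le> 0"
proof (rule ccontr)
  assume "\<not> e \<le> 0"
  obtain h \<Phi> where h: "h > 0" "\<Phi> holomorphic_on ball 0 1" "\<And>w. w \<in> ball 0 1 \<Longrightarrow> \<Phi> w \<noteq> 0"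
    "\<And>z. z \<in> upper_half_plane \<Longrightarrow> 1 = exp (2 * of_real pi * \<i> * of_real e * z) * \<Phi> (qh h z)"
    using assms unfolding has_ord_def by blast
  have eq: "exp (2 * pi * e * y) = norm (\<Phi> (of_real (exp (- 2 * pi * y / h))))" if "y > 0" for y
  proof -
    have 1: "qh h (\<i> * of_real y) = of_real (exp (- 2 * pi * y / h))"
      by (simp add: qh_def flip: exp_of_real) (simp add: algebra_simps)
    have "norm (1::complex) = norm (exp (2 * of_real pi * \<i> * of_real e * (\<i> * of_real y)) * \<Phi> (qh h (\<i> * of_real y)))"
      using h(4)[of "\<i> * of_real y"] that by (simp add: in_H)
    then have "1 = exp (- (2 * pi * e * y)) * norm (\<Phi> (qh h (\<i> * of_real y)))"
      by (simp add: norm_mult)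
    then show ?thesis unfolding 1 by (simp add: exp_minus field_simps)
  qed
  have "isCont \<Phi> 0" using h(2) by (metis at_within_open centre_in_ball continuous_on_eq_continuous_within holomorphic_on_imp_continuous_on open_ball zero_less_one)
  then have "((\<lambda>y. norm (\<Phi> (of_real (exp (- 2 * pi * y / h))))) \<longlongrightarrow> norm (\<Phi> (of_real 0))) at_top"
  proof (intro tendsto_norm isCont_tendsto_compose[of _ \<Phi>] tendsto_of_real)
    show "((\<lambda>y. exp (- 2 * pi * y / real h)) \<longlongrightarrow> 0) at_top"
      using h(1) by real_asymp
  qed simp
  moreover have "\<forall>\<^sub>F y in at_top. norm (\<Phi> (of_real (exp (- 2 * pi * y / h)))) = exp (2 * pi * e * y)"
    using eventually_gt_at_top[of 0] by eventually_elim (use eq in auto)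
  ultimately have "((\<lambda>y. exp (2 * pi * e * y)) \<longlongrightarrow> norm (\<Phi> 0)) at_top"
    using tendsto_cong by fastforce
  moreover have "filterlim (\<lambda>y. exp (2 * pi * e * y)) at_top at_top"
    using \<open>\<not> e \<le> 0\<close> by real_asymp
  ultimately show False
    by (meson filterlim_at_top_imp_at_infinity not_tendsto_and_filterlim_at_infinity trivial_limit_at_top_linorder)
qed

lemma has_ord_unique:
  assumes "has_ord F e" "has_ord F e'"
  shows "e = e'"
proof -
  have *: "e \<le> e'" if F: "has_ord F e" "has_ord F e'" for e e'
  proof -
    have nz: "F z \<noteq> 0" if "z \<in> upper_half_plane" for z
      using F(1) that qh_in_ball unfolding has_ord_def by force
    have "has_ord (\<lambda>z. F z * F z powi (-1)) (e + of_int (-1) * e')"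
      by (intro has_ord_mult has_ord_powi F)
    then have "has_ord (\<lambda>z. 1) (e + of_int (-1) * e')"
      by (rule has_ord_cong) (use nz in auto)
    then show ?thesis using has_ord_one_nonpos by fastforce
  qed
  show ?thesis using *[OF assms] *[OF assms(2,1)] by simp
qed

section \<open>Nonvanishing forms and their orders at the cusps\<close>

text \<open>Invariance under the principal congruence subgroup of level L. Unlike invariance under
  \<open>Gamma0\<close>, the existence of some such L survives slashing with every integral matrix
  of positive determinant.\<close>

definition has_level :: "int \<Rightarrow> (complex \<Rightarrow> complex) \<Rightarrow> int \<Rightarrow> bool" where
  "has_level k F L \<longleftrightarrow> L > 0 \<and>
     (\<forall>a b c d. a * d - b * c = 1 \<and> L dvd a - 1 \<and> L dvd b \<and> L dvd c \<and> L dvd d - 1 \<longrightarrow>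
        (\<forall>z\<in>upper_half_plane. mslash k F a b c d z = F z))"

lemma has_levelI:
  assumes "L > 0" "\<And>a b c d z. a * d - b * c = 1 \<Longrightarrow> L dvd a - 1 \<Longrightarrow> L dvd b \<Longrightarrow> L dvd c \<Longrightarrow>
    L dvd d - 1 \<Longrightarrow> z \<in> upper_half_plane \<Longrightarrow> mslash k F a b c d z = F z"
  shows "has_level k F L"
  unfolding has_level_def using assms by simp

lemma has_levelD:
  "has_level k F L \<Longrightarrow> a * d - b * c = 1 \<Longrightarrow> L dvd a - 1 \<Longrightarrow> L dvd b \<Longrightarrow> L dvd c \<Longrightarrow> L dvd d - 1 \<Longrightarrow>
   z \<in> upper_half_plane \<Longrightarrow> mslash k F a b c d z = F z"
  unfolding has_level_def by simp

lemma has_level_pos: "has_level k F L \<Longrightarrow> L > 0"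
  by (simp add: has_level_def)

text \<open>
  For primitive $(a, c)$ the number \<open>\<epsilon> a c\<close> is the order of $F$ at the cusp $a/c$, measured in $q$.  The
  extension of \<open>\<epsilon>\<close> to all integral vectors is homogeneous of degree 2; with it the orders transform by a
  uniform rule under every matrix of positive determinant (lemma \<open>vform_slash\<close>).
\<close>

definition vform :: "int \<Rightarrow> (complex \<Rightarrow> complex) \<Rightarrow> (int \<Rightarrow> int \<Rightarrow> real) \<Rightarrow> bool" where
  "vform k F \<epsilon> \<longleftrightarrow> F holomorphic_on upper_half_plane \<and> (\<forall>z\<in>upper_half_plane. F z \<noteq> 0) \<and>
     (\<exists>L. has_level k F L) \<and>
     (\<forall>a b c d. a * d - b * c > 0 \<longrightarrow> has_ord (mslash k F a b c d) (\<epsilon> a c / of_int (a * d - b * c)))"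

lemma vform_holomorphic: "vform k F \<epsilon> \<Longrightarrow> F holomorphic_on upper_half_plane"
  and vform_nonzero: "vform k F \<epsilon> \<Longrightarrow> z \<in> upper_half_plane \<Longrightarrow> F z \<noteq> 0"
  and vform_has_ord: "vform k F \<epsilon> \<Longrightarrow> a * d - b * c > 0 \<Longrightarrow>
    has_ord (mslash k F a b c d) (\<epsilon> a c / of_int (a * d - b * c))"
  by (simp_all add: vform_def)

lemma vform_level:
  assumes "vform k F \<epsilon>"
  obtains L where "has_level k F L"
  using assms unfolding vform_def by blast

lemma vformI:
  assumes "F holomorphic_on upper_half_plane" "\<And>z. z \<in> upper_half_plane \<Longrightarrow> F z \<noteq> 0" "has_level k F L"
    "\<And>a b c d. a * d - b * c > 0 \<Longrightarrow> has_ord (mslash k F a b c d) (\<epsilon> a c / of_int (a * d - b * c))"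
  shows "vform k F \<epsilon>"
  unfolding vform_def using assms by auto

lemma vform_mult:
  assumes "vform k F \<epsilon>" "vform l G \<delta>"
  shows "vform (k + l) (\<lambda>z. F z * G z) (\<lambda>x y. \<epsilon> x y + \<delta> x y)"
proof -
  obtain L where L: "has_level k F L" using vform_level[OF assms(1)] .
  obtain L' where L': "has_level l G L'" using vform_level[OF assms(2)] .
  show ?thesis
  proof (rule vformI)
    show "has_level (k + l) (\<lambda>z. F z * G z) (L * L')"
    proof (rule has_levelI)
      show "mslash (k + l) (\<lambda>z. F z * G z) a b c d z = F z * G z"
        if "a * d - b * c = 1" "L * L' dvd a - 1" "L * L' dvd b" "L * L' dvd c" "L * L' dvd d - 1"
          "z \<in> upper_half_plane" for a b c d z
        using that has_levelD[OF L, of a d b c z] has_levelD[OF L', of a d b c z]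
          dvd_mult_left[of L L'] dvd_mult_right[of L L']
        by (subst mslash_mult) auto
    qed (use has_level_pos[OF L] has_level_pos[OF L'] in simp)
    show "has_ord (mslash (k + l) (\<lambda>z. F z * G z) a b c d) ((\<epsilon> a c + \<delta> a c) / of_int (a * d - b * c))"
      if "a * d - b * c > 0" for a b c d
      unfolding add_divide_distrib
      by (rule has_ord_cong[OF has_ord_mult[OF vform_has_ord[OF assms(1) that] vform_has_ord[OF assms(2) that]]])
         (rule mslash_mult[OF _ that, symmetric])
  qed (use vform_nonzero[OF assms(1)] vform_nonzero[OF assms(2)] vform_holomorphic[OF assms(1)]
      vform_holomorphic[OF assms(2)] in \<open>auto intro!: holomorphic_intros\<close>)
qed

lemma vform_powi:
  assumes "vform k F \<epsilon>"
  shows "vform (n * k) (\<lambda>z. F z powi n) (\<lambda>x y. of_int n * \<epsilon> x y)"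
proof -
  obtain L where L: "has_level k F L" using vform_level[OF assms(1)] .
  show ?thesis
  proof (rule vformI)
    show "has_level (n * k) (\<lambda>z. F z powi n) L"
      by (rule has_levelI[OF has_level_pos[OF L]]) (use has_levelD[OF L] in \<open>simp add: mslash_powi\<close>)
    show "has_ord (mslash (n * k) (\<lambda>z. F z powi n) a b c d) (of_int n * \<epsilon> a c / of_int (a * d - b * c))"
      if "a * d - b * c > 0" for a b c d
    proof -
      have "has_ord (mslash (n * k) (\<lambda>z. F z powi n) a b c d) (of_int n * (\<epsilon> a c / of_int (a * d - b * c)))"
        by (rule has_ord_cong[OF has_ord_powi[OF vform_has_ord[OF assms(1) that]]])
           (rule mslash_powi[OF _ that, symmetric])
      then show ?thesis by simp
    qed
  qed (use vform_nonzero[OF assms(1)] vform_holomorphic[OF assms(1)]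
      in \<open>auto intro!: holomorphic_intros\<close>)
qed

lemma vform_const:
  assumes "C \<noteq> 0"
  shows "vform 0 (\<lambda>_. C) (\<lambda>_ _. 0)"
  using assms by (intro vformI[where L = 1])
    (auto simp: mslash_def[abs_def] has_level_def intro: has_ord_const)

lemma vform_prod:
  assumes "finite A" "\<And>i. i \<in> A \<Longrightarrow> vform (k i) (F i) (\<epsilon> i)"
  shows "vform (\<Sum>i\<in>A. k i) (\<lambda>z. \<Prod>i\<in>A. F i z) (\<lambda>x y. \<Sum>i\<in>A. \<epsilon> i x y)"
  using assms
proof (induction A rule: finite_induct)
  case empty
  then show ?case using vform_const[of 1] by simp
next
  case (insert x A)
  then show ?case using vform_mult[of "k x" "F x" "\<epsilon> x"] by simp
qed

lemma vform_slash:
  assumes "vform k F \<epsilon>" "p * s - q * r > 0"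
  shows "vform k (mslash k F p q r s) (\<lambda>x y. \<epsilon> (p * x + q * y) (r * x + s * y) / of_int (p * s - q * r))"
proof -
  obtain L where L: "has_level k F L" using vform_level[OF assms(1)] .
  define D where "D = p * s - q * r"
  show ?thesis
  proof (rule vformI)
    have "mslash k (mslash k F p q r s) a b c d z = mslash k F p q r s z"
      if B: "a * d - b * c = 1" "L * D dvd a - 1" "L * D dvd b" "L * D dvd c" "L * D dvd d - 1"
        "z \<in> upper_half_plane" for a b c d z
    proof -
      obtain a1 b1 c1 d1 where e: "a = 1 + L * D * a1" "b = L * D * b1" "c = L * D * c1" "d = 1 + L * D * d1"
        using B unfolding dvd_def by (metis add_diff_cancel_left' diff_add_cancel add.commute)
      \<comment> \<open>With P = (p, q; r, s) and (a, b; c, d) = 1 + L D X, these are the entries of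
        P X adj P. Since P^-1 = adj P / D, conjugation by P turns 1 + L D X into 1 + L P X adj P,
        which is trivial modulo L.\<close>
      define X11 where "X11 = (p * a1 + q * c1) * s - (p * b1 + q * d1) * r"
      define X12 where "X12 = (p * b1 + q * d1) * p - (p * a1 + q * c1) * q"
      define X21 where "X21 = (r * a1 + s * c1) * s - (r * b1 + s * d1) * r"
      define X22 where "X22 = (r * b1 + s * d1) * p - (r * a1 + s * c1) * q"
      have tr: "X11 + X22 = D * (a1 + d1)" "X11 * X22 - X12 * X21 = D\<^sup>2 * (a1 * d1 - b1 * c1)"
        unfolding X11_def X12_def X21_def X22_def D_def by algebra+
      have "(1 + L * X11) * (1 + L * X22) - (L * X12) * (L * X21) =
          1 + L * (X11 + X22) + L\<^sup>2 * (X11 * X22 - X12 * X21)" by algebra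
      also have "\<dots> = a * d - b * c" unfolding tr e by algebra
      finally have det: "(1 + L * X11) * (1 + L * X22) - (L * X12) * (L * X21) = 1" using B by simp
      have "mslash k (mslash k F p q r s) a b c d z =
          mslash k F (p * a + q * c) (p * b + q * d) (r * a + s * c) (r * b + s * d) z"
        using mslash_mslash[OF B(6), of a d b c] B by simp
      also have "p * a + q * c = (1 + L * X11) * p + L * X12 * r"
        unfolding e X11_def X12_def D_def by algebra
      also have "p * b + q * d = (1 + L * X11) * q + L * X12 * s"
        unfolding e X11_def X12_def D_def by algebra
      also have "r * a + s * c = L * X21 * p + (1 + L * X22) * r"
        unfolding e X21_def X22_def D_def by algebra
      also have "r * b + s * d = L * X21 * q + (1 + L * X22) * s"
        unfolding e X21_def X22_def D_def by algebra
      also have "mslash k F ((1 + L * X11) * p + L * X12 * r) ((1 + L * X11) * q + L * X12 * s)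
         (L * X21 * p + (1 + L * X22) * r) (L * X21 * q + (1 + L * X22) * s) z =
         mslash k (mslash k F (1 + L * X11) (L * X12) (L * X21) (1 + L * X22)) p q r s z"
        using mslash_mslash[OF B(6) assms(2)] by simp
      also have "\<dots> = mslash k F p q r s z"
        by (rule mslash_cong[OF _ B(6) assms(2)], rule has_levelD[OF L det]) auto
      finally show ?thesis .
    qed
    then show "has_level k (mslash k F p q r s) (L * D)"
      using has_level_pos[OF L] assms(2) by (intro has_levelI) (auto simp: D_def)
    show "has_ord (mslash k (mslash k F p q r s) a b c d)
       (\<epsilon> (p * a + q * c) (r * a + s * c) / of_int (p * s - q * r) / of_int (a * d - b * c))"
      if det: "a * d - b * c > 0" for a b c d
    proof -
      have eq: "(p * a + q * c) * (r * b + s * d) - (p * b + q * d) * (r * a + s * c) =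
          (p * s - q * r) * (a * d - b * c)" by algebra
      have "has_ord (mslash k F (p * a + q * c) (p * b + q * d) (r * a + s * c) (r * b + s * d))
        (\<epsilon> (p * a + q * c) (r * a + s * c) / of_int ((p * s - q * r) * (a * d - b * c)))"
        using vform_has_ord[OF assms(1), of "p * a + q * c" "r * b + s * d" "p * b + q * d" "r * a + s * c"]
        unfolding eq using assms(2) det by simp
      then have "has_ord (mslash k (mslash k F p q r s) a b c d)
        (\<epsilon> (p * a + q * c) (r * a + s * c) / of_int ((p * s - q * r) * (a * d - b * c)))"
        by (rule has_ord_cong) (use mslash_mslash[OF _ det] in simp)
      then show ?thesis by (simp only: of_int_mult divide_divide_eq_left)
    qed
  qed (use assms mslash_nonzero[of F] vform_nonzero[OF assms(1)] vform_holomorphic[OF assms(1)]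
      in \<open>auto intro!: mslash_holomorphic\<close>)
qed

lemma vform_unique:
  assumes "vform k F \<epsilon>" "vform k F \<delta>" "a \<noteq> 0 \<or> c \<noteq> 0"
  shows "\<epsilon> a c = \<delta> a c"
proof -
  \<comment> \<open>The column (a, c) is completed to (a, -c; c, a), of determinant a^2 + c^2, so
    that it need not be primitive.\<close>
  have pos: "a * a - (- c) * c > 0"
    using assms(3) by (simp add: sum_squares_gt_zero_iff)
  show ?thesis
    using has_ord_unique[OF vform_has_ord[OF assms(1) pos] vform_has_ord[OF assms(2) pos]] pos assms(3)
    by auto
qed

lemma vform_cong:
  assumes "vform k F \<epsilon>" "\<And>z. z \<in> upper_half_plane \<Longrightarrow> F z = G z"
  shows "vform k G \<epsilon>"
proof -
  have eq: "mslash k F a b c d z = mslash k G a b c d z"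
    if "a * d - b * c > 0" "z \<in> upper_half_plane" for a b c d z
    by (rule mslash_cong[OF assms(2)]) (use that in auto)
  obtain L where L: "has_level k F L" using vform_level[OF assms(1)] .
  show ?thesis
  proof (rule vformI)
    show "G holomorphic_on upper_half_plane"
      using vform_holomorphic[OF assms(1)] assms(2) holomorphic_transform by blast
    show "has_level k G L"
      by (rule has_levelI[OF has_level_pos[OF L]])
         (use has_levelD[OF L] eq assms(2) in \<open>metis zero_less_one\<close>)
    show "has_ord (mslash k G a b c d) (\<epsilon> a c / of_int (a * d - b * c))"
      if "a * d - b * c > 0" for a b c d
      by (rule has_ord_cong[OF vform_has_ord[OF assms(1) that]]) (use eq that in auto)
  qed (use vform_nonzero[OF assms(1)] assms(2) in auto)
qed

section \<open>Forms of weight 0 with all orders 0 are constant\<close>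

lemma upper_half_plane_reduction:
  assumes "z \<in> upper_half_plane"
  obtains a b c d :: int and \<tau> where "a * d - b * c = 1" "Im \<tau> \<ge> 1 / 2"
    "z = (of_int a * \<tau> + of_int b) / (of_int c * \<tau> + of_int d)"
proof -
  have y: "Im z > 0" using assms by (simp add: in_H)
  define nf where "nf = (\<lambda>(c, d). norm (of_int c * z + of_int d))"
  \<comment> \<open>|cz + d| is minimised over the nonzero integral vectors. As (0, 1) has the value
    1, the minimum is attained on the finite set \<open>S\<close>.\<close>
  define S where "S = {(c::int, d::int). (c, d) \<noteq> (0, 0) \<and> nf (c, d) \<le> 1}"
  define B where "B = \<lceil>1 / Im z\<rceil>"
  define B' where "B' = \<lceil>1 + of_int B * norm z\<rceil>"
  have "S \<subseteq> {-B..B} \<times> {-B'..B'}"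
  proof (clarify, rule conjI)
    fix c d assume "(c, d) \<in> S"
    then have le: "norm (of_int c * z + of_int d) \<le> 1" by (simp add: S_def nf_def)
    have "\<bar>Im (of_int c * z + of_int d)\<bar> \<le> 1" using abs_Im_le_cmod le order_trans by blast
    then have "\<bar>of_int c\<bar> * Im z \<le> 1" using y by (simp add: abs_mult)
    then have "\<bar>of_int c\<bar> \<le> 1 / Im z" using y by (simp add: field_simps)
    also have "\<dots> \<le> of_int B" by (simp add: B_def)
    finally have cB: "\<bar>c\<bar> \<le> B" by linarith
    then show "c \<in> {-B..B}" by auto
    have "norm (of_int d :: complex) = norm (of_int c * z + of_int d - of_int c * z)" by simp
    also have "\<dots> \<le> 1 + norm (of_int c * z)" using norm_triangle_ineq4 le by (smt (verit))
    also have "norm (of_int c * z) \<le> of_int B * norm z"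
      using cB by (simp add: norm_mult mult_right_mono)
    also have "1 + of_int B * norm z \<le> of_int B'" by (simp add: B'_def)
    finally have "\<bar>d\<bar> \<le> B'" by simp
    then show "d \<in> {-B'..B'}" by auto
  qed
  then have fin: "finite S" by (rule finite_subset) auto
  have "(0, 1) \<in> S" by (simp add: S_def nf_def)
  then obtain v where v: "v \<in> S" "\<And>w. w \<in> S \<Longrightarrow> nf v \<le> nf w"
    using ex_min_if_finite[of "nf ` S"] fin by (metis arg_min_if_finite(1) arg_min_least empty_iff)
  obtain c d where cd: "v = (c, d)" by force
  have cd0: "(c, d) \<noteq> (0, 0)" "nf (c, d) \<le> 1" using v(1) by (auto simp: S_def cd)
  have min: "nf (c, d) \<le> nf (c', d')" if "(c', d') \<noteq> (0, 0)" for c' d'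
    using v(2)[of "(c', d')"] that cd0 unfolding cd by (cases "nf (c', d') \<le> 1") (auto simp: S_def)
  have nfpos: "nf (c, d) > 0"
  proof -
    have "of_int c * z + of_int d \<noteq> 0"
    proof
      assume *: "of_int c * z + of_int d = 0"
      then have "Im (of_int c * z + of_int d) = 0" by simp
      with y have "c = 0" by simp
      with * cd0 show False by simp
    qed
    then show ?thesis by (simp add: nf_def)
  qed
  have cop: "gcd c d = 1"
  proof -
    define g where "g = gcd c d"
    obtain c' d' where g: "c = g * c'" "d = g * d'" unfolding g_def by (meson dvdE gcd_dvd1 gcd_dvd2)
    have "g > 0" using cd0 by (simp add: g_def)
    have "of_int c * z + of_int d = of_int g * (of_int c' * z + of_int d')"
      unfolding g by (simp add: algebra_simps)
    then have "nf (c, d) = of_int g * nf (c', d')" using \<open>g > 0\<close> by (simp add: nf_def norm_mult)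
    moreover have "nf (c, d) \<le> nf (c', d')" using g cd0 by (intro min) auto
    ultimately have "of_int g * nf (c', d') \<le> nf (c', d')" "nf (c', d') > 0"
      using nfpos \<open>g > 0\<close> by (auto simp: zero_less_mult_iff)
    then have "g \<le> 1" by simp
    then show ?thesis using \<open>g > 0\<close> g_def by linarith
  qed
  obtain u w where uw: "u * c + w * d = 1" using bezout_int[of c d] cop by auto
  define t where "t = (of_int w * z - of_int u) / (of_int c * z + of_int d)"
  define n where "n = - round (Re t)"
  define \<tau> where "\<tau> = t + of_int n"
  define a where "a = w + n * c"
  define b where "b = - u + n * d"
  have det: "a * d - b * c = 1" using uw by (simp add: a_def b_def algebra_simps)
  have nz: "of_int c * z + of_int d \<noteq> 0" using nfpos by (auto simp: nf_def)
  have \<tau>: "\<tau> = (of_int a * z + of_int b) / (of_int c * z + of_int d)"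
    using nz by (simp add: \<tau>_def t_def a_def b_def field_simps)
  have "\<bar>Re \<tau>\<bar> \<le> 1 / 2"
    using of_int_round_abs_le[of "Re t"] by (simp add: \<tau>_def n_def abs_minus_commute)
  have "Im \<tau> > 0" using moebius_int_in_H[OF assms, of a d b c] det by (simp add: in_H \<tau>)
  \<comment> \<open>Otherwise |\<tau>| < 1, and the top row (a, b) would give a smaller value than
    the minimal (c, d). The bound 1/2 is cruder than that of the fundamental domain, but any
    positive constant serves the compactness argument.\<close>
  have "Im \<tau> \<ge> 1 / 2"
  proof (rule ccontr)
    assume "\<not> Im \<tau> \<ge> 1 / 2"
    then have "\<bar>Im \<tau>\<bar> < 1 / 2" using \<open>Im \<tau> > 0\<close> by simp
    then have "norm \<tau> < 1" using cmod_le[of \<tau>] \<open>\<bar>Re \<tau>\<bar> \<le> 1 / 2\<close> by linarith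
    moreover have "nf (a, b) = norm \<tau> * nf (c, d)"
      unfolding \<tau> nf_def using nz by (simp add: norm_divide)
    ultimately have "nf (a, b) < nf (c, d)" using nfpos by simp
    moreover have "(a, b) \<noteq> (0, 0)" using det by auto
    ultimately show False using min[of a b] by simp
  qed
  moreover have "z = (of_int d * \<tau> + of_int (- b)) / (of_int (- c) * \<tau> + of_int a)"
  proof -
    have \<tau>H: "\<tau> \<in> upper_half_plane" using \<open>Im \<tau> > 0\<close> by (simp add: in_H)
    have "of_int (- c) * \<tau> + of_int a \<noteq> 0"
      using cz_d_nonzero[of \<tau> d a "-b" "-c"] \<open>Im \<tau> > 0\<close> det by (simp add: mult.commute)
    moreover have "of_int d * \<tau> + of_int (- b) = z * (of_int (- c) * \<tau> + of_int a)"
    proof -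
      have "\<tau> * (of_int c * z + of_int d) = of_int a * z + of_int b" using \<tau> nz by simp
      then show ?thesis by (simp add: algebra_simps)
    qed
    ultimately show ?thesis by simp
  qed
  moreover have "d * a - (- b) * (- c) = 1" using det by (simp add: mult.commute)
  ultimately show ?thesis using that by blast
qed

text \<open>The maximum principle on the compactified quotient: all values of U are values of
  finitely many functions \<Phi> on closed discs inside the unit disc, one for each class of
  matrices modulo L. So the modulus of one \<open>\<Phi> B\<close> attains its maximum at an
  interior point.\<close>

theorem vform_zero_constant:
  assumes "vform 0 U (\<lambda>_ _. 0)"
  obtains C where "\<And>z. z \<in> upper_half_plane \<Longrightarrow> U z = C"
proof -
  obtain L where L: "has_level 0 U L" using vform_level[OF assms(1)] .
  define S where "S = {(a, b, c, d). a * d - b * c = (1::int)}"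
  define red where "red = (\<lambda>(a, b, c, d). (a mod L, b mod L, c mod L, d mod L))"
  define sl where "sl = (\<lambda>(a, b, c, d). mslash 0 U a b c d)"
  have "red ` S \<subseteq> {0..<L} \<times> {0..<L} \<times> {0..<L} \<times> {0..<L}"
    using has_level_pos[OF L] by (auto simp: red_def)
  then have "finite (red ` S)" by (rule finite_subset) auto
  then obtain R where R: "R \<subseteq> S" "finite R" "red ` S = red ` R"
    using finite_subset_image[of "red ` S" red S] by blast
  have sl_eq: "sl A z = sl B z" if "A \<in> S" "B \<in> S" "red A = red B" "z \<in> upper_half_plane" for A B z
  proof -
    obtain a b c d where A: "A = (a, b, c, d)" by (cases A) auto
    obtain a' b' c' d' where B: "B = (a', b', c', d')" by (cases B) auto
    have det: "a * d - b * c = 1" "a' * d' - b' * c' = 1" using that by (auto simp: A B S_def)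
    have "L dvd a - a'" "L dvd b - b'" "L dvd c - c'" "L dvd d - d'"
      using that(3) by (auto simp: A B red_def mod_eq_dvd_iff)
    then obtain x y u v where e: "a = a' + L * x" "b = b' + L * y" "c = c' + L * u" "d = d' + L * v"
      unfolding dvd_def by (metis add.commute diff_add_cancel)
    \<comment> \<open>C = A B^-1, which is congruent to 1 modulo L because A and B have the same
      reduction.\<close>
    define C11 where "C11 = a * d' - b * c'"
    define C12 where "C12 = b * a' - a * b'"
    define C21 where "C21 = c * d' - d * c'"
    define C22 where "C22 = d * a' - c * b'"
    have "C11 * C22 - C12 * C21 = (a * d - b * c) * (a' * d' - b' * c')"
      unfolding C11_def C12_def C21_def C22_def by algebra
    then have detC: "C11 * C22 - C12 * C21 = 1" using det by simp
    have "C11 - 1 = L * (x * d' - y * c')" "C12 = L * (y * a' - x * b')" "C21 = L * (u * d' - v * c')"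
      "C22 - 1 = L * (v * a' - u * b')"
      using det(2) unfolding C11_def C12_def C21_def C22_def e by algebra+
    then have "L dvd C11 - 1" "L dvd C12" "L dvd C21" "L dvd C22 - 1" by simp_all
    then have CU: "mslash 0 U C11 C12 C21 C22 z = U z" if "z \<in> upper_half_plane" for z
      using has_levelD[OF L detC] that by simp
    have "mslash 0 (mslash 0 U C11 C12 C21 C22) a' b' c' d' z = mslash 0 U (C11 * a' + C12 * c')
      (C11 * b' + C12 * d') (C21 * a' + C22 * c') (C21 * b' + C22 * d') z"
      using mslash_mslash[OF that(4)] det by simp
    moreover have "C11 * a' + C12 * c' = a" "C11 * b' + C12 * d' = b"
      "C21 * a' + C22 * c' = c" "C21 * b' + C22 * d' = d"
      unfolding C11_def C12_def C21_def C22_def using det(2) by algebra+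
    ultimately have "mslash 0 (mslash 0 U C11 C12 C21 C22) a' b' c' d' z = mslash 0 U a b c d z" by simp
    moreover have "mslash 0 (mslash 0 U C11 C12 C21 C22) a' b' c' d' z = mslash 0 U a' b' c' d' z"
      by (rule mslash_cong[OF CU]) (use that det in auto)
    ultimately show ?thesis by (simp add: A B sl_def)
  qed
  have "\<exists>h \<Phi>. h > 0 \<and> \<Phi> holomorphic_on ball 0 1 \<and> (\<forall>z\<in>upper_half_plane. sl A z = \<Phi> (qh h z))"
    if AS: "A \<in> S" for A
  proof -
    obtain a b c d where A: "A = (a, b, c, d)" by (cases A) auto
    have "a * d - b * c > 0" using AS by (simp add: A S_def)
    from vform_has_ord[OF assms this] have "has_ord (sl A) 0" by (simp add: A sl_def)
    then show ?thesis unfolding has_ord_def by auto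
  qed
  then obtain h \<Phi> where h: "\<And>A. A \<in> S \<Longrightarrow> h A > 0" "\<And>A. A \<in> S \<Longrightarrow> \<Phi> A holomorphic_on ball 0 1"
    "\<And>A z. A \<in> S \<Longrightarrow> z \<in> upper_half_plane \<Longrightarrow> sl A z = \<Phi> A (qh (h A) z)"
    by metis
  \<comment> \<open>The radius comes from |q_h| = exp(-2 pi Im \<tau> / h) and the bound Im \<tau>
    >= 1/2 of the reduction.\<close>
  define K where "K A = cball (0::complex) (exp (- pi / h A))" for A
  have K01: "K A \<subseteq> ball 0 1" if "A \<in> S" for A
    using h(1)[OF that] by (simp add: K_def cball_subset_ball_iff)
  have "\<exists>w\<in>K A. \<forall>u\<in>K A. norm (\<Phi> A u) \<le> norm (\<Phi> A w)" if "A \<in> S" for A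
  proof (rule continuous_attains_sup)
    show "continuous_on (K A) (\<lambda>w. norm (\<Phi> A w))"
      by (intro continuous_on_norm holomorphic_on_imp_continuous_on
          holomorphic_on_subset[OF h(2)[OF that] K01[OF that]])
  qed (auto simp: K_def)
  then obtain w where w: "\<And>A. A \<in> S \<Longrightarrow> w A \<in> K A"
    "\<And>A u. A \<in> S \<Longrightarrow> u \<in> K A \<Longrightarrow> norm (\<Phi> A u) \<le> norm (\<Phi> A (w A))"
    by metis
  have "(1, 0, 0, 1) \<in> S" by (simp add: S_def)
  then have "R \<noteq> {}" using R by auto
  define g where "g A = norm (\<Phi> A (w A))" for A
  have "Max (g ` R) \<in> g ` R" using R(2) \<open>R \<noteq> {}\<close> by (intro Max_in) auto
  then obtain B where BR: "B \<in> R" "Max (g ` R) = g B" by auto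
  have "g A \<le> g B" if "A \<in> R" for A unfolding BR(2)[symmetric] using R(2) that by (intro Max_ge) auto
  then have B: "B \<in> R" "\<And>A. A \<in> R \<Longrightarrow> norm (\<Phi> A (w A)) \<le> norm (\<Phi> B (w B))"
    using BR(1) by (simp_all add: g_def)
  have BS: "B \<in> S" using B R by auto
  have bound: "norm (U z) \<le> norm (\<Phi> B (w B))" if z: "z \<in> upper_half_plane" for z
  proof -
    obtain a b c d \<tau> where r: "a * d - b * c = 1" "Im \<tau> \<ge> 1 / 2"
      "z = (of_int a * \<tau> + of_int b) / (of_int c * \<tau> + of_int d)"
      by (rule upper_half_plane_reduction[OF z])
    have \<tau>: "\<tau> \<in> upper_half_plane" using r(2) by (simp add: in_H)
    have "(a, b, c, d) \<in> S" using r(1) by (simp add: S_def)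
    moreover from this obtain A where A: "A \<in> R" "red A = red (a, b, c, d)" using R(3) by (metis imageE imageI)
    moreover have AS: "A \<in> S" using A R by auto
    ultimately have "U z = sl A \<tau>" using sl_eq[of "(a, b, c, d)" A \<tau>] \<tau> by (simp add: sl_def mslash_def r(3))
    also have "\<dots> = \<Phi> A (qh (h A) \<tau>)" using h(3)[OF AS \<tau>] .
    also have "norm \<dots> \<le> norm (\<Phi> A (w A))"
    proof (rule w(2)[OF AS])
      have "- 2 * pi * Im \<tau> / h A \<le> - pi / h A" using r(2) h(1)[OF AS] by (simp add: divide_right_mono)
      then show "qh (h A) \<tau> \<in> K A" by (simp add: K_def norm_qh)
    qed
    also have "\<dots> \<le> norm (\<Phi> B (w B))" using B(2) A(1) by blast
    finally show ?thesis .
  qed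
  obtain a b c d where Beq: "B = (a, b, c, d)" by (cases B) auto
  have det: "a * d - b * c = 1" using BS by (simp add: Beq S_def)
  have "\<Phi> B constant_on ball 0 1"
  proof (rule maximum_modulus_principle[OF h(2)[OF BS] open_ball _ open_ball subset_refl])
    show "w B \<in> ball 0 1" using w(1)[OF BS] K01[OF BS] by blast
    fix u :: complex assume u: "u \<in> ball 0 1"
    show "norm (\<Phi> B u) \<le> norm (\<Phi> B (w B))"
    proof (cases "u = 0")
      case True
      then show ?thesis using w(2)[OF BS, of 0] by (simp add: K_def)
    next
      case False
      then obtain z where z: "z \<in> upper_half_plane" "u = qh (h B) z"
        using qh_surj[OF u] h(1)[OF BS] by blast
      have "\<Phi> B u = sl B z" using h(3)[OF BS z(1)] z(2) by simp
      also have "\<dots> = U ((of_int a * z + of_int b) / (of_int c * z + of_int d))"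
        by (simp add: sl_def Beq mslash_def)
      finally show ?thesis using bound[OF moebius_int_in_H[OF z(1), of a d b c]] det by simp
    qed
  qed auto
  then obtain C where C: "\<And>u. u \<in> ball 0 1 \<Longrightarrow> \<Phi> B u = C" unfolding constant_on_def by blast
  have "U z = C" if z: "z \<in> upper_half_plane" for z
  proof -
    \<comment> \<open>Slashing with B^-1 leads from the constant \<open>\<Phi> B\<close> back to
      U.\<close>
    have det': "d * a - (- b) * (- c) = 1" using det by (simp add: mult.commute)
    define t where "t = (of_int d * z + of_int (- b)) / (of_int (- c) * z + of_int a)"
    have t: "t \<in> upper_half_plane" unfolding t_def by (rule moebius_int_in_H[OF z]) (use det' in linarith)
    have "mslash 0 (sl B) d (- b) (- c) a z = mslash 0 U 1 0 0 1 z"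
      using mslash_mslash[OF z, of d a "-b" "-c" 0 U a b c d] det
      by (simp add: sl_def Beq algebra_simps)
    then have "U z = sl B t" by (simp add: mslash_def t_def)
    then show ?thesis using h(3)[OF BS t] C qh_in_ball[OF t h(1)[OF BS]] by simp
  qed
  then show ?thesis using that by blast
qed

section \<open>Expansions at infinity and Hecke operators\<close>

lemma q_expansion_factor:
  assumes "h > 0" "has_q_expansion F h a" "\<And>z. z \<in> upper_half_plane \<Longrightarrow> F z \<noteq> 0"
  obtains m \<Phi> where "a m \<noteq> 0" "\<And>n. n < m \<Longrightarrow> a n = 0" "\<Phi> holomorphic_on ball 0 1"
    "\<And>w. w \<in> ball 0 1 \<Longrightarrow> \<Phi> w \<noteq> 0" "\<And>w. w \<in> ball 0 1 \<Longrightarrow> (\<lambda>n. a (n + m) * w ^ n) sums \<Phi> w"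
    "\<And>z. z \<in> upper_half_plane \<Longrightarrow> F z = qh h z ^ m * \<Phi> (qh h z)"
proof -
  have sums: "(\<lambda>n. a n * qh h z ^ n) sums F z" if "z \<in> upper_half_plane" for z
    using assms(2) that by (simp add: has_q_expansion_def qh_def)
  have "\<exists>n. a n \<noteq> 0"
  proof (rule ccontr)
    assume "\<nexists>n. a n \<noteq> 0"
    then have "(\<lambda>n. 0) sums F \<i>" using sums[of \<i>] by (simp add: in_H)
    then show False using assms(3)[of \<i>] sums_unique2[OF sums_zero] by (auto simp: in_H)
  qed
  define m where "m = (LEAST n. a n \<noteq> 0)"
  have m: "a m \<noteq> 0" unfolding m_def using \<open>\<exists>n. a n \<noteq> 0\<close> by (rule LeastI_ex)
  have m': "a n = 0" if "n < m" for n using not_less_Least[of n "\<lambda>n. a n \<noteq> 0"] that by (auto simp: m_def)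
  define \<Phi> where "\<Phi> w = (\<Sum>n. a (n + m) * w ^ n)" for w
  have s: "(\<lambda>n. a (n + m) * qh h z ^ n) sums (F z / qh h z ^ m)" if z: "z \<in> upper_half_plane" for z
  proof -
    have "(\<lambda>n. a (n + m) * qh h z ^ (n + m)) sums F z"
      using sums[OF z] m' by (subst sums_iff_shift) simp
    from sums_divide[OF this, of "qh h z ^ m"] show ?thesis by (simp add: power_add)
  qed
  have \<Phi>: "(\<lambda>n. a (n + m) * w ^ n) sums \<Phi> w" if w: "w \<in> ball 0 1" for w
  proof (cases "w = 0")
    case True
    then show ?thesis unfolding \<Phi>_def using powser_sums_zero[of "\<lambda>n. a (n + m)"] by (simp add: sums_unique[symmetric])
  next
    case False
    then obtain z where "z \<in> upper_half_plane" "w = qh h z" using qh_surj w assms(1) by blast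
    with s show ?thesis unfolding \<Phi>_def by (simp add: sums_iff)
  qed
  have F: "F z = qh h z ^ m * \<Phi> (qh h z)" if z: "z \<in> upper_half_plane" for z
    using s[OF z] by (simp add: \<Phi>_def sums_iff field_simps)
  show ?thesis
  proof (rule that[OF m m' _ _ \<Phi> F])
    show "\<Phi> holomorphic_on ball 0 1"
      by (rule power_series_holomorphic[where a = "\<lambda>n. a (n + m)"]) (use \<Phi> in simp)
    show "\<Phi> w \<noteq> 0" if w: "w \<in> ball 0 1" for w
    proof (cases "w = 0")
      case True
      then show ?thesis using \<Phi>[OF w] powser_sums_zero[of "\<lambda>n. a (n + m)"] m sums_unique2 by fastforce
    next
      case False
      then obtain z where "z \<in> upper_half_plane" "w = qh h z" using qh_surj w assms(1) by blast
      with assms(3) F show ?thesis by force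
    qed
  qed
qed

lemma has_ord_q_expansion:
  assumes "h > 0" "has_q_expansion F h a" "\<And>z. z \<in> upper_half_plane \<Longrightarrow> F z \<noteq> 0"
  shows "\<exists>e. has_ord F e"
proof -
  obtain m \<Phi> where *: "\<Phi> holomorphic_on ball 0 1" "\<And>w. w \<in> ball 0 1 \<Longrightarrow> \<Phi> w \<noteq> 0"
    "\<And>z. z \<in> upper_half_plane \<Longrightarrow> F z = qh h z ^ m * \<Phi> (qh h z)"
    using q_expansion_factor[OF assms] by metis
  have "has_ord F (m / h)"
    by (rule has_ordI[OF assms(1) *(1,2)]) (simp_all add: *(3) qh_def flip: exp_of_nat_mult, simp add: field_simps)
  then show ?thesis ..
qed

section \<open>Orders of a modular form at all cusps\<close>

lemma slash_eq_mslash: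
  "slash k f (vector [vector [a, b], vector [c, d]]) = mslash k f a b c d"
  by (rule ext) (simp add: slash_def mslash_def moebius_act_def moebius_def)

lemma det_vector_2: "det (vector [vector [a, b], vector [c, d]] :: int^2^2) = a * d - b * c"
  by (simp add: det_2)

text \<open>A scalar matrix t acts on F by a constant and leaves the orders alone, while the rule
  for slashing divides by its determinant t^2.\<close>

lemma vform_homogeneous:
  assumes "vform k F \<epsilon>" "t > 0" "x \<noteq> 0 \<or> y \<noteq> 0"
  shows "\<epsilon> (t * x) (t * y) = (of_int t)\<^sup>2 * \<epsilon> x y"
proof -
  have "vform k (mslash k F t 0 0 t) (\<lambda>x y. \<epsilon> (t * x + 0 * y) (0 * x + t * y) / of_int (t * t - 0 * 0))"
    by (rule vform_slash[OF assms(1)]) (use assms in simp)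
  moreover have "(of_int t :: complex) powi k \<noteq> 0" using assms(2) by simp
  ultimately have "vform (0 + k) (\<lambda>z. of_int t powi k * mslash k F t 0 0 t z)
      (\<lambda>x y. 0 + \<epsilon> (t * x + 0 * y) (0 * x + t * y) / of_int (t * t - 0 * 0))"
    by (intro vform_mult vform_const)
  then have "vform k F (\<lambda>x y. \<epsilon> (t * x) (t * y) / of_int (t * t))"
    using assms(2) by (simp add: mslash_def power_int_minus field_simps)
  from vform_unique[OF this assms(1,3)] show ?thesis
    using assms(2) by (simp add: power2_eq_square field_simps)
qed

lemma vform_invariant:
  assumes "vform k F \<epsilon>" "p * s - q * r = 1" "\<And>z. z \<in> upper_half_plane \<Longrightarrow> mslash k F p q r s z = F z"
    "x \<noteq> 0 \<or> y \<noteq> 0"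
  shows "\<epsilon> (p * x + q * y) (r * x + s * y) = \<epsilon> x y"
proof -
  have "vform k (mslash k F p q r s) (\<lambda>x y. \<epsilon> (p * x + q * y) (r * x + s * y) / of_int (p * s - q * r))"
    by (rule vform_slash[OF assms(1)]) (use assms in simp)
  then have "vform k F (\<lambda>x y. \<epsilon> (p * x + q * y) (r * x + s * y))"
    unfolding assms(2) using vform_cong assms(3) by auto
  from vform_unique[OF this assms(1,4)] show ?thesis .
qed

lemma modular_forms_mslash_invariant:
  assumes "f \<in> modular_forms k N" "a * d - b * c = 1" "int N dvd c" "z \<in> upper_half_plane"
  shows "mslash k f a b c d z = f z"
proof -
  have "vector [vector [a, b], vector [c, d]] \<in> Gamma0 N"
    using assms by (simp add: Gamma0_def SL2Z_def det_vector_2)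
  then show ?thesis using assms(1,4) slash_eq_mslash[of k f a b c d] unfolding modular_forms_def by auto
qed

lemma primitive_decomposition:
  assumes "x \<noteq> 0 \<or> y \<noteq> (0::int)"
  obtains g x' y' where "g > 0" "x = g * x'" "y = g * y'" "coprime x' y'"
proof
  show "gcd x y > 0" "x = gcd x y * (x div gcd x y)" "y = gcd x y * (y div gcd x y)"
    using assms by auto
  show "coprime (x div gcd x y) (y div gcd x y)"
    using assms by (intro div_gcd_coprime) auto
qed

lemma modular_forms_vform:
  assumes "N > 0" "f \<in> modular_forms k N" "\<forall>z\<in>upper_half_plane. f z \<noteq> 0"
  obtains \<epsilon> where "vform k f \<epsilon>"
proof -
  have base: "\<exists>e. has_ord (mslash k f a b c d) e" if det: "a * d - b * c = 1" for a b c d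
  proof -
    have "vector [vector [a, b], vector [c, d]] \<in> SL2Z"
      using det by (simp add: SL2Z_def det_vector_2)
    then obtain h as where "h > 0" "has_q_expansion (mslash k f a b c d) h as"
      using assms(2) slash_eq_mslash[of k f a b c d] unfolding modular_forms_def by auto
    then show ?thesis
      by (rule has_ord_q_expansion) (use mslash_nonzero[of f] assms(3) det in auto)
  qed
  have "\<exists>e. \<forall>b d. a * d - b * c > 0 \<longrightarrow> has_ord (mslash k f a b c d) (e / of_int (a * d - b * c))" for a c
  proof (cases "a = 0 \<and> c = 0")
    case False
    obtain g x y where g: "g > 0" and xy: "a = g * x" "c = g * y" and "coprime x y"
      using primitive_decomposition[of a c] False by metis
    then obtain d0 b1 where "d0 * x + b1 * y = 1" using bezout_int[of x y] by (auto simp: coprime_iff_gcd_eq_1)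
    define b0 where "b0 = - b1"
    have det0: "x * d0 - b0 * y = 1" using \<open>d0 * x + b1 * y = 1\<close> by (simp add: b0_def algebra_simps)
    obtain e0 where e0: "has_ord (mslash k f x b0 y d0) e0" using base[OF det0] by blast
    show ?thesis
    proof (intro exI[of _ "e0 * (of_int g)\<^sup>2"] allI impI)
      fix b d assume D: "a * d - b * c > 0"
      \<comment> \<open>Every integral matrix of positive determinant with first column g (x, y) is
        (x, b0; y, d0) times (g, t; 0, u), so the single order e0 serves all b and d. The triangular
        factor scales it by g / u = g^2 / (g u).\<close>
      define t where "t = d0 * b - b0 * d"
      define u where "u = x * d - y * b"
      have Du: "a * d - b * c = g * u" by (simp add: xy u_def algebra_simps)
      then have u: "u > 0" using D g by (simp add: zero_less_mult_iff)
      have bd: "x * t + b0 * u = b" "y * t + d0 * u = d" unfolding t_def u_def using det0 by algebra+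
      have "has_ord (\<lambda>z. of_int u powi (- k) * mslash k f x b0 y d0 ((of_int g * z + of_int t) / of_int u)) (e0 * of_int g / of_int u)"
        by (rule has_ord_cmult[OF has_ord_affine[OF e0 g u]]) (use u in simp)
      then have "has_ord (mslash k (mslash k f x b0 y d0) g t 0 u) (e0 * of_int g / of_int u)"
        by (rule has_ord_cong) (simp add: mslash_def)
      moreover have "mslash k (mslash k f x b0 y d0) g t 0 u z = mslash k f a b c d z"
        if "z \<in> upper_half_plane" for z
      proof -
        have "g * u - t * 0 > 0" using g u by simp
        from mslash_mslash[OF that this, of k f x b0 y d0] show ?thesis
          by (simp only: bd mult_zero_right add_0_right xy mult.commute[of x g] mult.commute[of y g])
      qed
      ultimately have "has_ord (mslash k f a b c d) (e0 * of_int g / of_int u)" using has_ord_cong by blast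
      then show "has_ord (mslash k f a b c d) (e0 * (of_int g)\<^sup>2 / of_int (a * d - b * c))"
        unfolding Du using g by (simp add: power2_eq_square)
    qed
  qed auto
  then obtain \<epsilon> where \<epsilon>: "\<And>a b c d. a * d - b * c > 0 \<Longrightarrow> has_ord (mslash k f a b c d) (\<epsilon> a c / of_int (a * d - b * c))"
    by metis
  have "has_level k f (int N)"
    by (rule has_levelI) (use assms(1) modular_forms_mslash_invariant[OF assms(2)] in auto)
  then have "vform k f \<epsilon>"
    by (rule vformI[OF _ _ _ \<epsilon>, rotated 2]) (use assms in \<open>auto simp: modular_forms_def\<close>)
  then show ?thesis using that by blast
qed

text \<open>The coefficient \<open>l 0\<close> is redundant, as it can be absorbed into $C$.\<close>

definition logexp :: "(complex \<Rightarrow> complex) \<Rightarrow> real \<Rightarrow> (nat \<Rightarrow> complex) \<Rightarrow> bool" where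
  "logexp F m l \<longleftrightarrow> (\<exists>C \<Lambda>. C \<noteq> 0 \<and> (\<forall>w\<in>ball 0 1. (\<lambda>n. l n * w ^ n) sums \<Lambda> w) \<and>
     (\<forall>z\<in>upper_half_plane. F z = C * exp (2 * of_real pi * \<i> * of_real m * z + \<Lambda> (qh 1 z))))"

lemma logexpI:
  assumes "C \<noteq> 0" "\<And>w. w \<in> ball 0 1 \<Longrightarrow> (\<lambda>n. l n * w ^ n) sums \<Lambda> w"
    "\<And>z. z \<in> upper_half_plane \<Longrightarrow> F z = C * exp (2 * of_real pi * \<i> * of_real m * z + \<Lambda> (qh 1 z))"
  shows "logexp F m l"
  using assms unfolding logexp_def by blast

lemma logexpE:
  assumes "logexp F m l"
  obtains C \<Lambda> where "C \<noteq> 0" "\<And>w. w \<in> ball 0 1 \<Longrightarrow> (\<lambda>n. l n * w ^ n) sums \<Lambda> w"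
    "\<And>z. z \<in> upper_half_plane \<Longrightarrow> F z = C * exp (2 * of_real pi * \<i> * of_real m * z + \<Lambda> (qh 1 z))"
  using assms unfolding logexp_def by blast

lemma logexp_mult:
  assumes "logexp F m l" "logexp G m' l'"
  shows "logexp (\<lambda>z. F z * G z) (m + m') (\<lambda>n. l n + l' n)"
proof -
  obtain C \<Lambda> where F: "C \<noteq> 0" "\<And>w. w \<in> ball 0 1 \<Longrightarrow> (\<lambda>n. l n * w ^ n) sums \<Lambda> w"
    "\<And>z. z \<in> upper_half_plane \<Longrightarrow> F z = C * exp (2 * of_real pi * \<i> * of_real m * z + \<Lambda> (qh 1 z))"
    using logexpE[OF assms(1)] by blast
  obtain C' \<Lambda>' where G: "C' \<noteq> 0" "\<And>w. w \<in> ball 0 1 \<Longrightarrow> (\<lambda>n. l' n * w ^ n) sums \<Lambda>' w"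
    "\<And>z. z \<in> upper_half_plane \<Longrightarrow> G z = C' * exp (2 * of_real pi * \<i> * of_real m' * z + \<Lambda>' (qh 1 z))"
    using logexpE[OF assms(2)] by blast
  show ?thesis
    by (rule logexpI[where C = "C * C'" and \<Lambda> = "\<lambda>w. \<Lambda> w + \<Lambda>' w"])
       (use F G in \<open>auto simp: ring_distribs exp_add intro: sums_add\<close>)
qed

lemma logexp_powi:
  assumes "logexp F m l"
  shows "logexp (\<lambda>z. F z powi i) (of_int i * m) (\<lambda>n. of_int i * l n)"
proof -
  obtain C \<Lambda> where F: "C \<noteq> 0" "\<And>w. w \<in> ball 0 1 \<Longrightarrow> (\<lambda>n. l n * w ^ n) sums \<Lambda> w"
    "\<And>z. z \<in> upper_half_plane \<Longrightarrow> F z = C * exp (2 * of_real pi * \<i> * of_real m * z + \<Lambda> (qh 1 z))"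
    using logexpE[OF assms(1)] by blast
  show ?thesis
  proof (rule logexpI[where C = "C powi i" and \<Lambda> = "\<lambda>w. of_int i * \<Lambda> w"])
    show "F z powi i = C powi i * exp (2 * of_real pi * \<i> * of_real (of_int i * m) * z + of_int i * \<Lambda> (qh 1 z))"
      if "z \<in> upper_half_plane" for z
      unfolding F(3)[OF that] power_int_mult_distrib exp_power_int by (simp add: ring_distribs mult_ac)
    show "(\<lambda>n. of_int i * l n * w ^ n) sums (of_int i * \<Lambda> w)" if "w \<in> ball 0 1" for w
      using sums_mult[OF F(2)[OF that]] by (simp add: mult.assoc)
  qed (use F in auto)
qed

lemma logexp_const: "C \<noteq> 0 \<Longrightarrow> logexp (\<lambda>_. C) 0 (\<lambda>_. 0)"
  by (rule logexpI[where C = C and \<Lambda> = "\<lambda>_. 0"]) auto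

lemma logexp_cmult: "logexp F m l \<Longrightarrow> C \<noteq> 0 \<Longrightarrow> logexp (\<lambda>z. C * F z) m l"
  using logexp_mult[OF logexp_const] by fastforce

lemma logexp_compose_mult:
  assumes "logexp F m l" "p > 0"
  shows "logexp (\<lambda>z. F (of_nat p * z)) (of_nat p * m) (\<lambda>n. if p dvd n then l (n div p) else 0)"
proof -
  obtain C \<Lambda> where F: "C \<noteq> 0" "\<And>w. w \<in> ball 0 1 \<Longrightarrow> (\<lambda>n. l n * w ^ n) sums \<Lambda> w"
    "\<And>z. z \<in> upper_half_plane \<Longrightarrow> F z = C * exp (2 * of_real pi * \<i> * of_real m * z + \<Lambda> (qh 1 z))"
    using logexpE[OF assms(1)] by blast
  show ?thesis
  proof (rule logexpI[where C = C and \<Lambda> = "\<lambda>w. \<Lambda> (w ^ p)"])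
    show "F (of_nat p * z) = C * exp (2 * of_real pi * \<i> * of_real (of_nat p * m) * z + \<Lambda> (qh 1 z ^ p))"
      if "z \<in> upper_half_plane" for z
    proof -
      have "of_nat p * z \<in> upper_half_plane" using that assms(2) by (simp add: in_H)
      moreover have "qh 1 (of_nat p * z) = qh 1 z ^ p"
        by (simp add: qh_def mult_ac flip: exp_of_nat_mult)
      ultimately show ?thesis using F(3) by (simp add: mult_ac)
    qed
    show "(\<lambda>n. (if p dvd n then l (n div p) else 0) * w ^ n) sums \<Lambda> (w ^ p)" if w: "w \<in> ball 0 1" for w
    proof -
      have "(\<lambda>n. (if p dvd p * n then l (p * n div p) else 0) * w ^ (p * n)) sums \<Lambda> (w ^ p)"
        using F(2)[OF power_in_ball[OF w assms(2)]] assms(2) by (simp add: power_mult)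
      then show ?thesis
        by (subst (asm) sums_mono_reindex[where f = "\<lambda>n. (if p dvd n then l (n div p) else 0) * w ^ n"])
           (use assms(2) in \<open>auto simp: strict_mono_def\<close>)
    qed
  qed (use F in auto)
qed

lemma sum_roots_of_unity:
  assumes "p > 0"
  shows "(\<Sum>j<p. exp (2 * of_real pi * \<i> / of_nat p) ^ (j * n)) = (if p dvd n then of_nat p else (0::complex))"
proof -
  define x where "x = exp (2 * of_real pi * \<i> * of_nat n / of_nat p)"
  have x: "exp (2 * of_real pi * \<i> / of_nat p) ^ (j * n) = x ^ j" for j
    by (simp add: x_def flip: exp_of_nat_mult) (simp add: mult_ac)
  have "x ^ p = 1"
    using assms by (simp add: x_def flip: exp_of_nat_mult) (simp add: exp_eq_1, metis of_int_of_nat_eq mult.commute)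
  moreover have "x = 1 \<longleftrightarrow> p dvd n"
    unfolding x_def using complex_root_unity_eq_1[of p n] assms by (simp add: mult_ac)
  ultimately show ?thesis
    unfolding x by (auto simp: geometric_sum)
qed

text \<open>Summation over the p-th roots of unity retains only the exponents divisible by p: on
  logarithmic coefficients this is p times the classical operator U_p.\<close>

lemma logexp_prod_translates:
  assumes "logexp F m l" "p > 0"
  shows "logexp (\<lambda>z. \<Prod>j<p. F ((z + of_nat j) / of_nat p)) m (\<lambda>n. of_nat p * l (p * n))"
proof -
  obtain C \<Lambda> where F: "C \<noteq> 0" "\<And>w. w \<in> ball 0 1 \<Longrightarrow> (\<lambda>n. l n * w ^ n) sums \<Lambda> w"
    "\<And>z. z \<in> upper_half_plane \<Longrightarrow> F z = C * exp (2 * of_real pi * \<i> * of_real m * z + \<Lambda> (qh 1 z))"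
    using logexpE[OF assms(1)] by blast
  define \<zeta> where "\<zeta> = exp (2 * of_real pi * \<i> / of_nat p)"
  have "\<zeta> = exp (\<i> * of_real (2 * pi / p))" by (simp add: \<zeta>_def mult_ac)
  then have "norm \<zeta> = 1" by (simp only: norm_exp_i_times)
  have sums: "(\<lambda>n. of_nat p * l (p * n) * (u ^ p) ^ n) sums (\<Sum>j<p. \<Lambda> (\<zeta> ^ j * u))"
    if u: "u \<in> ball 0 1" for u
  proof -
    have "(\<lambda>n. \<Sum>j<p. l n * (\<zeta> ^ j * u) ^ n) sums (\<Sum>j<p. \<Lambda> (\<zeta> ^ j * u))"
      by (intro sums_sum F(2)) (use u \<open>norm \<zeta> = 1\<close> in \<open>auto simp: norm_mult norm_power\<close>)
    moreover have "(\<Sum>j<p. l n * (\<zeta> ^ j * u) ^ n) = (if p dvd n then of_nat p else 0) * l n * u ^ n" for n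
      unfolding sum_roots_of_unity[OF assms(2), of n, symmetric] \<zeta>_def[symmetric]
      by (simp add: sum_distrib_right sum_distrib_left power_mult_distrib power_mult mult_ac)
    ultimately have "(\<lambda>n. (if p dvd n then of_nat p else 0) * l n * u ^ n) sums (\<Sum>j<p. \<Lambda> (\<zeta> ^ j * u))" by simp
    then have "(\<lambda>n. (if p dvd p * n then of_nat p else 0) * l (p * n) * u ^ (p * n)) sums (\<Sum>j<p. \<Lambda> (\<zeta> ^ j * u))"
      by (subst sums_mono_reindex[where f = "\<lambda>n. (if p dvd n then of_nat p else 0) * l n * u ^ n"])
         (use assms(2) in \<open>auto simp: strict_mono_def\<close>)
    then show ?thesis by (simp add: power_mult)
  qed
  define \<Lambda>' where "\<Lambda>' w = (\<Sum>n. of_nat p * l (p * n) * w ^ n)" for w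
  have \<Lambda>'_eq: "\<Lambda>' (u ^ p) = (\<Sum>j<p. \<Lambda> (\<zeta> ^ j * u))" if "u \<in> ball 0 1" for u
    using sums[OF that] by (simp add: \<Lambda>'_def sums_iff)
  show ?thesis
  proof (rule logexpI[where C = "C ^ p * exp (\<Sum>j<p. 2 * of_real pi * \<i> * of_real m * of_nat j / of_nat p)"
        and \<Lambda> = \<Lambda>'])
    show "(\<lambda>n. of_nat p * l (p * n) * w ^ n) sums \<Lambda>' w" if w: "w \<in> ball 0 1" for w
    proof -
      \<comment> \<open>The sum is known only at points of the form u^p; every w in the disc is of
        this form.\<close>
      obtain u where u: "u \<in> ball 0 1" "w = u ^ p"
      proof (cases "w = 0")
        case True
        then show ?thesis using that[of 0] assms(2) by simp
      next
        case False
        then obtain z where z: "z \<in> upper_half_plane" "w = qh 1 z" using qh_surj w by (metis zero_less_one)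
        show ?thesis
        proof (rule that)
          show "qh p z \<in> ball 0 1" using qh_in_ball z assms(2) by blast
          show "w = qh p z ^ p" using qh_mult[of p 1 z] assms(2) z by simp
        qed
      qed
      show ?thesis using sums[OF u(1)] unfolding u(2) \<Lambda>'_eq[OF u(1)] .
    qed
    fix z assume z: "z \<in> upper_half_plane"
    have u: "qh p z \<in> ball 0 1" using qh_in_ball z assms(2) by blast
    have 1: "(\<Prod>j<p. F ((z + of_nat j) / of_nat p)) =
        (\<Prod>j<p. C * exp (2 * of_real pi * \<i> * of_real m * ((z + of_nat j) / of_nat p) + \<Lambda> (\<zeta> ^ j * qh p z)))"
    proof (rule prod.cong)
      fix j assume "j \<in> {..<p}"
      have "(z + of_nat j) / of_nat p \<in> upper_half_plane"
        using z assms(2) by (simp add: in_H Im_divide_of_nat)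
      moreover have "qh 1 ((z + of_nat j) / of_nat p) = \<zeta> ^ j * qh p z"
        by (simp add: qh_def \<zeta>_def flip: exp_of_nat_mult exp_add) (simp add: field_simps add_divide_distrib)
      ultimately show "F ((z + of_nat j) / of_nat p) =
          C * exp (2 * of_real pi * \<i> * of_real m * ((z + of_nat j) / of_nat p) + \<Lambda> (\<zeta> ^ j * qh p z))"
        using F(3) by simp
    qed simp
    have "(\<Sum>j<p. 2 * of_real pi * \<i> * of_real m * ((z + of_nat j) / of_nat p) + \<Lambda> (\<zeta> ^ j * qh p z)) =
       (\<Sum>j<p. 2 * of_real pi * \<i> * of_real m * z / of_nat p) + (\<Sum>j<p. 2 * of_real pi * \<i> * of_real m * of_nat j / of_nat p) +
       (\<Sum>j<p. \<Lambda> (\<zeta> ^ j * qh p z))"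
      by (simp only: ring_distribs add_divide_distrib times_divide_eq_right sum.distrib add.assoc)
    also have "(\<Sum>j<p. 2 * of_real pi * \<i> * of_real m * z / of_nat p) = 2 * of_real pi * \<i> * of_real m * z"
      using assms(2) by simp
    also have "(\<Sum>j<p. \<Lambda> (\<zeta> ^ j * qh p z)) = \<Lambda>' (qh 1 z)"
      using \<Lambda>'_eq[OF u] qh_mult[of p 1 z] assms(2) by simp
    finally have 2: "(\<Sum>j<p. 2 * of_real pi * \<i> * of_real m * ((z + of_nat j) / of_nat p) + \<Lambda> (\<zeta> ^ j * qh p z)) =
      2 * of_real pi * \<i> * of_real m * z + (\<Sum>j<p. 2 * of_real pi * \<i> * of_real m * of_nat j / of_nat p) + \<Lambda>' (qh 1 z)" .
    show "(\<Prod>j<p. F ((z + of_nat j) / of_nat p)) =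
       C ^ p * exp (\<Sum>j<p. 2 * of_real pi * \<i> * of_real m * of_nat j / of_nat p) *
       exp (2 * of_real pi * \<i> * of_real m * z + \<Lambda>' (qh 1 z))"
      unfolding 1 prod.distrib exp_sum[symmetric, OF finite_lessThan] 2 by (simp add: exp_add mult_ac)
  qed (use F(1) in simp)
qed

lemma logexp_imp_constant:
  assumes "logexp F 0 l" "\<And>n. n > 0 \<Longrightarrow> l n = 0"
  obtains C where "C \<noteq> 0" "\<And>z. z \<in> upper_half_plane \<Longrightarrow> F z = C"
proof -
  obtain C \<Lambda> where F: "C \<noteq> 0" "\<And>w. w \<in> ball 0 1 \<Longrightarrow> (\<lambda>n. l n * w ^ n) sums \<Lambda> w"
    "\<And>z. z \<in> upper_half_plane \<Longrightarrow> F z = C * exp (2 * of_real pi * \<i> * of_real 0 * z + \<Lambda> (qh 1 z))"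
    using logexpE[OF assms(1)] by blast
  have "\<Lambda> w = l 0" if "w \<in> ball 0 1" for w
  proof -
    have "(\<lambda>n. l n * w ^ n) = (\<lambda>n. if n = 0 then l 0 else 0)" using assms(2) by auto
    moreover have "(\<lambda>n. if n = 0 then l 0 else 0) sums l 0" using sums_single[of 0 "\<lambda>_. l 0"] by simp
    ultimately show ?thesis using F(2)[OF that] sums_unique2 by auto
  qed
  then show ?thesis using that[of "C * exp (l 0)"] F qh_in_ball[of _ 1] by simp
qed

text \<open>The exponent \<open>G\<close> has derivative 0 because exp G is constant. Its values at
  i and i + 1 differ by 2 pi i m, so m = 0, and then \<Lambda> itself is constant.\<close>

lemma logexp_constant:
  assumes "logexp F m l" "\<And>z. z \<in> upper_half_plane \<Longrightarrow> F z = c"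
  shows "m = 0" "n > 0 \<Longrightarrow> l n = 0"
proof -
  obtain C \<Lambda> where F: "C \<noteq> 0" "\<And>w. w \<in> ball 0 1 \<Longrightarrow> (\<lambda>n. l n * w ^ n) sums \<Lambda> w"
    "\<And>z. z \<in> upper_half_plane \<Longrightarrow> F z = C * exp (2 * of_real pi * \<i> * of_real m * z + \<Lambda> (qh 1 z))"
    using logexpE[OF assms(1)] by blast
  have hol: "\<Lambda> holomorphic_on ball 0 1"
    by (rule power_series_holomorphic[where a = l]) (use F(2) in simp)
  define G where "G z = 2 * of_real pi * \<i> * of_real m * z + \<Lambda> (qh 1 z)" for z
  have "(\<lambda>z. \<Lambda> (qh 1 z)) holomorphic_on upper_half_plane"
    by (rule holomorphic_on_compose_gen[OF _ hol, unfolded o_def])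
       (use qh_in_ball[of _ 1] in \<open>auto simp: qh_def[abs_def] intro!: holomorphic_intros\<close>)
  then have "G holomorphic_on upper_half_plane"
    unfolding G_def[abs_def] by (intro holomorphic_intros)
  then have der: "(G has_field_derivative deriv G z) (at z)" if "z \<in> upper_half_plane" for z
    using open_H that holomorphic_derivI by blast
  have expG: "exp (G z) = c / C" if "z \<in> upper_half_plane" for z
    using assms(2)[OF that] F(1) F(3)[OF that] by (simp add: G_def field_simps)
  have der0: "(G has_field_derivative 0) (at z)" if z: "z \<in> upper_half_plane" for z
  proof -
    have "((\<lambda>z. exp (G z)) has_field_derivative exp (G z) * deriv G z) (at z)"
      using der[OF z] by (auto intro!: derivative_eq_intros)
    moreover have "((\<lambda>z. exp (G z)) has_field_derivative 0) (at z)"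
      by (rule has_field_derivative_transform_within_open[OF DERIV_const[of "c / C"] open_H z])
         (simp add: expG)
    ultimately have "exp (G z) * deriv G z = 0" using DERIV_unique by blast
    then show ?thesis using der[OF z] by simp
  qed
  obtain K where K: "\<And>z. z \<in> upper_half_plane \<Longrightarrow> G z = K"
    using has_field_derivative_zero_constant[OF convex_H, of G] der0
    by (metis has_field_derivative_at_within)
  have qh1: "qh 1 (\<i> + 1) = qh 1 \<i>" by (simp add: qh_def ring_distribs exp_add)
  have "G (\<i> + 1) = G \<i>" using K by (simp add: in_H)
  then show m: "m = 0" by (simp add: G_def qh1[simplified] ring_distribs)
  have \<Lambda>K: "\<Lambda> w = K" if w: "w \<in> ball 0 1 - {0}" for w
  proof -
    obtain z where "z \<in> upper_half_plane" "w = qh 1 z" using qh_surj[of w 1] w by auto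
    then show ?thesis using K[of z] by (simp add: G_def m)
  qed
  have "continuous_on (ball 0 1) \<Lambda>" using hol by (rule holomorphic_on_imp_continuous_on)
  have ev: "\<forall>\<^sub>F w in at 0. \<Lambda> w = K"
    unfolding eventually_at by (rule exI[of _ 1]) (use \<Lambda>K in auto)
  have "isCont \<Lambda> 0" using \<open>continuous_on (ball 0 1) \<Lambda>\<close>
    by (simp add: continuous_on_eq_continuous_at)
  then have "(\<Lambda> \<longlongrightarrow> \<Lambda> 0) (at 0)" by (simp add: isCont_def)
  moreover have "(\<Lambda> \<longlongrightarrow> K) (at 0)" using ev tendsto_eventually by blast
  ultimately have "\<Lambda> 0 = K" using tendsto_unique trivial_limit_at by blast
  then have all: "\<Lambda> w = K" if "w \<in> ball 0 1" for w using \<Lambda>K that by (cases "w = 0") auto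
  have evb: "\<forall>\<^sub>F w in nhds 0. w \<in> ball (0::complex) 1" by (intro eventually_nhds_in_open) auto
  have "\<Lambda> has_fps_expansion Abs_fps l"
    by (rule has_fps_expansionI) (use evb in eventually_elim, use F(2) in simp)
  moreover have "\<Lambda> has_fps_expansion fps_const K"
  proof (rule has_fps_expansionI)
    show "\<forall>\<^sub>F u in nhds 0. (\<lambda>n. fps_nth (fps_const K) n * u ^ n) sums \<Lambda> u"
      using evb
    proof eventually_elim
      case (elim u)
      have "(\<lambda>n. fps_nth (fps_const K) n * u ^ n) = (\<lambda>n. if n = 0 then K else 0)" by auto
      moreover have "(\<lambda>n. if n = 0 then K else 0) sums K" using sums_single[of 0 "\<lambda>_. K"] by simp
      ultimately show ?case using all[OF elim] by simp
    qed
  qed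
  ultimately have eq: "Abs_fps l = fps_const K" by (rule fps_expansion_unique_complex)
  show "l n = 0" if "n > 0" 
    using that arg_cong[OF eq, of "\<lambda>F. fps_nth F n"] by simp
qed

section \<open>Multiplicative Hecke operators\<close>

definition heckeU :: "int \<Rightarrow> nat \<Rightarrow> (complex \<Rightarrow> complex) \<Rightarrow> complex \<Rightarrow> complex" where
  "heckeU k p F z = (\<Prod>j<p. mslash k F 1 (int j) 0 (int p) z)"

definition heckeT :: "int \<Rightarrow> nat \<Rightarrow> (complex \<Rightarrow> complex) \<Rightarrow> complex \<Rightarrow> complex" where
  "heckeT k p F z = mslash k F (int p) 0 0 1 z * heckeU k p F z"

text \<open>The orders of the Hecke transforms, read off from the matrices $(1, j; 0, p)$ and $(p, 0; 0, 1)$.\<close>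

definition ordU :: "nat \<Rightarrow> (int \<Rightarrow> int \<Rightarrow> real) \<Rightarrow> int \<Rightarrow> int \<Rightarrow> real" where
  "ordU p \<epsilon> x y = (\<Sum>j<p. \<epsilon> (x + int j * y) (int p * y)) / p"

definition ordT :: "nat \<Rightarrow> (int \<Rightarrow> int \<Rightarrow> real) \<Rightarrow> int \<Rightarrow> int \<Rightarrow> real" where
  "ordT p \<epsilon> x y = \<epsilon> (int p * x) y / p + ordU p \<epsilon> x y"

lemma vform_heckeU:
  assumes "vform k F \<epsilon>" "p > 0"
  shows "vform (int p * k) (heckeU k p F) (ordU p \<epsilon>)"
proof -
  have "vform (\<Sum>j<p. k) (\<lambda>z. \<Prod>j<p. mslash k F 1 (int j) 0 (int p) z)
      (\<lambda>x y. \<Sum>j<p. \<epsilon> (1 * x + int j * y) (0 * x + int p * y) / of_int (1 * int p - int j * 0))"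
    by (intro vform_prod vform_slash assms) (use assms in auto)
  then show ?thesis
    by (simp add: heckeU_def[abs_def] ordU_def[abs_def] sum_divide_distrib)
qed

lemma vform_heckeT:
  assumes "vform k F \<epsilon>" "p > 0"
  shows "vform ((int p + 1) * k) (heckeT k p F) (ordT p \<epsilon>)"
proof -
  have "vform k (mslash k F (int p) 0 0 1) (\<lambda>x y. \<epsilon> (int p * x + 0 * y) (0 * x + 1 * y) / of_int (int p * 1 - 0 * 0))"
    by (intro vform_slash assms) (use assms in auto)
  from vform_mult[OF this vform_heckeU[OF assms]] show ?thesis
    by (simp add: heckeT_def[abs_def] ordT_def[abs_def] algebra_simps)
qed

lemma logexp_heckeU:
  assumes "logexp F m l" "p > 0"
  shows "logexp (heckeU k p F) m (\<lambda>n. of_nat p * l (p * n))"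
proof -
  have "logexp (\<lambda>z. (\<Prod>j<p. of_nat p powi (- k)) * (\<Prod>j<p. F ((z + of_nat j) / of_nat p))) m (\<lambda>n. of_nat p * l (p * n))"
    by (rule logexp_cmult[OF logexp_prod_translates[OF assms]]) (use assms in simp)
  then show ?thesis
    by (simp only: heckeU_def[abs_def] mslash_def prod.distrib of_int_of_nat_eq of_int_0 of_int_1 mult_zero_left mult_1 add_0)
qed

lemma logexp_heckeT:
  assumes "logexp F m l" "p > 0"
  shows "logexp (heckeT k p F) ((of_nat p + 1) * m)
    (\<lambda>n. (if p dvd n then l (n div p) else 0) + of_nat p * l (p * n))"
proof -
  have "logexp (mslash k F (int p) 0 0 1) (of_nat p * m) (\<lambda>n. if p dvd n then l (n div p) else 0)"
    using logexp_compose_mult[OF assms] by (simp add: mslash_def[abs_def])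
  from logexp_mult[OF this logexp_heckeU[OF assms]] show ?thesis
    by (simp add: heckeT_def[abs_def] ring_distribs)
qed

section \<open>Invariance of the orders\<close>

lemma coprime_bezout_int:
  assumes "coprime a (b::int)"
  obtains u v where "u * a + v * b = 1"
  using bezout_int[of a b] assms by (auto simp: coprime_iff_gcd_eq_1)

lemma coprime_int_if_no_prime:
  assumes "\<And>q. prime q \<Longrightarrow> q dvd (a::int) \<Longrightarrow> q dvd b \<Longrightarrow> False" "b \<noteq> 0"
  shows "coprime a b"
proof (rule ccontr)
  assume "\<not> coprime a b"
  then have "\<not> is_unit (gcd a b)" by (simp add: coprime_iff_gcd_eq_1 is_unit_gcd)
  moreover have "gcd a b \<noteq> 0" using assms(2) by simp
  ultimately obtain q where "prime q" "q dvd gcd a b" using prime_divisor_exists by blast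
  with assms(1)[of q] show False by auto
qed

lemma add_mult_abs_pos:
  assumes "M > (0::int)"
  shows "a + M * (\<bar>a\<bar> + 1) > 0"
proof -
  have "0 < a + 1 * (\<bar>a\<bar> + 1)" by (cases "a \<ge> 0") auto
  also have "\<dots> \<le> a + M * (\<bar>a\<bar> + 1)"
    using assms by (intro add_left_mono mult_right_mono) auto
  finally show ?thesis .
qed

lemma coprime_translate:
  assumes "coprime x (y::int)"
  shows "coprime (x + j * y) y"
proof (rule coprimeI)
  fix c assume c: "c dvd x + j * y" "c dvd y"
  then have "c dvd (x + j * y) - j * y" by (intro dvd_diff dvd_mult)
  then show "is_unit c" using assms c(2) coprime_common_divisor by fastforce
qed

text \<open>Each prime of N divides exactly one of u and g * P, where \<open>P\<close> collects the
  primes of N that divide neither u nor g; so no prime of N divides the sum. A multiple of N then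
  makes s positive.\<close>

lemma unit_lift:
  assumes "coprime u g" "g dvd N" "N > (0::int)"
  obtains s where "g dvd s - u" "coprime s N" "s > 0"
proof -
  define A where "A = {q. prime q \<and> q dvd N \<and> \<not> q dvd u \<and> \<not> q dvd g}"
  have "finite A" by (rule finite_subset[OF _ finite_divisors_int[of N]]) (use assms in \<open>auto simp: A_def\<close>)
  define P where "P = \<Prod>A"
  define s0 where "s0 = u + g * P"
  have cop: "coprime s0 N"
  proof (rule coprime_int_if_no_prime)
    fix q assume q: "prime q" "q dvd s0" "q dvd N"
    show False
    proof (cases "q dvd u")
      case True
      then have "\<not> q dvd g" using assms(1) q(1) by (meson coprime_common_divisor not_prime_unit)
      moreover have "q dvd g * P" using q(2) True unfolding s0_def by (simp add: dvd_add_right_iff)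
      ultimately have "q dvd P" using q(1) prime_dvd_mult_iff by blast
      then obtain r where "r \<in> A" "q dvd r" unfolding P_def using prime_dvd_prod_iff[OF \<open>finite A\<close> q(1)] by auto
      then have "q = r" using q(1) primes_dvd_imp_eq by (auto simp: A_def)
      with \<open>r \<in> A\<close> True show False by (simp add: A_def)
    next
      case False
      have "q dvd g * P"
      proof (cases "q dvd g")
        case False
        with \<open>\<not> q dvd u\<close> q have "q \<in> A" by (simp add: A_def)
        then have "q dvd P" unfolding P_def using \<open>finite A\<close> dvd_prodI by fastforce
        then show ?thesis by simp
      qed simp
      then have "q dvd u" using q(2) unfolding s0_def by (simp add: dvd_add_left_iff)
      with False show False by simp
    qed
  qed (use assms in simp)
  define s where "s = s0 + N * (\<bar>s0\<bar> + 1)"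
  have "s > 0" unfolding s_def by (rule add_mult_abs_pos[OF assms(3)])
  moreover have "coprime s N"
    using coprime_translate[OF cop] unfolding s_def mult.commute[of N] .
  moreover have "g dvd s - u" unfolding s_def s0_def using assms(2) by simp
  ultimately show ?thesis using that by blast
qed

lemma prime_dvd_unique_translate:
  assumes "prime p" "\<not> int p dvd y"
  obtains j0 w where "j0 < p" "x + int j0 * y = int p * w"
    "\<And>j. j < p \<Longrightarrow> j \<noteq> j0 \<Longrightarrow> \<not> int p dvd x + int j * y"
proof -
  have p: "p > 0" "prime (int p)" using assms(1) by (auto simp: prime_gt_0_nat)
  have "coprime (int p) y" using assms(2) p(2) prime_imp_coprime by blast
  then obtain a b where ab: "a * int p + b * y = 1" using coprime_bezout_int by blast
  define j0 where "j0 = nat ((- b * x) mod int p)"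
  have j0: "int j0 = (- b * x) mod int p" "j0 < p" using p(1) by (auto simp: j0_def nat_less_iff)
  have "(- b * x) mod int p = - b * x - int p * ((- b * x) div int p)"
    using minus_mult_div_eq_mod[of "- b * x" "int p"] by simp
  then have w: "x + int j0 * y = int p * (a * x - (- b * x) div int p * y)"
    unfolding j0(1) using ab by algebra
  have "\<not> int p dvd x + int j * y" if j: "j < p" "j \<noteq> j0" for j
  proof
    assume "int p dvd x + int j * y"
    then have "int p dvd (x + int j * y) - (x + int j0 * y)" unfolding w by (rule dvd_diff) simp
    then have "int p dvd (int j - int j0) * y" by (simp add: algebra_simps)
    then have "int p dvd int j - int j0" using assms(2) p(2) prime_dvd_mult_iff by blast
    then show False using j j0(2) zdvd_imp_le[of "int p" "\<bar>int j - int j0\<bar>"] by auto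
  qed
  then show ?thesis using that j0(2) w by blast
qed

text \<open>The classical criterion for $(x, y)$ and $(x', y')$ to be equivalent as cusps of \<open>\<Gamma>\<^sub>0(N)\<close>; the
  residues $s$ and $t$ are inverse to each other.  It also makes sense for vectors that are only primitive
  modulo $N$.\<close>

definition cusp_rel :: "int \<Rightarrow> int \<Rightarrow> int \<Rightarrow> int \<Rightarrow> int \<Rightarrow> bool" where
  "cusp_rel N x y x' y' \<longleftrightarrow> (\<exists>s t j. N dvd s * t - 1 \<and> N dvd y' - s * y \<and> N dvd x' - (t * x + j * y))"

lemma cusp_relI: "N dvd s * t - 1 \<Longrightarrow> N dvd y' - s * y \<Longrightarrow> N dvd x' - (t * x + j * y) \<Longrightarrow> cusp_rel N x y x' y'"
  unfolding cusp_rel_def by blast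

lemma cusp_rel_refl: "cusp_rel N x y x y"
  by (rule cusp_relI[where s = 1 and t = 1 and j = 0]) auto

lemma cusp_rel_sym:
  assumes "cusp_rel N x y x' y'"
  shows "cusp_rel N x' y' x y"
proof -
  obtain s t j where "N dvd s * t - 1" "N dvd y' - s * y" "N dvd x' - (t * x + j * y)"
    using assms unfolding cusp_rel_def by blast
  then obtain a b c where e: "s * t - 1 = N * a" "y' - s * y = N * b" "x' - (t * x + j * y) = N * c"
    unfolding dvd_def by blast
  show ?thesis
  proof (rule cusp_relI[where s = t and t = s and j = "- s * j * t"])
    show "N dvd t * s - 1" using e(1) by (simp add: mult.commute)
    have "y - t * y' = N * (- a * y - t * b)" using e by algebra
    then show "N dvd y - t * y'" by simp
    have "x - (s * x' + - s * j * t * y') = N * (- s * c - a * x + s * j * (t * b + a * y))"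
      using e by algebra
    then show "N dvd x - (s * x' + - s * j * t * y')" by simp
  qed
qed

lemma cusp_rel_trans:
  assumes "cusp_rel N x y x' y'" "cusp_rel N x' y' x'' y''"
  shows "cusp_rel N x y x'' y''"
proof -
  obtain s t j where 1: "N dvd s * t - 1" "N dvd y' - s * y" "N dvd x' - (t * x + j * y)"
    using assms(1) unfolding cusp_rel_def by blast
  obtain s' t' j' where 2: "N dvd s' * t' - 1" "N dvd y'' - s' * y'" "N dvd x'' - (t' * x' + j' * y')"
    using assms(2) unfolding cusp_rel_def by blast
  show ?thesis
  proof (rule cusp_relI[where s = "s' * s" and t = "t' * t" and j = "t' * j + j' * s"])
    have eq: "s' * s * (t' * t) - 1 = (s' * t') * (s * t - 1) + (s' * t' - 1)" by algebra
    show "N dvd s' * s * (t' * t) - 1" unfolding eq using 1 2 by (intro dvd_add dvd_mult)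
    have eq: "y'' - s' * s * y = (y'' - s' * y') + s' * (y' - s * y)" by algebra
    show "N dvd y'' - s' * s * y" unfolding eq using 1 2 by (intro dvd_add dvd_mult)
    have eq: "x'' - (t' * t * x + (t' * j + j' * s) * y) =
      (x'' - (t' * x' + j' * y')) + t' * (x' - (t * x + j * y)) + j' * (y' - s * y)" by algebra
    show "N dvd x'' - (t' * t * x + (t' * j + j' * s) * y)"
      unfolding eq using 1 2 by (intro dvd_add dvd_mult)
  qed
qed

text \<open>Exactly one of the p vectors is divisible by p; it is p (w, y) and contributes p^2
  \<epsilon>(w, y) by homogeneity. The other p - 1 are primitive and share the value B. Division by
  p gives the two coefficients.\<close>

lemma ordU_not_dvd:
  assumes "\<And>t x y. t > 0 \<Longrightarrow> x \<noteq> 0 \<or> y \<noteq> 0 \<Longrightarrow> \<epsilon> (t * x) (t * y) = (of_int t)\<^sup>2 * \<epsilon> x y"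
    and "prime p" "\<not> int p dvd y" "coprime x y"
    and "\<And>j. coprime (x + int j * y) (int p * y) \<Longrightarrow> \<epsilon> (x + int j * y) (int p * y) = B"
  obtains j w where "x + int j * y = int p * w" "coprime w y" "ordU p \<epsilon> x y = p * \<epsilon> w y + (1 - 1 / p) * B"
proof -
  have p: "p > 0" "prime (int p)" using assms(2) by (auto simp: prime_gt_0_nat)
  obtain j0 w where j0: "j0 < p" "x + int j0 * y = int p * w"
    "\<And>j. j < p \<Longrightarrow> j \<noteq> j0 \<Longrightarrow> \<not> int p dvd x + int j * y"
    using prime_dvd_unique_translate[OF assms(2,3)] by metis
  have cop: "coprime (x + int j * y) y" for j using assms(4) by (rule coprime_translate)
  have cw: "coprime w y" using cop[of j0] unfolding j0(2) by simp
  have other: "\<epsilon> (x + int j * y) (int p * y) = B" if "j < p" "j \<noteq> j0" for j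
    using j0(3)[OF that] p(2) cop[of j] by (intro assms(5)) (simp add: coprime_commute prime_imp_coprime)
  have "(\<Sum>j<p. \<epsilon> (x + int j * y) (int p * y)) =
      \<epsilon> (x + int j0 * y) (int p * y) + (\<Sum>j\<in>{..<p} - {j0}. \<epsilon> (x + int j * y) (int p * y))"
    using j0(1) by (subst sum.remove[of _ j0]) auto
  also have "\<epsilon> (x + int j0 * y) (int p * y) = (of_nat p)\<^sup>2 * \<epsilon> w y"
    unfolding j0(2) using assms(1)[of "int p" w y] p(1) cw by fastforce
  also have "(\<Sum>j\<in>{..<p} - {j0}. \<epsilon> (x + int j * y) (int p * y)) = (\<Sum>j\<in>{..<p} - {j0}. B)"
    by (rule sum.cong) (use other in auto)
  also have "\<dots> = (of_nat p - 1) * B" using j0(1) p(1) by (simp add: of_nat_diff)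
  finally show ?thesis
    using that[OF j0(2) cw] p(1) by (simp add: ordU_def field_simps power2_eq_square)
qed

section \<open>Orders at the cusps of Gamma_0(N)\<close>

text \<open>What the combinatorics of cusps uses of a form, free of analysis. The vector (0, 0) is
  excluded because it is not a column of an invertible matrix, so a form says nothing about
  \<epsilon> there.\<close>

locale cusp_orders =
  fixes N :: int and \<epsilon> :: "int \<Rightarrow> int \<Rightarrow> real"
  assumes N_pos: "N > 0"
    and homogeneous: "\<And>t x y. t > 0 \<Longrightarrow> x \<noteq> 0 \<or> y \<noteq> 0 \<Longrightarrow> \<epsilon> (t * x) (t * y) = (of_int t)\<^sup>2 * \<epsilon> x y"
    and invariant: "\<And>a b c d x y. a * d - b * c = 1 \<Longrightarrow> N dvd c \<Longrightarrow> x \<noteq> 0 \<or> y \<noteq> 0 \<Longrightarrow>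
      \<epsilon> (a * x + b * y) (c * x + d * y) = \<epsilon> x y"
begin

text \<open>The two vectors are completed to \<gamma> = (x, b; y, d) and \<gamma>' = (x', b'; y',
  d') of determinant 1. The matrices carrying one vector to the other are \<gamma>' (1, k; 0, 1)
  \<gamma>^-1, with lower left entry y' d - y d' - k y y'. Some k makes it divisible by N once gcd(y
  y', N) divides y' d - y d'.\<close>

lemma ord_cusp_rel:
  assumes "coprime x y" "coprime x' y'" "cusp_rel N x y x' y'"
  shows "\<epsilon> x' y' = \<epsilon> x y"
proof -
  obtain s t j where r: "N dvd s * t - 1" "N dvd y' - s * y" "N dvd x' - (t * x + j * y)"
    using assms(3) unfolding cusp_rel_def by blast
  obtain d b0 where "d * x + b0 * y = 1" using coprime_bezout_int[OF assms(1)] .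
  then obtain b where b: "x * d - b * y = 1" using that[of "- b0"] by (simp add: algebra_simps)
  obtain d' b1 where "d' * x' + b1 * y' = 1" using coprime_bezout_int[OF assms(2)] .
  then obtain b' where b': "x' * d' - b' * y' = 1" using that[of "- b1"] by (simp add: algebra_simps)
  define G where "G = gcd (y * y') N"
  define g where "g = gcd y N"
  have GN: "G dvd N" "G dvd y * y'" by (auto simp: G_def)
  have gN: "g dvd N" "g dvd y" by (auto simp: g_def)
  have "g dvd y' - s * y" using r(2) gN(1) dvd_trans by blast
  then have "g dvd (y' - s * y) + s * y" using gN(2) by (intro dvd_add dvd_mult)
  then have gy': "g dvd y'" by simp
  \<comment> \<open>Modulo g, which divides y and y', the numbers d and d' are inverse to x and x',
    and x' = t x with t inverse to s.\<close>
  have gsd: "g dvd s * d - d'"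
  proof -
    have "s * d - d' = d * d' * (s * (x' - (t * x + j * y)) + x * (s * t - 1)) + d * d' * s * j * y
       - s * d * (b' * y') + d' * (b * y)"
      using b b' by algebra
    moreover have "g dvd x' - (t * x + j * y)" "g dvd s * t - 1" using r gN(1) dvd_trans by blast+
    moreover have "g dvd d * d' * (s * A + x * B) + d * d' * s * j * y - s * d * (b' * y') + d' * (b * y)"
      if "g dvd A" "g dvd B" for A B using that gN(2) gy' by simp
    ultimately show ?thesis by simp
  qed
  have Gy2: "G dvd y\<^sup>2"
  proof -
    have "y\<^sup>2 = t * (y * y') - t * y * (y' - s * y) - y\<^sup>2 * (s * t - 1)"
      by (simp add: power2_eq_square algebra_simps)
    moreover have "G dvd y' - s * y" "G dvd s * t - 1" using r GN dvd_trans by blast+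
    ultimately show ?thesis using GN(2) by (metis dvd_diff dvd_mult)
  qed
  have "G dvd y * g"
  proof -
    obtain u v where uv: "u * y + v * N = g" using bezout_int[of y N] unfolding g_def by blast
    have "y * g = u * y\<^sup>2 + v * y * N" unfolding uv[symmetric] by (simp add: power2_eq_square algebra_simps)
    then show ?thesis using Gy2 GN(1) by simp
  qed
  then have "G dvd y * (s * d - d')" using gsd by (meson dvd_trans mult_dvd_mono dvd_refl)
  moreover have "y' * d - y * d' = y * (s * d - d') + d * (y' - s * y)" by algebra
  moreover have "G dvd y' - s * y" using r GN dvd_trans by blast
  ultimately have "G dvd y' * d - y * d'" by simp
  then obtain q where q: "y' * d - y * d' = G * q" unfolding dvd_def by blast
  obtain u v where uv: "u * (y * y') + v * N = G" using bezout_int[of "y * y'" N] unfolding G_def by blast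
  \<comment> \<open>By Bezout for G this k solves k y y' = y' d - y d' modulo N.\<close>
  define k where "k = u * q"
  have c: "y' * d - (k * y' + d') * y = N * (v * q)"
    unfolding k_def using q uv by algebra
  have "\<epsilon> ((x' * d - (k * x' + b') * y) * x + ((k * x' + b') * x - x' * b) * y)
      ((y' * d - (k * y' + d') * y) * x + ((k * y' + d') * x - y' * b) * y) = \<epsilon> x y"
  proof (rule invariant)
    show "(x' * d - (k * x' + b') * y) * ((k * y' + d') * x - y' * b) -
       ((k * x' + b') * x - x' * b) * (y' * d - (k * y' + d') * y) = 1" using b b' by algebra
    show "x \<noteq> 0 \<or> y \<noteq> 0" using assms(1) by auto
  qed (simp add: c)
  moreover have "(x' * d - (k * x' + b') * y) * x + ((k * x' + b') * x - x' * b) * y = x'"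
    "(y' * d - (k * y' + d') * y) * x + ((k * y' + d') * x - y' * b) * y = y'"
    using b by algebra+
  ultimately show ?thesis by simp
qed

text \<open>As u inverts p modulo N, the two cusps are the images under <p>^-1 and <p>. The vectors
  (u x, y) and (p x, y) may fail to be primitive and are therefore replaced by related primitive
  ones. The p-fold term comes from the one divisible translate if p does not divide y, and from the
  matrix (p, 0; 0, 1) if it does.\<close>

lemma ordT_eq:
  assumes "prime p" "coprime (int p) N" "coprime x y" "N dvd int p * u - 1"
  obtains w1 w2 z1 z2 where "coprime w1 w2" "cusp_rel N (u * x) y w1 w2"
    "coprime z1 z2" "cusp_rel N (int p * x) y z1 z2"
    "ordT p \<epsilon> x y = p * \<epsilon> w1 w2 + \<epsilon> z1 z2"
proof -
  have p: "p > 0" "prime (int p)" using assms(1) by (auto simp: prime_gt_0_nat)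
  have up: "N dvd u * int p - 1" using assms(4) by (simp add: mult.commute)
  show ?thesis
  proof (cases "int p dvd y")
    case False
    have cz: "coprime (int p * x) y"
      using False assms(3) prime_imp_coprime[OF p(2)] by simp
    have "cusp_rel N (int p * x) y (x + int j * y) (int p * y)" for j
    proof (rule cusp_relI[where s = "int p" and t = u and j = j])
      have "x + int j * y - (u * (int p * x) + int j * y) = - x * (int p * u - 1)" by algebra
      then show "N dvd x + int j * y - (u * (int p * x) + int j * y)" using assms(4) by simp
    qed (use assms(4) in auto)
    then have o: "\<epsilon> (x + int j * y) (int p * y) = \<epsilon> (int p * x) y"
      if "coprime (x + int j * y) (int p * y)" for j using ord_cusp_rel[OF cz that] by blast
    obtain j0 w where w: "x + int j0 * y = int p * w" and cw: "coprime w y"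
      and U: "ordU p \<epsilon> x y = p * \<epsilon> w y + (1 - 1 / p) * \<epsilon> (int p * x) y"
      using ordU_not_dvd[where \<epsilon> = \<epsilon>, OF homogeneous assms(1) False assms(3) o] by metis
    have rw: "cusp_rel N (u * x) y w y"
    proof (rule cusp_relI[where s = 1 and t = 1 and j = "u * j0"])
      have "w - (1 * (u * x) + u * int j0 * y) = - w * (int p * u - 1)" using w by algebra
      then show "N dvd w - (1 * (u * x) + u * int j0 * y)" using assms(4) by simp
    qed auto
    \<comment> \<open>The share 1/p from the matrix (p, 0; 0, 1) and the share 1 - 1/p from the
      primitive translates add up to 1.\<close>
    have "ordT p \<epsilon> x y = p * \<epsilon> w y + \<epsilon> (int p * x) y"
      unfolding ordT_def U using p(1) by (simp add: field_simps)
    then show ?thesis using that cw rw cz cusp_rel_refl by blast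
  next
    case True
    then obtain y0 where y0: "y = int p * y0" unfolding dvd_def by blast
    have cxp: "coprime x (int p)" "coprime x y0" using assms(3) by (auto simp: y0)
    then have cz: "coprime x (int p * y)" using assms(3) by simp
    have rw: "cusp_rel N (u * x) y x y0"
    proof (rule cusp_relI[where s = u and t = "int p" and j = 0])
      have "y0 - u * y = - y0 * (int p * u - 1)" "x - (int p * (u * x) + 0 * y) = - x * (int p * u - 1)"
        unfolding y0 by algebra+
      then show "N dvd y0 - u * y" "N dvd x - (int p * (u * x) + 0 * y)" using assms(4) by auto
    qed (rule up)
    have rz: "cusp_rel N (int p * x) y x (int p * y)"
    proof (rule cusp_relI[where s = "int p" and t = u and j = 0])
      have "x - (u * (int p * x) + 0 * y) = - x * (int p * u - 1)" by algebra
      then show "N dvd x - (u * (int p * x) + 0 * y)" using assms(4) by auto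
    qed (use assms(4) in auto)
    have "\<epsilon> (x + int j * y) (int p * y) = \<epsilon> x (int p * y)" for j
    proof (rule ord_cusp_rel[OF cz])
      have "coprime (x + int j * y) y" using assms(3) by (rule coprime_translate)
      then show "coprime (x + int j * y) (int p * y)" by (auto simp: y0)
      show "cusp_rel N x (int p * y) (x + int j * y) (int p * y)"
      proof (rule cusp_relI[where s = 1 and t = 1 and j = "u * int j"])
        have "x + int j * y - (1 * x + u * int j * (int p * y)) = - (int j * y) * (int p * u - 1)" by algebra
        then show "N dvd x + int j * y - (1 * x + u * int j * (int p * y))" using assms(4) by auto
      qed auto
    qed
    then have "ordU p \<epsilon> x y = \<epsilon> x (int p * y)" unfolding ordU_def using p(1) by simp
    moreover have "\<epsilon> (int p * x) y = (of_nat p)\<^sup>2 * \<epsilon> x y0"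
      unfolding y0 using homogeneous[of "int p" x y0] p(1) cxp(2) by fastforce
    ultimately have "ordT p \<epsilon> x y = p * \<epsilon> x y0 + \<epsilon> x (int p * y)"
      unfolding ordT_def using p(1) by (simp add: power2_eq_square)
    then show ?thesis using that cxp(2) rw cz rz by blast
  qed
qed

text \<open>Invariance under <n>, which maps (x, y) to (n x, y). For n prime to N the image is
  primitive only modulo N, hence the quantification over primitive vectors in its class.\<close>

definition diamond_invariant :: "int \<Rightarrow> bool" where
  "diamond_invariant n \<longleftrightarrow> (\<forall>x y x' y'. coprime x y \<and> coprime x' y' \<and> cusp_rel N (n * x) y x' y' \<longrightarrow> \<epsilon> x' y' = \<epsilon> x y)"

text \<open>A and B are the orders at the images under <p>^-1 and <p>, which depend on p only modulo
  N. That q enters as an affine function is what makes any three primes of a class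
  dependent.\<close>

lemma ordT_residue_class:
  assumes "prime p" "coprime (int p) N" "coprime x y"
  obtains A B :: real where "\<And>q. prime q \<Longrightarrow> N dvd int p - int q \<Longrightarrow> ordT q \<epsilon> x y = q * A + B"
    "\<And>x' y'. coprime x' y' \<Longrightarrow> cusp_rel N (int p * x) y x' y' \<Longrightarrow> \<epsilon> x' y' = B"
proof -
  obtain u v where "u * int p + v * N = 1" using coprime_bezout_int[OF assms(2)] .
  then have u: "N dvd int p * u - 1" by (metis add_diff_cancel_left' dvd_minus_iff dvd_triv_right minus_diff_eq mult.commute)
  obtain w1 w2 z1 z2 where 1: "coprime w1 w2" "cusp_rel N (u * x) y w1 w2"
    "coprime z1 z2" "cusp_rel N (int p * x) y z1 z2" "ordT p \<epsilon> x y = p * \<epsilon> w1 w2 + \<epsilon> z1 z2"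
    using ordT_eq[OF assms u] by metis
  show ?thesis
  proof (rule that[of "\<epsilon> w1 w2" "\<epsilon> z1 z2"])
    show "\<epsilon> x' y' = \<epsilon> z1 z2" if "coprime x' y'" "cusp_rel N (int p * x) y x' y'" for x' y'
      by (rule ord_cusp_rel[OF 1(3) that(1)]) (rule cusp_rel_trans[OF cusp_rel_sym[OF 1(4)] that(2)])
    fix q assume q: "prime q" "N dvd int p - int q"
    have eq: "int q * u - 1 = (int p * u - 1) - u * (int p - int q)" by algebra
    have uq: "N dvd int q * u - 1" unfolding eq by (rule dvd_diff[OF u dvd_mult[OF q(2)]])
    have "coprime (int q) N"
    proof (rule coprimeI)
      fix c assume c: "c dvd int q" "c dvd N"
      then have "c dvd int q * u - 1" using uq dvd_trans by blast
      moreover have "c dvd int q * u" using c(1) by simp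
      ultimately have "c dvd int q * u - (int q * u - 1)" using dvd_diff by blast
      then show "is_unit c" by simp
    qed
    then obtain w1' w2' z1' z2' where 2: "coprime w1' w2'" "cusp_rel N (u * x) y w1' w2'"
      "coprime z1' z2'" "cusp_rel N (int q * x) y z1' z2'" "ordT q \<epsilon> x y = q * \<epsilon> w1' w2' + \<epsilon> z1' z2'"
      using ordT_eq[OF q(1) _ assms(3) uq] by metis
    have pqrel: "cusp_rel N (int q * x) y (int p * x) y"
    proof (rule cusp_relI[where s = 1 and t = 1 and j = 0])
      have "int p * x - (1 * (int q * x) + 0 * y) = x * (int p - int q)" by algebra
      then show "N dvd int p * x - (1 * (int q * x) + 0 * y)" using q(2) by simp
    qed auto
    have "\<epsilon> w1' w2' = \<epsilon> w1 w2"
      using 1 2 by (intro ord_cusp_rel) (auto intro: cusp_rel_trans cusp_rel_sym)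
    moreover have "\<epsilon> z1' z2' = \<epsilon> z1 z2"
      by (rule ord_cusp_rel[OF 1(3) 2(3)])
         (rule cusp_rel_trans[OF cusp_rel_sym[OF 1(4)] cusp_rel_trans[OF cusp_rel_sym[OF pqrel] 2(4)]])
    ultimately show "ordT q \<epsilon> x y = q * \<epsilon> w1 w2 + \<epsilon> z1 z2" using 2(5) by simp
  qed
qed

text \<open>After inserting p A + B and q A + B the number A cancels, and (q - p)(B - \<epsilon>(x,
  y)) = 0 remains.\<close>

lemma diamond_invariant_prime:
  assumes "prime p" "coprime (int p) N" "prime q" "q \<noteq> p" "N dvd int p - int q"
    "\<And>x y. x \<noteq> 0 \<or> y \<noteq> 0 \<Longrightarrow> q * ordT p \<epsilon> x y + p * \<epsilon> x y = p * ordT q \<epsilon> x y + q * \<epsilon> x y"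
  shows "diamond_invariant (int p)"
  unfolding diamond_invariant_def
proof (intro allI impI, elim conjE)
  fix x y x' y' assume xy: "coprime x y" "coprime x' y'" "cusp_rel N (int p * x) y x' y'"
  obtain A B :: real where AB: "\<And>q. prime q \<Longrightarrow> N dvd int p - int q \<Longrightarrow> ordT q \<epsilon> x y = q * A + B"
    "\<And>x' y'. coprime x' y' \<Longrightarrow> cusp_rel N (int p * x) y x' y' \<Longrightarrow> \<epsilon> x' y' = B"
    using ordT_residue_class[OF assms(1,2) xy(1)] by blast
  have pq: "ordT p \<epsilon> x y = p * A + B" "ordT q \<epsilon> x y = q * A + B"
    using AB(1)[of p] AB(1)[of q] assms by auto
  have "x \<noteq> 0 \<or> y \<noteq> 0" using xy(1) by auto
  from assms(6)[OF this] have "(real q - real p) * (\<epsilon> x' y' - \<epsilon> x y) = 0"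
    unfolding pq AB(2)[OF xy(2,3)] by (simp add: algebra_simps)
  then show "\<epsilon> x' y' = \<epsilon> x y" using assms(4) by simp
qed

text \<open>The residue n is represented by a positive m all of whose prime factors are good: m is n
  modulo N, and 1 modulo every exceptional prime. It is also 1 modulo the primes of y not dividing
  N, which keeps the vectors primitive while the primes of m are applied one after the
  other.\<close>

lemma diamond_invariant_all:
  assumes "finite {p::nat. prime p \<and> coprime (int p) N \<and> \<not> diamond_invariant (int p)}"
    and "coprime n N"
  shows "diamond_invariant n"
proof -
  have *: "\<epsilon> x' y' = \<epsilon> x y" if xy: "coprime x y" "coprime x' y'" "cusp_rel N (n * x) y x' y'" "y \<noteq> 0" for x y x' y'
  proof -
    define B where "B = {p::nat. prime p \<and> coprime (int p) N \<and> \<not> diamond_invariant (int p)}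
      \<union> {p. prime p \<and> coprime (int p) N \<and> p dvd nat \<bar>y\<bar>}"
    have "finite {p. p dvd nat \<bar>y\<bar>}" using xy(4) by (intro finite_divisors_nat) simp
    then have "finite {p. prime p \<and> coprime (int p) N \<and> p dvd nat \<bar>y\<bar>}"
      by (rule rev_finite_subset) auto
    then have "finite B" unfolding B_def using assms(1) by simp
    define Q where "Q = int (\<Prod>B)"
    have "coprime Q N" unfolding Q_def of_nat_prod by (rule prod_coprime_left) (auto simp: B_def)
    have "Q > 0" unfolding Q_def B_def by (auto intro!: prod_pos dest: prime_gt_0_nat)
    obtain u v where uv: "u * Q + v * N = 1" using coprime_bezout_int[OF \<open>coprime Q N\<close>] .
    \<comment> \<open>Chinese remainders: since u Q + v N = 1, this is n modulo N and 1 modulo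
      Q.\<close>
    define m0 where "m0 = n * u * Q + v * N"
    define m where "m = m0 + N * Q * (\<bar>m0\<bar> + 1)"
    have "m > 0" unfolding m_def by (rule add_mult_abs_pos) (use N_pos \<open>Q > 0\<close> in simp)
    have mN: "N dvd m - n"
    proof -
      have "m - n = N * (v - n * v + Q * (\<bar>m0\<bar> + 1))" unfolding m_def m0_def using uv by algebra
      then show ?thesis by simp
    qed
    have mQ: "Q dvd m - 1"
    proof -
      have "m - 1 = Q * (n * u - u + N * (\<bar>m0\<bar> + 1))" unfolding m_def m0_def using uv by algebra
      then show ?thesis by simp
    qed
    have good: "diamond_invariant (int p)" "coprime (int p) y" if p: "prime p" "p dvd nat m" for p
    proof -
      have pm: "int p dvd m" using p(2) \<open>m > 0\<close> by (simp add: int_dvd_int_iff[symmetric] del: int_dvd_int_iff)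
      have "p \<notin> B"
      proof
        assume "p \<in> B"
        then have "int p dvd Q" unfolding Q_def using \<open>finite B\<close> by (simp add: dvd_prodI)
        then have "int p dvd m - 1" using mQ dvd_trans by blast
        with pm have "int p dvd m - (m - 1)" using dvd_diff by blast
        with p(1) show False by auto
      qed
      moreover have "coprime (int p) N"
      proof (rule coprimeI)
        fix c assume c: "c dvd int p" "c dvd N"
        then have "c dvd m" "c dvd m - n" using pm mN dvd_trans by blast+
        then have "c dvd m - (m - n)" by (rule dvd_diff)
        then have "c dvd n" by simp
        then show "is_unit c" using assms(2) c(2) by (meson coprime_common_divisor)
      qed
      ultimately show "diamond_invariant (int p)" "coprime (int p) y"
        using p(1) prime_imp_coprime[of "int p" y] unfolding B_def by auto
    qed
    have step: "coprime (int k) y \<and> (\<forall>x. coprime x y \<longrightarrow> \<epsilon> (int k * x) y = \<epsilon> x y)"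
      if "k > 0" "\<And>p. prime p \<Longrightarrow> p dvd k \<Longrightarrow> diamond_invariant (int p) \<and> coprime (int p) y" for k
      using that
    proof (induction k rule: less_induct)
      case (less k)
      show ?case
      proof (cases "k = 1")
        case False
        then obtain p where p: "prime p" "p dvd k" using prime_factor_nat by blast
        then obtain k' where k': "k = p * k'" unfolding dvd_def by blast
        have IH: "coprime (int k') y \<and> (\<forall>x. coprime x y \<longrightarrow> \<epsilon> (int k' * x) y = \<epsilon> x y)"
          by (rule less.IH) (use less.prems p k' prime_gt_1_nat[OF p(1)] in auto)
        have pg: "diamond_invariant (int p)" "coprime (int p) y" using less.prems(2)[OF p] by auto
        show ?thesis
        proof (intro conjI allI impI)
          show "coprime (int k) y" using IH pg by (simp add: k')
          fix x assume "coprime x y"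
          then have c: "coprime (int k' * x) y" "coprime (int p * (int k' * x)) y" using IH pg by auto
          have "\<epsilon> (int p * (int k' * x)) y = \<epsilon> (int k' * x) y"
            using pg(1) c cusp_rel_refl unfolding diamond_invariant_def by blast
          then show "\<epsilon> (int k * x) y = \<epsilon> x y" using IH \<open>coprime x y\<close> by (simp add: k' mult.assoc)
        qed
      qed simp
    qed
    have st: "coprime m y" "\<epsilon> (m * x) y = \<epsilon> x y"
      using step[of "nat m"] good \<open>m > 0\<close> xy(1) by auto
    have "cusp_rel N (n * x) y (m * x) y"
    proof (rule cusp_relI[where s = 1 and t = 1 and j = 0])
      have "m * x - (1 * (n * x) + 0 * y) = x * (m - n)" by algebra
      then show "N dvd m * x - (1 * (n * x) + 0 * y)" using mN by simp
    qed auto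
    then have "\<epsilon> (m * x) y = \<epsilon> x' y'"
      using xy st(1) by (intro ord_cusp_rel) (auto intro: cusp_rel_trans cusp_rel_sym)
    then show ?thesis using st(2) by simp
  qed
  show ?thesis unfolding diamond_invariant_def
  proof (intro allI impI, elim conjE)
    fix x y x' y' assume xy: "coprime x y" "coprime x' y'" "cusp_rel N (n * x) y x' y'"
    show "\<epsilon> x' y' = \<epsilon> x y"
    proof (cases "y = 0")
      case True
      \<comment> \<open>The choice of m requires y to be nonzero; modulo N the vector (x, 0) may be
        replaced by (x, N).\<close>
      have rel: "cusp_rel N a y a N" for a
        by (rule cusp_relI[where s = 1 and t = 1 and j = 0]) (auto simp: True)
      have c: "coprime x N" using xy(1) True by (simp add: is_unit_left_imp_coprime)
      have "\<epsilon> x' y' = \<epsilon> x N"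
        by (rule *[OF c xy(2)]) (use rel xy(3) N_pos in \<open>auto intro: cusp_rel_trans cusp_rel_sym\<close>)
      also have "\<dots> = \<epsilon> x y" by (rule ord_cusp_rel[OF xy(1) c rel])
      finally show ?thesis .
    qed (use * xy in blast)
  qed
qed

end

locale diamond_cusp_orders = cusp_orders +
  assumes diamond: "\<And>n. coprime n N \<Longrightarrow> diamond_invariant n"
begin

lemma ord_diamond:
  "coprime n N \<Longrightarrow> coprime x y \<Longrightarrow> coprime x' y' \<Longrightarrow> cusp_rel N (n * x) y x' y' \<Longrightarrow> \<epsilon> x' y' = \<epsilon> x y"
  using diamond unfolding diamond_invariant_def by blast

lemma ordT_diamond:
  assumes "prime p" "coprime (int p) N" "coprime x y"
  shows "ordT p \<epsilon> x y = (p + 1) * \<epsilon> x y"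
proof -
  obtain u v where uv: "u * int p + v * N = 1" using coprime_bezout_int[OF assms(2)] .
  then have u: "N dvd int p * u - 1" by (metis add_diff_cancel_left' dvd_minus_iff dvd_triv_right minus_diff_eq mult.commute)
  have "coprime u N" using uv by (metis coprime_iff_gcd_eq_1 coprimeI dvd_add dvd_mult dvd_mult2)
  then show ?thesis
    using ordT_eq[OF assms u] ord_diamond assms(2,3) by (metis distrib_right mult_1 of_nat_1 of_nat_add)
qed

text \<open>A unit s modulo N with s = x modulo gcd(y, N) differs from x by a multiple of y modulo
  N. So (s, y) is equivalent to (x, y), and <s> leads from 1/y to x/y.\<close>

lemma ord_eq_denominator:
  assumes "coprime x y"
  shows "\<epsilon> x y = \<epsilon> 1 y"
proof -
  define g where "g = gcd y N"
  have "coprime x g" using assms unfolding g_def by (meson coprime_divisors dvd_refl gcd_dvd1)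
  then obtain s where s: "g dvd s - x" "coprime s N"
    using unit_lift[of x g N] N_pos unfolding g_def by auto
  obtain c where c: "s - x = g * c" using s(1) unfolding dvd_def by blast
  obtain u v where uv: "u * y + v * N = g" using bezout_int[of y N] unfolding g_def by blast
  show ?thesis
  proof (rule ord_diamond[OF s(2)])
    show "cusp_rel N (s * 1) y x y"
    proof (rule cusp_relI[where s = 1 and t = 1 and j = "- c * u"])
      have "x - (1 * (s * 1) + - c * u * y) = N * (- v * c)" using c uv by algebra
      then show "N dvd x - (1 * (s * 1) + - c * u * y)" by simp
    qed auto
  qed (use assms in auto)
qed

lemma ord_denominator_unit:
  assumes "coprime s N" "N dvd y' - s * y"
  shows "\<epsilon> 1 y' = \<epsilon> 1 y"
proof (rule ord_diamond[OF assms(1)])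
  obtain t v where "t * s + v * N = 1" using coprime_bezout_int[OF assms(1)] .
  then have t: "N dvd s * t - 1" by (metis add_diff_cancel_left' dvd_minus_iff dvd_triv_right minus_diff_eq mult.commute)
  show "cusp_rel N (s * 1) y 1 y'"
  proof (rule cusp_relI[where s = s and t = t and j = 0])
    have "1 - (t * (s * 1) + 0 * y) = - (s * t - 1)" by algebra
    then show "N dvd 1 - (t * (s * 1) + 0 * y)" using t by (simp only: dvd_minus_iff)
  qed (use assms(2) t in auto)
qed simp_all

text \<open>Write N = p^e g and choose a unit s modulo N with s = p modulo g. Then p^e y (p - s) is
  divisible by N, so the additional factor p acts like a unit.\<close>

lemma ord_denominator_prime_power:
  assumes "prime p"
  shows "\<epsilon> 1 (int p ^ (multiplicity (int p) N + 1) * y) = \<epsilon> 1 (int p ^ multiplicity (int p) N * y)"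
proof -
  define e where "e = multiplicity (int p) N"
  obtain g where g: "N = int p ^ e * g" "\<not> int p dvd g"
    unfolding e_def by (rule multiplicity_decompose'[of N "int p"]) (use N_pos assms in auto)
  have "coprime (int p) g" using g(2) assms prime_imp_coprime[of "int p" g] by simp
  then obtain s where s: "g dvd s - int p" "coprime s N"
    using unit_lift[of "int p" g N] N_pos g(1) by auto
  obtain c where c: "s - int p = g * c" using s(1) unfolding dvd_def by blast
  have "int p ^ (e + 1) * y - s * (int p ^ e * y) = - c * y * N"
    unfolding g(1) using c by (simp add: algebra_simps)
  then show ?thesis using ord_denominator_unit[OF s(2)] by (simp add: e_def)
qed

end

section \<open>U_p on orders that depend only on the denominator\<close>

definition orders_by_denominator :: "(int \<Rightarrow> int \<Rightarrow> real) \<Rightarrow> (int \<Rightarrow> real) \<Rightarrow> bool" where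
  "orders_by_denominator \<epsilon> \<phi> \<longleftrightarrow> (\<forall>t x y. t > 0 \<and> (x \<noteq> 0 \<or> y \<noteq> 0) \<longrightarrow> \<epsilon> (t * x) (t * y) = (of_int t)\<^sup>2 * \<epsilon> x y) \<and>
     (\<forall>x y. coprime x y \<longrightarrow> \<epsilon> x y = \<phi> y)"

text \<open>The effect of \<open>ordU\<close> at a cusp of denominator y. The second case adds up
  the one translate divisible by p and the p - 1 primitive ones.\<close>

definition denominatorU :: "nat \<Rightarrow> (int \<Rightarrow> real) \<Rightarrow> int \<Rightarrow> real" where
  "denominatorU p \<phi> y = (if int p dvd y then \<phi> (int p * y) else p * \<phi> y + (1 - 1 / p) * \<phi> (int p * y))"

lemma orders_by_denominator_ordU:
  assumes "orders_by_denominator \<epsilon> \<phi>" "prime p"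
  shows "orders_by_denominator (ordU p \<epsilon>) (denominatorU p \<phi>)"
proof -
  have p: "p > 0" "prime (int p)" using assms(2) by (auto simp: prime_gt_0_nat)
  have hom: "\<epsilon> (t * x) (t * y) = (of_int t)\<^sup>2 * \<epsilon> x y" if "t > 0" "x \<noteq> 0 \<or> y \<noteq> 0" for t x y
    using assms(1) that unfolding orders_by_denominator_def by blast
  have prim: "\<epsilon> x y = \<phi> y" if "coprime x y" for x y
    using assms(1) that unfolding orders_by_denominator_def by blast
  have "ordU p \<epsilon> (t * x) (t * y) = (of_int t)\<^sup>2 * ordU p \<epsilon> x y" if t: "t > 0" "x \<noteq> 0 \<or> y \<noteq> 0" for t x y
  proof -
    have "\<epsilon> (t * x + int j * (t * y)) (int p * (t * y)) = (of_int t)\<^sup>2 * \<epsilon> (x + int j * y) (int p * y)" for j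
    proof -
      have "t * x + int j * (t * y) = t * (x + int j * y)" "int p * (t * y) = t * (int p * y)"
        by (simp_all add: algebra_simps)
      moreover have "x + int j * y \<noteq> 0 \<or> int p * y \<noteq> 0" using t(2) p(1) by auto
      ultimately show ?thesis using hom[OF t(1), of "x + int j * y" "int p * y"]
        by (simp only: mult.left_commute[of "int p"])
    qed
    then show ?thesis by (simp add: ordU_def sum_distrib_left)
  qed
  moreover have "ordU p \<epsilon> x y = denominatorU p \<phi> y" if xy: "coprime x y" for x y
  proof (cases "int p dvd y")
    case True
    have "\<epsilon> (x + int j * y) (int p * y) = \<phi> (int p * y)" for j
    proof (rule prim)
      have "coprime (x + int j * y) y" using xy by (rule coprime_translate)
      then show "coprime (x + int j * y) (int p * y)"
        using True by (meson coprime_divisors coprime_mult_right_iff dvd_refl)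
    qed
    then show ?thesis using True p by (simp add: ordU_def denominatorU_def)
  next
    case False
    have o: "\<epsilon> (x + int j * y) (int p * y) = \<phi> (int p * y)" if "coprime (x + int j * y) (int p * y)" for j
      by (rule prim[OF that])
    obtain j0 w where "coprime w y" "ordU p \<epsilon> x y = p * \<epsilon> w y + (1 - 1 / p) * \<phi> (int p * y)"
      using ordU_not_dvd[where \<epsilon> = \<epsilon>, OF hom assms(2) False xy o] by metis
    then show ?thesis using prim[of w y] False by (simp add: denominatorU_def)
  qed
  ultimately show ?thesis unfolding orders_by_denominator_def by blast
qed

lemma orders_by_denominator_iterate:
  assumes "orders_by_denominator \<epsilon> \<phi>" "prime p"
  shows "orders_by_denominator ((ordU p ^^ k) \<epsilon>) ((denominatorU p ^^ k) \<phi>)"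
  by (induction k) (use assms orders_by_denominator_ordU in auto)

lemma denominatorU_iterate_dvd:
  assumes "int p dvd y"
  shows "(denominatorU p ^^ k) \<phi> y = \<phi> (int p ^ k * y)"
  using assms
proof (induction k arbitrary: y)
  case (Suc k)
  then have "(denominatorU p ^^ Suc k) \<phi> y = (denominatorU p ^^ k) \<phi> (int p * y)" by (simp add: denominatorU_def)
  also have "\<dots> = \<phi> (int p ^ k * (int p * y))" using Suc.IH[of "int p * y"] by simp
  finally show ?case by (simp add: mult_ac)
qed simp

text \<open>From the e-th iterate on, (U - 1)(U - p) = 0. If p divides y, the iterates take the
  values \<phi>(p^k y), which are constant for k >= e. Otherwise U - p leaves (1 - 1/p)
  \<phi>(p^(k+1) y), which is constant for k >= e as well.\<close>

lemma ordU_iterate_relation: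
  assumes "orders_by_denominator \<epsilon> \<phi>" "prime p" "\<And>y. \<phi> (int p ^ (e + 1) * y) = \<phi> (int p ^ e * y)"
    "x \<noteq> 0 \<or> y \<noteq> 0"
  shows "(ordU p ^^ (e + 2)) \<epsilon> x y - (p + 1) * (ordU p ^^ (e + 1)) \<epsilon> x y + p * (ordU p ^^ e) \<epsilon> x y = 0"
proof -
  have stable: "\<phi> (int p ^ (e + 2) * y) = \<phi> (int p ^ (e + 1) * y)" for y
    using assms(3)[of "int p * y"] by (simp add: mult_ac)
  have prim: "(denominatorU p ^^ (e + 2)) \<phi> y - (p + 1) * (denominatorU p ^^ (e + 1)) \<phi> y + p * (denominatorU p ^^ e) \<phi> y = 0" for y
  proof (cases "int p dvd y")
    case True
    then show ?thesis using denominatorU_iterate_dvd[OF True, of _ \<phi>] assms(3)[of y] stable[of y]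
      by (simp only:) (simp add: algebra_simps)
  next
    case False
    have rec: "(denominatorU p ^^ (k + 1)) \<phi> y = p * (denominatorU p ^^ k) \<phi> y + (1 - 1 / p) * \<phi> (int p ^ (k + 1) * y)" for k
      using False denominatorU_iterate_dvd[of p "int p * y" k \<phi>] by (simp add: denominatorU_def mult_ac)
    have "(denominatorU p ^^ (e + 2)) \<phi> y - p * (denominatorU p ^^ (e + 1)) \<phi> y =
        (denominatorU p ^^ (e + 1)) \<phi> y - p * (denominatorU p ^^ e) \<phi> y"
      using rec[of e] rec[of "e + 1"] stable[of y] by simp
    then show ?thesis by (simp add: algebra_simps)
  qed
  obtain g x' y' where g: "g > 0" and xy': "x = g * x'" "y = g * y'" and cop: "coprime x' y'"
    using primitive_decomposition[OF assms(4)] .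
  have eq: "(ordU p ^^ k) \<epsilon> x y = (of_int g)\<^sup>2 * (denominatorU p ^^ k) \<phi> y'" for k
    using orders_by_denominator_iterate[OF assms(1,2), of k] g cop assms(4) xy'
    unfolding orders_by_denominator_def by (metis mult_zero_right)
  have "(ordU p ^^ (e + 2)) \<epsilon> x y - (p + 1) * (ordU p ^^ (e + 1)) \<epsilon> x y + p * (ordU p ^^ e) \<epsilon> x y =
    (of_int g)\<^sup>2 * ((denominatorU p ^^ (e + 2)) \<phi> y' - (p + 1) * (denominatorU p ^^ (e + 1)) \<phi> y' + p * (denominatorU p ^^ e) \<phi> y')"
    unfolding eq by (simp add: algebra_simps)
  then show ?thesis using prim[of y'] by (simp only: mult_zero_right of_nat_add of_nat_1)
qed

lemma (in diamond_cusp_orders) orders_by_denominator: "orders_by_denominator \<epsilon> (\<epsilon> 1)"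
  unfolding orders_by_denominator_def using homogeneous ord_eq_denominator by blast

section \<open>Integral power series\<close>

text \<open>Moebius inversion as a recursion, which makes sense in every abelian group; it is used
  over the integers and over the complex numbers.\<close>

function divisor_inverse :: "(nat \<Rightarrow> 'a::ab_group_add) \<Rightarrow> nat \<Rightarrow> 'a" where
  "divisor_inverse A n = A n - (\<Sum>d | d dvd n \<and> d < n. divisor_inverse A d)"
  by auto
termination by (relation "Wellfounded.measure snd") auto

declare divisor_inverse.simps [simp del]

lemma sum_divisor_inverse:
  assumes "n > 0"
  shows "(\<Sum>d | d dvd n. divisor_inverse A d) = A n"
proof -
  have "{d. d dvd n} = insert n {d. d dvd n \<and> d < n}"
    using assms by (auto dest: dvd_imp_le simp: le_less)
  moreover have "finite {d. d dvd n \<and> d < n}" by simp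
  ultimately show ?thesis by (simp add: divisor_inverse.simps[of A n])
qed

lemma divisor_inverse_unique:
  assumes "\<And>n. n > 0 \<Longrightarrow> A n = (\<Sum>d | d dvd n. B d)" "n > 0"
  shows "B n = divisor_inverse A n"
  using assms(2)
proof (induction n rule: less_induct)
  case (less n)
  have "{d. d dvd n} = insert n {d. d dvd n \<and> d < n}"
    using less.prems by (auto dest: dvd_imp_le simp: le_less)
  moreover have "finite {d. d dvd n \<and> d < n}" by simp
  ultimately have "A n = B n + (\<Sum>d | d dvd n \<and> d < n. B d)"
    using assms(1)[OF less.prems] by simp
  also have "(\<Sum>d | d dvd n \<and> d < n. B d) = (\<Sum>d | d dvd n \<and> d < n. divisor_inverse A d)"
    using less by (intro sum.cong) (auto intro: dvd_pos_nat)
  finally show ?case by (simp add: divisor_inverse.simps[of A n])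
qed

text \<open>\<open>has_theta_log G A\<close> says that $A = q\,G'/G$, without dividing.\<close>

definition has_theta_log :: "'a::comm_ring_1 fps \<Rightarrow> 'a fps \<Rightarrow> bool" where
  "has_theta_log G A \<longleftrightarrow> fps_X * fps_deriv G = A * G"

lemma has_theta_log_one: "has_theta_log 1 0"
  by (simp add: has_theta_log_def)

lemma has_theta_log_mult:
  assumes "has_theta_log G A" "has_theta_log H B"
  shows "has_theta_log (G * H) (A + B)"
proof -
  have "fps_X * fps_deriv (G * H) = G * (fps_X * fps_deriv H) + (fps_X * fps_deriv G) * H"
    by (simp add: algebra_simps)
  also have "\<dots> = G * (B * H) + (A * G) * H" using assms by (simp only: has_theta_log_def)
  finally show ?thesis by (simp add: has_theta_log_def algebra_simps)
qed

lemma has_theta_log_power: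
  assumes "has_theta_log G A"
  shows "has_theta_log (G ^ r) (of_nat r * A)"
proof (induction r)
  case 0
  then show ?case using has_theta_log_one by simp
next
  case (Suc r)
  then show ?case using has_theta_log_mult[OF assms Suc] by (simp add: algebra_simps)
qed

lemma has_theta_log_inverse:
  assumes "has_theta_log G A" "G * H = 1"
  shows "has_theta_log H (- A)"
proof -
  have "0 = fps_X * fps_deriv (G * H)" using assms(2) by simp
  also have "\<dots> = G * (fps_X * fps_deriv H) + (fps_X * fps_deriv G) * H" by (simp add: algebra_simps)
  also have "\<dots> = G * (fps_X * fps_deriv H) + A" using assms by (simp add: has_theta_log_def mult.assoc)
  finally have "G * (fps_X * fps_deriv H) = - A" by (simp add: eq_neg_iff_add_eq_0)
  then have "(G * H) * (fps_X * fps_deriv H) = - A * H" by (metis mult.assoc mult.commute)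
  then show ?thesis unfolding assms(2) by (simp add: has_theta_log_def)
qed

lemma has_theta_log_nth:
  assumes "has_theta_log G A"
  shows "of_nat n * fps_nth G n = (\<Sum>i\<le>n. fps_nth A i * fps_nth G (n - i))"
proof -
  have "of_nat n * fps_nth G n = fps_nth (fps_X * fps_deriv G) n" by (cases n) auto
  also have "\<dots> = (\<Sum>i=0..n. fps_nth A i * fps_nth G (n - i))"
    using assms by (simp add: has_theta_log_def fps_mult_nth)
  finally show ?thesis by (simp add: atLeast0AtMost)
qed

definition fps_geom :: "nat \<Rightarrow> 'a::comm_ring_1 fps" where
  "fps_geom n = Abs_fps (\<lambda>j. if n dvd j then 1 else 0)"

lemma fps_geom_inverse:
  assumes "n > 0"
  shows "(1 - fps_X ^ n) * fps_geom n = 1"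
proof (rule fps_ext)
  fix j
  have "fps_nth ((1 - fps_X ^ n) * fps_geom n) j =
      fps_nth (fps_geom n) j - (if j < n then 0 else fps_nth (fps_geom n :: 'a fps) (j - n))"
    by (simp add: left_diff_distrib fps_X_power_mult_nth)
  also have "\<dots> = fps_nth 1 j"
    using assms by (auto simp: fps_geom_def dvd_minus_self dest: dvd_imp_le)
  finally show "fps_nth ((1 - fps_X ^ n) * fps_geom n) j = fps_nth (1 :: 'a fps) j" .
qed

lemma has_theta_log_cyc:
  assumes "n > 0"
  shows "has_theta_log (1 - fps_X ^ n :: 'a::comm_ring_1 fps) (- of_nat n * (fps_geom n - 1))"
proof -
  have "(fps_geom n - 1) * (1 - fps_X ^ n) = (1 - fps_X ^ n) * fps_geom n - (1 - fps_X ^ n :: 'a fps)"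
    by (simp add: algebra_simps)
  also have "\<dots> = fps_X ^ n" unfolding fps_geom_inverse[OF assms] by simp
  finally have "(- of_nat n * (fps_geom n - 1)) * (1 - fps_X ^ n) = - of_nat n * (fps_X ^ n :: 'a fps)"
    by (simp only: mult.assoc)
  moreover have "fps_X * fps_deriv (1 - fps_X ^ n :: 'a fps) = - of_nat n * fps_X ^ n"
    by (rule fps_ext) (auto simp: fps_of_nat[symmetric] fps_X_power_nth)
  ultimately show ?thesis by (simp add: has_theta_log_def)
qed

text \<open>K is (1 - X^n)^(-b/n), with an integral exponent because n divides b; its sign decides
  between powers of 1 - X^n and of the inverse \<open>fps_geom n\<close>.\<close>

lemma int_fps_with_theta_log_single:
  assumes "n > 0" "int n dvd b"
  obtains K :: "int fps" where "fps_nth K 0 = 1" "has_theta_log K (of_int b * (fps_geom n - 1))"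
proof -
  obtain r where r: "b = int n * r" using assms(2) by (elim dvdE)
  show ?thesis
  proof (cases "r \<ge> 0")
    case True
    show ?thesis
    proof (rule that)
      show "fps_nth (fps_geom n ^ nat r :: int fps) 0 = 1" by (simp add: fps_geom_def fps_nth_power_0)
      have "has_theta_log (fps_geom n ^ nat r :: int fps) (of_nat (nat r) * - (- of_nat n * (fps_geom n - 1)))"
        by (rule has_theta_log_power[OF has_theta_log_inverse[OF has_theta_log_cyc[OF assms(1)] fps_geom_inverse[OF assms(1)]]])
      moreover have "of_nat (nat r) = (of_int r :: int fps)" using True by (metis int_nat_eq of_int_of_nat_eq)
      ultimately show "has_theta_log (fps_geom n ^ nat r :: int fps) (of_int b * (fps_geom n - 1))"
        by (simp add: r algebra_simps)
    qed
  next
    case False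
    show ?thesis
    proof (rule that)
      show "fps_nth ((1 - fps_X ^ n) ^ nat (- r) :: int fps) 0 = 1"
        using assms(1) by (simp add: fps_nth_power_0 zero_power)
      have "has_theta_log ((1 - fps_X ^ n) ^ nat (- r) :: int fps) (of_nat (nat (- r)) * (- of_nat n * (fps_geom n - 1)))"
        by (rule has_theta_log_power[OF has_theta_log_cyc[OF assms(1)]])
      moreover have "of_nat (nat (- r)) = (of_int (- r) :: int fps)" using False
        by (metis int_nat_eq of_int_of_nat_eq linear neg_0_le_iff_le)
      ultimately show "has_theta_log ((1 - fps_X ^ n) ^ nat (- r) :: int fps) (of_int b * (fps_geom n - 1))"
        by (simp add: r algebra_simps)
    qed
  qed
qed

lemma int_fps_with_theta_log:
  assumes "\<And>i. 0 < i \<Longrightarrow> i < n \<Longrightarrow> int i dvd B i"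
  obtains K :: "int fps" where "fps_nth K 0 = 1"
    "has_theta_log K (\<Sum>i\<in>{0<..<n}. of_int (B i) * (fps_geom i - 1))"
proof -
  have "\<exists>K :: int fps. fps_nth K 0 = 1 \<and> has_theta_log K (\<Sum>i\<in>{0<..<n}. of_int (B i) * (fps_geom i - 1))"
    using assms
  proof (induction n)
    case 0
    then show ?case by (intro exI[of _ 1]) (simp add: has_theta_log_one)
  next
    case (Suc n)
    then obtain K :: "int fps" where K: "fps_nth K 0 = 1"
      "has_theta_log K (\<Sum>i\<in>{0<..<n}. of_int (B i) * (fps_geom i - 1))" by auto
    show ?case
    proof (cases "n = 0")
      case True
      moreover have "{0<..<Suc 0} = {}" by auto
      ultimately show ?thesis using K by (intro exI[of _ K]) simp
    next
      case False
      then obtain K' :: "int fps" where K': "fps_nth K' 0 = 1"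
        "has_theta_log K' (of_int (B n) * (fps_geom n - 1))"
        using int_fps_with_theta_log_single[of n "B n"] Suc.prems[of n] by auto
      have "{0<..<Suc n} = insert n {0<..<n}" using False by auto
      then show ?thesis using K K' has_theta_log_mult[OF K'(2) K(2)] by (intro exI[of _ "K' * K"]) simp
    qed
  qed
  then show ?thesis using that by blast
qed

lemma nth_sum_fps_geom:
  "fps_nth (\<Sum>i\<in>{0<..<n}. of_int (B i) * (fps_geom i - 1) :: int fps) j =
    (if j = 0 then 0 else (\<Sum>i | 0 < i \<and> i < n \<and> i dvd j. B i))"
proof -
  have "fps_nth (of_int b * (fps_geom i - 1) :: int fps) j = (if j = 0 then 0 else if i dvd j then b else 0)" for b i
    by (simp add: fps_of_int[symmetric] fps_geom_def)
  then have "fps_nth (\<Sum>i\<in>{0<..<n}. of_int (B i) * (fps_geom i - 1) :: int fps) j =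
      (\<Sum>i\<in>{0<..<n}. if j = 0 then 0 else if i dvd j then B i else 0)"
    by (simp only: fps_sum_nth)
  also have "\<dots> = (if j = 0 then 0 else (\<Sum>i\<in>{0<..<n} \<inter> {i. i dvd j}. B i))"
    by (simp add: sum.inter_restrict)
  also have "{0<..<n} \<inter> {i. i dvd j} = {i. 0 < i \<and> i < n \<and> i dvd j}" by auto
  finally show ?thesis .
qed

text \<open>Formally G is the product of the (1 - X^i)^(-B i / i). By induction the factors with i <
  n are integral, and multiplication by K removes them. The n-th coefficient of the logarithmic
  derivative of G * K is then B n, and it equals n times the n-th coefficient of the integral series
  G * K.\<close>

lemma dvd_divisor_inverse_theta_log:
  fixes G :: "int fps"
  assumes "fps_nth G 0 = 1" "has_theta_log G A" "n > 0"
  shows "int n dvd divisor_inverse (fps_nth A) n"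
  using assms(3)
proof (induction n rule: less_induct)
  case (less n)
  define B where "B = divisor_inverse (fps_nth A)"
  have "int i dvd - B i" if "0 < i" "i < n" for i using less.IH[of i] that by (simp add: B_def)
  then obtain K :: "int fps" where K: "fps_nth K 0 = 1"
    "has_theta_log K (\<Sum>i\<in>{0<..<n}. of_int (- B i) * (fps_geom i - 1))"
    using int_fps_with_theta_log[of n "\<lambda>i. - B i"] by blast
  define D where "D = A + (\<Sum>i\<in>{0<..<n}. of_int (- B i) * (fps_geom i - 1))"
  have GK: "has_theta_log (G * K) D" unfolding D_def by (rule has_theta_log_mult[OF assms(2) K(2)])
  have D0: "fps_nth D 0 = 0"
    using has_theta_log_nth[OF assms(2), of 0] assms(1) unfolding D_def by (simp add: nth_sum_fps_geom del: of_int_minus)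
  have Dj: "fps_nth D j = (if j < n then 0 else B n)" if j: "0 < j" "j \<le> n" for j
  proof -
    have "fps_nth D j = fps_nth A j - (\<Sum>i | 0 < i \<and> i < n \<and> i dvd j. B i)"
      unfolding D_def using j by (simp add: nth_sum_fps_geom sum_negf del: of_int_minus)
    also have "fps_nth A j = (\<Sum>i | i dvd j. B i)" unfolding B_def using sum_divisor_inverse[OF j(1)] by metis
    also have "{i. i dvd j} = (if j < n then {i. 0 < i \<and> i < n \<and> i dvd j} else insert n {i. 0 < i \<and> i < n \<and> i dvd j})"
      using j by (auto dest: dvd_imp_le intro: dvd_pos_nat)
    finally show ?thesis by (cases "j < n") simp_all
  qed
  have "int n * fps_nth (G * K) n = (\<Sum>i\<le>n. fps_nth D i * fps_nth (G * K) (n - i))"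
    using has_theta_log_nth[OF GK, of n] by simp
  also have "\<dots> = (\<Sum>i\<in>{n}. fps_nth D i * fps_nth (G * K) (n - i))"
  proof (rule sum.mono_neutral_right)
    show "\<forall>i\<in>{..n} - {n}. fps_nth D i * fps_nth (G * K) (n - i) = 0"
      using D0 Dj by (metis DiffD1 DiffD2 atMost_iff gr0I insertI1 le_neq_implies_less mult_zero_left insert_iff)
  qed auto
  also have "\<dots> = B n" using Dj[of n] less.prems K(1) assms(1) by simp
  finally show ?case unfolding B_def by (metis dvd_triv_left)
qed

text \<open>In terms of divisor sums only the divisors d of p n that do not divide n survive. These
  are multiples of p, and d divides the term B d.\<close>

lemma prime_dvd_theta_log_diff:
  fixes G :: "int fps"
  assumes "fps_nth G 0 = 1" "has_theta_log G A" "prime p" "n > 0"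
  shows "int p dvd fps_nth A (p * n) - fps_nth A n"
proof -
  define B where "B = divisor_inverse (fps_nth A)"
  have p: "p > 0" using assms(3) by (rule prime_gt_0_nat)
  have "fps_nth A (p * n) - fps_nth A n = (\<Sum>d | d dvd p * n. B d) - (\<Sum>d | d dvd n. B d)"
    unfolding B_def using sum_divisor_inverse[of "p * n" "fps_nth A"] sum_divisor_inverse[of n "fps_nth A"] assms(4) p by simp
  also have "\<dots> = (\<Sum>d \<in> {d. d dvd p * n} - {d. d dvd n}. B d)"
    by (subst sum_diff) (use assms(4) p in \<open>auto intro: finite_divisors_nat\<close>)
  also have "int p dvd \<dots>"
  proof (rule dvd_sum)
    fix d assume d: "d \<in> {d. d dvd p * n} - {d. d dvd n}"
    have "p dvd d"
    proof (rule ccontr)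
      assume "\<not> p dvd d"
      then have "coprime d p" using assms(3) prime_imp_coprime coprime_commute by blast
      then show False using d coprime_dvd_mult_right_iff by blast
    qed
    moreover have "d > 0" using d assms(4) p by (metis DiffD1 dvd_pos_nat mem_Collect_eq nat_0_less_mult_iff)
    then have "int d dvd B d" unfolding B_def by (rule dvd_divisor_inverse_theta_log[OF assms(1,2)])
    ultimately show "int p dvd B d" by (meson dvd_trans int_dvd_int_iff)
  qed
  finally show ?thesis .
qed

text \<open>Fermat's little theorem, from the previous lemma for the series $1 - cX$.\<close>

lemma fermat_power_diff:
  assumes "prime p" "n > 0"
  shows "int p dvd c ^ (p * n) - c ^ n"
proof -
  define G :: "int fps" where "G = 1 - fps_const c * fps_X"
  define A where "A = Abs_fps (\<lambda>n. if n = 0 then 0 else - (c ^ n))"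
  have "has_theta_log G A" unfolding has_theta_log_def
  proof (rule fps_ext)
    fix n
    have "A * G = A - fps_const c * (fps_X * A)" by (simp add: G_def algebra_simps)
    then have "fps_nth (A * G) n = fps_nth A n - c * (if n = 0 then 0 else fps_nth A (n - 1))"
      by simp
    also have "\<dots> = (if n = 1 then - c else 0)"
    proof (cases n)
      case (Suc k)
      then show ?thesis by (cases k) (simp_all add: A_def)
    qed (simp add: A_def)
    finally show "fps_nth (fps_X * fps_deriv G) n = fps_nth (A * G) n"
      by (cases n) (auto simp: G_def)
  qed
  moreover have "fps_nth G 0 = 1" by (simp add: G_def)
  ultimately have "int p dvd fps_nth A (p * n) - fps_nth A n" using assms by (intro prime_dvd_theta_log_diff)
  moreover have "p * n \<noteq> 0" using assms prime_gt_0_nat by auto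
  ultimately have "int p dvd - (c ^ (p * n) - c ^ n)" using assms(2) by (simp add: A_def)
  then show ?thesis by (simp only: dvd_minus_iff)
qed

section \<open>Integral series inside complex series, and Gauss's lemma\<close>

definition fps_of_int_fps :: "int fps \<Rightarrow> complex fps" where
  "fps_of_int_fps F = Abs_fps (\<lambda>n. of_int (fps_nth F n))"

lemma fps_of_int_fps_nth [simp]: "fps_nth (fps_of_int_fps F) n = of_int (fps_nth F n)"
  by (simp add: fps_of_int_fps_def)

lemma fps_of_int_fps_mult: "fps_of_int_fps (F * G) = fps_of_int_fps F * fps_of_int_fps G"
  by (rule fps_ext) (simp add: fps_mult_nth)

lemma fps_of_int_fps_power: "fps_of_int_fps (F ^ n) = fps_of_int_fps F ^ n"
proof (induction n)
  case 0
  then show ?case by (intro fps_ext) simp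
next
  case (Suc n)
  then show ?case by (simp add: fps_of_int_fps_mult)
qed

lemma has_theta_log_fps_of_int_fps:
  assumes "has_theta_log G A"
  shows "has_theta_log (fps_of_int_fps G) (fps_of_int_fps A)"
proof -
  have "fps_X * fps_deriv (fps_of_int_fps G) = fps_of_int_fps (fps_X * fps_deriv G)"
    by (rule fps_ext) (simp split: nat.splits)
  also have "\<dots> = fps_of_int_fps A * fps_of_int_fps G"
    using assms by (simp only: has_theta_log_def fps_of_int_fps_mult)
  finally show ?thesis by (simp only: has_theta_log_def)
qed

text \<open>As A has no constant term, the recursion for n u_n involves only earlier coefficients,
  and n can be divided out over the complex numbers.\<close>

lemma theta_log_determines_nth:
  fixes u v :: "complex fps"
  assumes "has_theta_log u A" "has_theta_log v D" "fps_nth u 0 = fps_nth v 0"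
    "fps_nth A 0 = 0" "\<And>j. j \<le> n \<Longrightarrow> fps_nth A j = fps_nth D j" "m \<le> n"
  shows "fps_nth u m = fps_nth v m"
  using assms(6)
proof (induction m rule: less_induct)
  case (less m)
  show ?case
  proof (cases "m = 0")
    case False
    have "of_nat m * fps_nth u m = (\<Sum>i\<le>m. fps_nth A i * fps_nth u (m - i))"
      by (rule has_theta_log_nth[OF assms(1)])
    also have "\<dots> = (\<Sum>i\<le>m. fps_nth D i * fps_nth v (m - i))"
    proof (rule sum.cong)
      fix i assume i: "i \<in> {..m}"
      show "fps_nth A i * fps_nth u (m - i) = fps_nth D i * fps_nth v (m - i)"
      proof (cases "i = 0")
        case True
        then show ?thesis using assms(4) assms(5)[of 0] by simp
      next
        case False
        then show ?thesis using less.IH[of "m - i"] less.prems assms(5)[of i] i \<open>m \<noteq> 0\<close> by simp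
      qed
    qed simp
    also have "\<dots> = of_nat m * fps_nth v m" by (rule has_theta_log_nth[OF assms(2), symmetric])
    finally show ?thesis using False by simp
  qed (use assms(3) in simp)
qed

text \<open>Up to degree n the series u has the same logarithmic derivative as the finite integral
  product K, and hence the same coefficients.\<close>

lemma integral_if_theta_log_integral:
  fixes u :: "complex fps"
  assumes "has_theta_log u A" "fps_nth u 0 = 1" "fps_nth A 0 = 0"
    "\<And>n. n > 0 \<Longrightarrow> fps_nth A n = of_int (\<Sum>d | d dvd n. B d)" "\<And>n. n > 0 \<Longrightarrow> int n dvd B n"
  shows "fps_nth u n \<in> \<int>"
proof -
  obtain K :: "int fps" where K: "fps_nth K 0 = 1"
    "has_theta_log K (\<Sum>i\<in>{0<..<Suc n}. of_int (B i) * (fps_geom i - 1))"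
    using int_fps_with_theta_log[of "Suc n" B] assms(5) by auto
  define D where "D = (\<Sum>i\<in>{0<..<Suc n}. of_int (B i) * (fps_geom i - 1) :: int fps)"
  have "fps_nth u n = fps_nth (fps_of_int_fps K) n"
  proof (rule theta_log_determines_nth[OF assms(1) has_theta_log_fps_of_int_fps[OF K(2)]])
    fix j assume j: "j \<le> n"
    show "fps_nth A j = fps_nth (fps_of_int_fps (\<Sum>i\<in>{0<..<Suc n}. of_int (B i) * (fps_geom i - 1))) j"
    proof (cases "j = 0")
      case False
      then have "{i. 0 < i \<and> i < Suc n \<and> i dvd j} = {i. i dvd j}"
        using j by (auto dest: dvd_imp_le intro: dvd_pos_nat)
      then show ?thesis using False assms(4)[of j] by (simp add: nth_sum_fps_geom)
    qed (simp add: assms(3) nth_sum_fps_geom)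
  qed (use K assms in auto)
  then show ?thesis by simp
qed

text \<open>Gauss's argument: at degree i + j, where i and j are the first indices with coefficients
  not divisible by p, all other terms of the Cauchy product are divisible by p.\<close>

lemma prime_dvd_int_fps_mult:
  fixes F G :: "int fps"
  assumes "prime p" "\<And>n. p dvd fps_nth (F * G) n"
  shows "(\<forall>n. p dvd fps_nth F n) \<or> (\<forall>n. p dvd fps_nth G n)"
proof (rule ccontr)
  assume "\<not> ?thesis"
  then have ex: "\<exists>n. \<not> p dvd fps_nth F n" "\<exists>n. \<not> p dvd fps_nth G n" by auto
  define i where "i = (LEAST n. \<not> p dvd fps_nth F n)"
  define j where "j = (LEAST n. \<not> p dvd fps_nth G n)"
  have i: "\<not> p dvd fps_nth F i" "\<And>n. n < i \<Longrightarrow> p dvd fps_nth F n"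
    unfolding i_def using LeastI_ex[OF ex(1)] not_less_Least by blast+
  have j: "\<not> p dvd fps_nth G j" "\<And>n. n < j \<Longrightarrow> p dvd fps_nth G n"
    unfolding j_def using LeastI_ex[OF ex(2)] not_less_Least by blast+
  have "fps_nth (F * G) (i + j) = (\<Sum>n\<in>{0..i + j}. fps_nth F n * fps_nth G (i + j - n))"
    by (simp add: fps_mult_nth)
  also have "\<dots> = fps_nth F i * fps_nth G j + (\<Sum>n\<in>{0..i + j} - {i}. fps_nth F n * fps_nth G (i + j - n))"
    by (subst sum.remove[of _ i]) auto
  finally have eq: "fps_nth F i * fps_nth G j = fps_nth (F * G) (i + j) - (\<Sum>n\<in>{0..i + j} - {i}. fps_nth F n * fps_nth G (i + j - n))"
    by simp
  have rest: "p dvd (\<Sum>n\<in>{0..i + j} - {i}. fps_nth F n * fps_nth G (i + j - n))"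
  proof (rule dvd_sum)
    fix n assume n: "n \<in> {0..i + j} - {i}"
    show "p dvd fps_nth F n * fps_nth G (i + j - n)"
    proof (cases "n < i")
      case False
      then have "i + j - n < j" using n by auto
      then show ?thesis using j(2) by simp
    qed (use i(2) in simp)
  qed
  have "p dvd fps_nth F i * fps_nth G j" unfolding eq by (rule dvd_diff[OF assms(2) rest])
  then show False using i(1) j(1) assms(1) prime_dvd_mult_iff by blast
qed

lemma prime_dvd_int_fps_power:
  fixes F :: "int fps"
  assumes "prime p" "\<And>n. p dvd fps_nth (F ^ r) n"
  shows "p dvd fps_nth F n"
  using assms(2)
proof (induction r)
  case 0
  then have "p dvd 1" using "0.prems"[of 0] by simp
  then show ?case using assms(1) by (meson not_prime_unit)
next
  case (Suc r)
  then show ?case using prime_dvd_int_fps_mult[OF assms(1), of F "F ^ r"] by auto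
qed

text \<open>The prime factors of c are split off from F one at a time; each divides F^r and hence F
  by Gauss's lemma.\<close>

lemma dvd_int_fps_power:
  fixes F :: "int fps"
  assumes "c > 0" "r > 0" "\<And>n. int c ^ r dvd fps_nth (F ^ r) n"
  shows "int c dvd fps_nth F n"
  using assms(1,3)
proof (induction c arbitrary: F n rule: less_induct)
  case (less c)
  show ?case
  proof (cases "c = 1")
    case False
    then obtain p where p: "prime p" "p dvd c" using prime_factor_nat by blast
    then obtain c' where c': "c = p * c'" by (elim dvdE)
    have c'0: "c' > 0" "c' < c" using less.prems(1) prime_gt_1_nat[OF p(1)] by (auto simp: c')
    have "int p dvd int c ^ r" using p(2) assms(2) by (meson dvd_power dvd_trans int_dvd_int_iff)
    then have pF: "int p dvd fps_nth (F ^ r) n" for n using less.prems(2) dvd_trans by blast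
    have "int p dvd fps_nth F n" for n
      by (rule prime_dvd_int_fps_power[OF _ pF]) (use p(1) in simp)
    then have eq: "int p * (fps_nth F n div int p) = fps_nth F n" for n by simp
    define F' where "F' = Abs_fps (\<lambda>n. fps_nth F n div int p)"
    have F: "F = fps_const (int p) * F'" by (rule fps_ext) (simp add: F'_def eq)
    have "F ^ r = fps_const (int p ^ r) * F' ^ r" unfolding F by (simp add: power_mult_distrib fps_const_power)
    then have "int p ^ r * int c' ^ r dvd int p ^ r * fps_nth (F' ^ r) n" for n
      using less.prems(2)[of n] by (simp add: c' power_mult_distrib)
    then have "int c' ^ r dvd fps_nth (F' ^ r) n" for n using p(1) by (simp add: prime_gt_0_nat)
    then have "int c' dvd fps_nth F' n" using less.IH[OF c'0(2,1)] by blast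
    then show ?thesis by (simp add: F c' mult_dvd_mono)
  qed simp
qed

section \<open>Hecke relations\<close>

text \<open>Bundles the orders at all cusps with the logarithmic coefficients at infinity, so that
  one calculus of products and Hecke operators carries both along.\<close>

definition nform :: "int \<Rightarrow> (complex \<Rightarrow> complex) \<Rightarrow> (int \<Rightarrow> int \<Rightarrow> real) \<Rightarrow> real \<Rightarrow> (nat \<Rightarrow> complex) \<Rightarrow> bool" where
  "nform k F \<epsilon> m l \<longleftrightarrow> vform k F \<epsilon> \<and> logexp F m l"

lemma nform_mult:
  "nform k F \<epsilon> m l \<Longrightarrow> nform k' F' \<epsilon>' m' l' \<Longrightarrow>
   nform (k + k') (\<lambda>z. F z * F' z) (\<lambda>x y. \<epsilon> x y + \<epsilon>' x y) (m + m') (\<lambda>n. l n + l' n)"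
  unfolding nform_def using vform_mult logexp_mult by blast

lemma nform_powi:
  "nform k F \<epsilon> m l \<Longrightarrow>
   nform (i * k) (\<lambda>z. F z powi i) (\<lambda>x y. of_int i * \<epsilon> x y) (of_int i * m) (\<lambda>n. of_int i * l n)"
  unfolding nform_def using vform_powi logexp_powi by blast

lemma nform_heckeU:
  "nform k F \<epsilon> m l \<Longrightarrow> p > 0 \<Longrightarrow>
   nform (int p * k) (heckeU k p F) (ordU p \<epsilon>) m (\<lambda>n. of_nat p * l (p * n))"
  unfolding nform_def using vform_heckeU logexp_heckeU by blast

lemma nform_heckeT:
  "nform k F \<epsilon> m l \<Longrightarrow> p > 0 \<Longrightarrow>
   nform ((int p + 1) * k) (heckeT k p F) (ordT p \<epsilon>) ((of_nat p + 1) * m)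
     (\<lambda>n. (if p dvd n then l (n div p) else 0) + of_nat p * l (p * n))"
  unfolding nform_def using vform_heckeT logexp_heckeT by blast

lemma vform_cong_ord:
  assumes "vform k F \<epsilon>" "\<And>x y. x \<noteq> 0 \<or> y \<noteq> 0 \<Longrightarrow> \<epsilon> x y = \<delta> x y"
  shows "vform k F \<delta>"
proof -
  have "\<epsilon> a c = \<delta> a c" if "a * d - b * c > 0" for a b c d
    using that by (intro assms(2)) auto
  then show ?thesis using assms(1) unfolding vform_def by metis
qed

text \<open>From cusps to coefficients, by the maximum principle.\<close>

lemma nform_zero_ord:
  assumes "nform 0 F \<epsilon> m l" "\<And>x y. x \<noteq> 0 \<or> y \<noteq> 0 \<Longrightarrow> \<epsilon> x y = 0" "n > 0"
  shows "l n = 0"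
proof -
  have F: "vform 0 F \<epsilon>" "logexp F m l" using assms(1) by (auto simp: nform_def)
  have "vform 0 F (\<lambda>_ _. 0)" by (rule vform_cong_ord[OF F(1) assms(2)])
  then obtain C where C: "\<And>z. z \<in> upper_half_plane \<Longrightarrow> F z = C"
    by (rule vform_zero_constant) (rule that, blast)
  show ?thesis by (rule logexp_constant(2)[OF F(2) C assms(3)])
qed

text \<open>From coefficients back to cusps: F is constant because its expansion at infinity is, so
  its orders are those of a constant. Here the leading exponent has to vanish as well.\<close>

lemma nform_zero_log:
  assumes "nform 0 F \<epsilon> 0 l" "\<And>n. n > 0 \<Longrightarrow> l n = 0" "x \<noteq> 0 \<or> y \<noteq> 0"
  shows "\<epsilon> x y = 0"
proof -
  have F: "vform 0 F \<epsilon>" "logexp F 0 l" using assms(1) by (auto simp: nform_def)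
  obtain C where C: "C \<noteq> 0" "\<And>z. z \<in> upper_half_plane \<Longrightarrow> F z = C"
    by (rule logexp_imp_constant[OF F(2) assms(2)]) (assumption | rule that, blast)+
  have "vform 0 F (\<lambda>_ _. 0)" by (rule vform_cong[OF vform_const[OF C(1)]]) (simp add: C(2))
  from vform_unique[OF F(1) this assms(3)] show ?thesis .
qed

lemma homogeneous_zero:
  fixes E :: "int \<Rightarrow> int \<Rightarrow> real"
  assumes "\<And>t x y. t > 0 \<Longrightarrow> x \<noteq> 0 \<or> y \<noteq> 0 \<Longrightarrow> E (t * x) (t * y) = (of_int t)\<^sup>2 * E x y"
    "\<And>x y. coprime x y \<Longrightarrow> E x y = 0" "x \<noteq> 0 \<or> y \<noteq> 0"
  shows "E x y = 0"
proof -
  obtain g x' y' where g: "g > 0" and xy': "x = g * x'" "y = g * y'" and "coprime x' y'"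
    using primitive_decomposition[OF assms(3)] .
  have "x' \<noteq> 0 \<or> y' \<noteq> 0" using assms(3) by (auto simp: xy')
  then show ?thesis using assms(1)[OF g] assms(2)[OF \<open>coprime x' y'\<close>] unfolding xy' by simp
qed

text \<open>\<open>A\<close> is the logarithmic derivative of f / q^m after the substitution of c q
  for q, which makes the coefficients integral even if c is not a unit. The integrality of f enters
  the Hecke argument only through \<open>scaled\<close> and \<open>prime_dvd_diff\<close>.\<close>

locale integral_form =
  fixes k :: int and N :: nat and f :: "complex \<Rightarrow> complex" and \<epsilon> :: "int \<Rightarrow> int \<Rightarrow> real"
    and m :: real and l :: "nat \<Rightarrow> complex" and c :: int and A :: "nat \<Rightarrow> int"
  assumes form: "nform k f \<epsilon> m l"
    and orders: "cusp_orders (int N) \<epsilon>"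
    and c_nonzero: "c \<noteq> 0"
    and scaled: "\<And>n. of_int (A n) = of_int c ^ n * (of_nat n * l n)"
    and prime_dvd_diff: "\<And>p n. prime p \<Longrightarrow> n > 0 \<Longrightarrow> int p dvd A (p * n) - A n"
begin

interpretation cusp_orders "int N" \<epsilon> by (rule orders)

definition logT :: "nat \<Rightarrow> nat \<Rightarrow> complex" where
  "logT p n = (if p dvd n then l (n div p) else 0) + of_nat p * l (p * n)"

lemma nform_T: "p > 0 \<Longrightarrow> nform ((int p + 1) * k) (heckeT k p f) (ordT p \<epsilon>) ((of_nat p + 1) * m) (logT p)"
  using nform_heckeT[OF form, of p] by (simp add: logT_def[abs_def])

lemma ordT_homogeneous:
  "p > 0 \<Longrightarrow> t > 0 \<Longrightarrow> x \<noteq> 0 \<or> y \<noteq> 0 \<Longrightarrow> ordT p \<epsilon> (t * x) (t * y) = (of_int t)\<^sup>2 * ordT p \<epsilon> x y"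
  using vform_homogeneous nform_T unfolding nform_def by blast

text \<open>The coefficients q - r, r - p, p - q annihilate every affine function of the prime,
  hence both the orders p A + B and the weights (p + 1) k.\<close>

lemma logT_three_primes:
  assumes "prime p" "coprime (int p) (int N)" "prime q" "int N dvd int p - int q"
    "prime r" "int N dvd int p - int r" "n > 0"
  shows "of_int (int q - int r) * logT p n + of_int (int r - int p) * logT q n
    + of_int (int p - int q) * logT r n = 0"
proof -
  have pos: "p > 0" "q > 0" "r > 0" using assms prime_gt_0_nat by auto
  define E where "E x y = of_int (int q - int r) * ordT p \<epsilon> x y + (of_int (int r - int p) * ordT q \<epsilon> x y
    + of_int (int p - int q) * ordT r \<epsilon> x y)" for x y
  have E0: "E x y = 0" if "x \<noteq> 0 \<or> y \<noteq> 0" for x y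
  proof (rule homogeneous_zero[OF _ _ that])
    show "E (t * x) (t * y) = (of_int t)\<^sup>2 * E x y" if "t > 0" "x \<noteq> 0 \<or> y \<noteq> 0" for t x y
      using that pos by (simp add: E_def ordT_homogeneous algebra_simps)
    show "E x y = 0" if cop: "coprime x y" for x y
    proof -
      obtain A B :: real where "\<And>q. prime q \<Longrightarrow> int N dvd int p - int q \<Longrightarrow> ordT q \<epsilon> x y = q * A + B"
        by (rule ordT_residue_class[OF assms(1,2) cop]) (rule that, blast)
      then have "ordT p \<epsilon> x y = p * A + B" "ordT q \<epsilon> x y = q * A + B" "ordT r \<epsilon> x y = r * A + B"
        using assms by auto
      then show ?thesis by (simp add: E_def algebra_simps)
    qed
  qed
  note F = nform_mult[OF nform_powi[OF nform_T[OF pos(1)], of "int q - int r"]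
      nform_mult[OF nform_powi[OF nform_T[OF pos(2)], of "int r - int p"]
        nform_powi[OF nform_T[OF pos(3)], of "int p - int q"]]]
  have k0: "(int q - int r) * ((int p + 1) * k) +
      ((int r - int p) * ((int q + 1) * k) + (int p - int q) * ((int r + 1) * k)) = 0" by algebra
  have "of_int (int q - int r) * logT p n + (of_int (int r - int p) * logT q n
    + of_int (int p - int q) * logT r n) = 0"
    by (rule nform_zero_ord[OF F[unfolded k0] E0[unfolded E_def] assms(7)])
  then show ?thesis by (simp only: add.assoc)
qed

text \<open>The power c^K clears the denominators as soon as K reaches p n, the largest index of l
  that occurs.\<close>

lemma scaled_logT:
  assumes "p > 0" "p * n \<le> K" "n > 0"
  obtains Y where "of_int Y = of_int c ^ K * (of_nat n * logT p n)"
proof -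
  have shift: "of_int (c ^ (K - j) * A j) = of_int c ^ K * (of_nat j * l j)" if "j \<le> K" for j
  proof -
    have "of_int c ^ K = (of_int c :: complex) ^ (K - j) * of_int c ^ j" using that by (simp flip: power_add)
    then show ?thesis by (simp add: scaled)
  qed
  have "of_nat n * logT p n = (if p dvd n then of_nat p * (of_nat (n div p) * l (n div p)) else 0)
      + of_nat (p * n) * l (p * n)"
    using assms(1) by (auto simp: logT_def algebra_simps elim!: dvdE)
  moreover have "n div p \<le> K"
    using assms by (metis div_le_dividend le_trans mult_le_mono1 nat_mult_1 Suc_leI One_nat_def)
  ultimately have "of_int ((if p dvd n then int p * (c ^ (K - n div p) * A (n div p)) else 0) + c ^ (K - p * n) * A (p * n))
      = of_int c ^ K * (of_nat n * logT p n)"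
    using shift[of "n div p"] shift[of "p * n"] assms(2) by (simp add: algebra_simps)
  then show ?thesis using that by blast
qed

text \<open>Modulo r the coefficients q - r and r - p of the three-prime relation become q and -p,
  and the term of T_r becomes that of f. What remains is an integer independent of r with infinitely
  many prime divisors.\<close>

lemma logT_two_primes:
  assumes "prime p" "coprime (int p) (int N)" "prime q" "int N dvd int p - int q"
    "infinite {r::nat. prime r \<and> int N dvd int p - int r}" "n > 0"
  shows "of_nat q * logT p n - of_nat p * logT q n + (of_nat p - of_nat q) * l n = 0"
proof -
  have pos: "p > 0" "q > 0" using assms prime_gt_0_nat by auto
  define K where "K = (p + q) * n"
  obtain Y1 where Y1: "of_int Y1 = of_int c ^ K * (of_nat n * logT p n)"
    using scaled_logT[OF pos(1), of n K] assms(6) by (auto simp: K_def algebra_simps)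
  obtain Y2 where Y2: "of_int Y2 = of_int c ^ K * (of_nat n * logT q n)"
    using scaled_logT[OF pos(2), of n K] assms(6) by (auto simp: K_def algebra_simps)
  have nK: "n \<le> K" using pos by (simp add: K_def algebra_simps trans_le_add1)
  \<comment> \<open>The left-hand side multiplied by n c^K, where K bounds all indices that occur
    for p, q and f.\<close>
  define Z where "Z = int q * Y1 - int p * Y2 + (int p - int q) * c ^ (K - n) * A n"
  have dvd: "int r dvd c ^ n * Z" if r: "prime r" "int N dvd int p - int r" "r > n" for r
  proof -
    \<comment> \<open>With r > n the term \<open>l (n div r)\<close> is absent from
      \<open>logT r n\<close>.\<close>
    have "\<not> r dvd n" using r(3) assms(6) by (auto dest: dvd_imp_le)
    then have "of_int (A (r * n)) = of_int c ^ (r * n) * (of_nat n * logT r n)"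
      by (simp add: scaled logT_def)
    then have "of_int ((int q - int r) * (c ^ (r * n) * Y1) + (int r - int p) * (c ^ (r * n) * Y2)
        + (int p - int q) * c ^ K * A (r * n)) =
      of_int c ^ K * of_int c ^ (r * n) * of_nat n * (of_int (int q - int r) * logT p n
        + of_int (int r - int p) * logT q n + of_int (int p - int q) * logT r n)"
      by (simp add: Y1 Y2 algebra_simps)
    also have "\<dots> = 0" by (subst logT_three_primes) (use assms r in auto)
    finally have rel: "(int q - int r) * (c ^ (r * n) * Y1) + (int r - int p) * (c ^ (r * n) * Y2)
        + (int p - int q) * c ^ K * A (r * n) = 0" by (simp only: of_int_eq_0_iff)
    \<comment> \<open>Scaling the term of T_r costs the factor c^(r n), which varies with r. By
      Fermat it is c^n modulo r, hence the factor c^n in front of Z.\<close>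
    obtain u where u: "c ^ (r * n) = c ^ n + int r * u"
      using fermat_power_diff[OF r(1) assms(6), of c] by (metis add_diff_cancel_left' dvdE diff_add_cancel add.commute)
    obtain v where v: "A (r * n) = A n + int r * v"
      using prime_dvd_diff[OF r(1) assms(6)] by (metis dvdE diff_add_cancel add.commute)
    have "c ^ K = c ^ n * c ^ (K - n)" using nK by (simp flip: power_add)
    moreover have "cn * (q' * Y1 - p' * Y2 + (p' - q') * D * a) = r' * (cn * Y1 - (q' - r') * u * Y1
        - cn * Y2 - (r' - p') * u * Y2 - (p' - q') * C * v)"
      if "C = cn * D" "(q' - r') * ((cn + r' * u) * Y1) + (r' - p') * ((cn + r' * u) * Y2)
        + (p' - q') * C * (a + r' * v) = 0" for cn D C a p' q' r' :: int
      using that by algebra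
    ultimately have "c ^ n * Z = int r * (c ^ n * Y1 - (int q - int r) * u * Y1 - c ^ n * Y2
        - (int r - int p) * u * Y2 - (int p - int q) * c ^ K * v)"
      using rel unfolding u v Z_def by blast
    then show ?thesis by simp
  qed
  have "c ^ n * Z = 0"
  proof (rule ccontr)
    assume nz: "c ^ n * Z \<noteq> 0"
    have "infinite ({r. prime r \<and> int N dvd int p - int r} - {..n + nat \<bar>c ^ n * Z\<bar>})"
      using assms(5) by (intro Diff_infinite_finite) auto
    then have "{r. prime r \<and> int N dvd int p - int r} - {..n + nat \<bar>c ^ n * Z\<bar>} \<noteq> {}"
      by (rule infinite_imp_nonempty)
    then obtain r where "r \<in> {r. prime r \<and> int N dvd int p - int r} - {..n + nat \<bar>c ^ n * Z\<bar>}"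
      by blast
    then have r: "prime r" "int N dvd int p - int r" "r > n" "r > nat \<bar>c ^ n * Z\<bar>"
      by (simp_all only: Diff_iff mem_Collect_eq atMost_iff not_le, linarith+)
    have "int r \<le> \<bar>c ^ n * Z\<bar>"
      using dvd_imp_le_int[OF nz dvd[OF r(1-3)]] by (simp only: abs_of_nat)
    with r(4) show False by linarith
  qed
  then have "Z = 0" using c_nonzero by simp
  have "of_int Z = of_int c ^ K * of_nat n * (of_nat q * logT p n - of_nat p * logT q n + (of_nat p - of_nat q) * l n)"
  proof -
    have "of_int c ^ K = (of_int c :: complex) ^ (K - n) * of_int c ^ n" using nK by (simp flip: power_add)
    then show ?thesis by (simp add: Z_def Y1 Y2 scaled algebra_simps)
  qed
  with \<open>Z = 0\<close> c_nonzero assms(6) show ?thesis by simp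
qed

text \<open>The relation between the coefficients for p, q and f itself is turned into one between
  orders. Weights and leading exponents cancel because q (p + 1) + p = p (q + 1) + q.\<close>

lemma diamond_invariant_if_infinite:
  assumes "prime p" "coprime (int p) (int N)" "infinite {r::nat. prime r \<and> int N dvd int p - int r}"
  shows "diamond_invariant (int p)"
proof -
  have "infinite ({r::nat. prime r \<and> int N dvd int p - int r} - {p})"
    using assms(3) by simp
  then have "{r::nat. prime r \<and> int N dvd int p - int r} - {p} \<noteq> {}"
    by (rule infinite_imp_nonempty)
  then obtain q where q: "prime q" "int N dvd int p - int q" "q \<noteq> p" by auto
  have pos: "p > 0" "q > 0" using assms(1) q(1) prime_gt_0_nat by auto
  show ?thesis
  proof (rule diamond_invariant_prime[OF assms(1,2) q(1,3,2)])
    fix x y :: int assume xy: "x \<noteq> 0 \<or> y \<noteq> 0"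
    note F = nform_mult[OF nform_mult[OF nform_powi[OF nform_T[OF pos(1)], of "int q"] nform_powi[OF form, of "int p"]]
      nform_mult[OF nform_powi[OF nform_T[OF pos(2)], of "- int p"] nform_powi[OF form, of "- int q"]]]
    have k0: "int q * ((int p + 1) * k) + int p * k + (- int p * ((int q + 1) * k) + - int q * k) = 0"
      by algebra
    have m0: "of_int (int q) * ((of_nat p + 1) * m) + of_int (int p) * m +
        (of_int (- int p) * ((of_nat q + 1) * m) + of_int (- int q) * m) = 0"
      by (simp add: algebra_simps)
    have "of_int (int q) * ordT p \<epsilon> x y + of_int (int p) * \<epsilon> x y +
        (of_int (- int p) * ordT q \<epsilon> x y + of_int (- int q) * \<epsilon> x y) = 0"
    proof (rule nform_zero_log[OF F[unfolded k0 m0] _ xy])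
      show "of_int (int q) * logT p n + of_int (int p) * l n +
          (of_int (- int p) * logT q n + of_int (- int q) * l n) = 0" if "n > 0" for n
        using logT_two_primes[OF assms(1,2) q(1,2) assms(3) that] by (simp add: algebra_simps)
    qed
    then show "q * ordT p \<epsilon> x y + p * \<epsilon> x y = p * ordT q \<epsilon> x y + q * \<epsilon> x y" by simp
  qed
qed

text \<open>There are only finitely many residue classes, so all but finitely many primes lie in a class that
  contains infinitely many of them; this replaces Dirichlet's theorem.\<close>

lemma finite_not_diamond_invariant:
  "finite {p::nat. prime p \<and> coprime (int p) (int N) \<and> \<not> diamond_invariant (int p)}" (is "finite ?B")
proof (rule ccontr)
  assume "infinite ?B"
  moreover have "(\<lambda>p. int p mod int N) ` ?B \<subseteq> {0..<int N}" using N_pos by auto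
  then have "finite ((\<lambda>p. int p mod int N) ` ?B)" by (rule finite_subset) auto
  ultimately obtain p where p: "p \<in> ?B" "infinite {q \<in> ?B. int q mod int N = int p mod int N}"
    using pigeonhole_infinite by blast
  have "{q \<in> ?B. int q mod int N = int p mod int N} \<subseteq> {r. prime r \<and> int N dvd int p - int r}"
  proof
    fix q assume "q \<in> {q \<in> ?B. int q mod int N = int p mod int N}"
    then have "prime q" "int p mod int N = int q mod int N" by auto
    then show "q \<in> {r. prime r \<and> int N dvd int p - int r}" by (simp add: mod_eq_dvd_iff)
  qed
  then have "infinite {r. prime r \<and> int N dvd int p - int r}" using p(2) infinite_super by blast
  then show False using p(1) diamond_invariant_if_infinite by blast
qed

lemma diamond_orders: "diamond_cusp_orders (int N) \<epsilon>"
  by unfold_locales (rule diamond_invariant_all[OF finite_not_diamond_invariant])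

interpretation diamond_cusp_orders "int N" \<epsilon> by (rule diamond_orders)

text \<open>T_p f and f^(p+1) have the same orders at all cusps. The relation has the form of the
  Hecke equation in weight 2 with the Eisenstein eigenvalue p + 1, written for the logarithmic
  derivative of f.\<close>

theorem hecke_relation_coprime:
  assumes "prime p" "\<not> p dvd N" "n > 0"
  shows "of_nat (p * n) * l (p * n) + (if p dvd n then of_nat p * (of_nat (n div p) * l (n div p)) else 0)
    = (of_nat p + 1) * (of_nat n * l n)"
proof -
  have cop: "coprime (int p) (int N)" using assms(1,2) by (simp add: prime_imp_coprime)
  have pos: "p > 0" using assms(1) prime_gt_0_nat by auto
  note F = nform_mult[OF nform_T[OF pos] nform_powi[OF form, of "- (int p + 1)"]]
  have k0: "(int p + 1) * k + - (int p + 1) * k = 0" by algebra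
  have "logT p n + of_int (- (int p + 1)) * l n = 0"
  proof (rule nform_zero_ord[OF F[unfolded k0] _ assms(3)])
    fix x y :: int assume xy: "x \<noteq> 0 \<or> y \<noteq> 0"
    show "ordT p \<epsilon> x y + of_int (- (int p + 1)) * \<epsilon> x y = 0"
    proof (rule homogeneous_zero[where E = "\<lambda>x y. ordT p \<epsilon> x y + of_int (- (int p + 1)) * \<epsilon> x y", OF _ _ xy])
      show "ordT p \<epsilon> (t * x) (t * y) + of_int (- (int p + 1)) * \<epsilon> (t * x) (t * y) =
          (of_int t)\<^sup>2 * (ordT p \<epsilon> x y + of_int (- (int p + 1)) * \<epsilon> x y)" if "t > 0" "x \<noteq> 0 \<or> y \<noteq> 0" for t x y
        unfolding ordT_homogeneous[OF pos that] homogeneous[OF that] by (simp add: algebra_simps)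
      show "ordT p \<epsilon> x y + of_int (- (int p + 1)) * \<epsilon> x y = 0" if "coprime x y" for x y
        using ordT_diamond[OF assms(1) cop that] by (simp add: algebra_simps)
    qed
  qed
  then have "of_nat n * logT p n = (of_nat p + 1) * (of_nat n * l n)" by (simp add: algebra_simps)
  moreover have "of_nat n * logT p n = of_nat (p * n) * l (p * n) + (if p dvd n then of_nat p * (of_nat (n div p) * l (n div p)) else 0)"
    using pos by (auto simp: logT_def algebra_simps elim!: dvdE)
  ultimately show ?thesis by simp
qed

lemma nform_heckeU_iterate:
  assumes "p > 0"
  shows "\<exists>F. nform (int p ^ i * k) F ((ordU p ^^ i) \<epsilon>) m (\<lambda>n. of_nat (p ^ i) * l (p ^ i * n))"
proof (induction i)
  case 0
  then show ?case using form by auto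
next
  case (Suc i)
  then obtain F where "nform (int p ^ i * k) F ((ordU p ^^ i) \<epsilon>) m (\<lambda>n. of_nat (p ^ i) * l (p ^ i * n))" ..
  from nform_heckeU[OF this assms] show ?case by (auto simp: mult_ac)
qed

text \<open>(U - 1)(U - p) U^e = 0, carried over from orders to coefficients. The weights p^i k
  cancel because p^(e+2) - (p + 1) p^(e+1) + p p^e = 0.\<close>

theorem hecke_relation_dvd:
  assumes "prime p" "n > 0"
  defines "e \<equiv> multiplicity (int p) (int N)"
  shows "of_nat (p ^ (e + 2) * n) * l (p ^ (e + 2) * n) + of_nat p * (of_nat (p ^ e * n) * l (p ^ e * n))
    = (of_nat p + 1) * (of_nat (p ^ (e + 1) * n) * l (p ^ (e + 1) * n))"
proof -
  have pos: "p > 0" using assms(1) prime_gt_0_nat by auto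
  obtain F0 F1 F2 where F: "nform (int p ^ e * k) F0 ((ordU p ^^ e) \<epsilon>) m (\<lambda>n. of_nat (p ^ e) * l (p ^ e * n))"
    "nform (int p ^ (e + 1) * k) F1 ((ordU p ^^ (e + 1)) \<epsilon>) m (\<lambda>n. of_nat (p ^ (e + 1)) * l (p ^ (e + 1) * n))"
    "nform (int p ^ (e + 2) * k) F2 ((ordU p ^^ (e + 2)) \<epsilon>) m (\<lambda>n. of_nat (p ^ (e + 2)) * l (p ^ (e + 2) * n))"
    using nform_heckeU_iterate[OF pos] by meson
  note G = nform_mult[OF F(3) nform_mult[OF nform_powi[OF F(2), of "- (int p + 1)"] nform_powi[OF F(1), of "int p"]]]
  have k0: "int p ^ (e + 2) * k + (- (int p + 1) * (int p ^ (e + 1) * k) + int p * (int p ^ e * k)) = 0"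
    by (simp add: algebra_simps)
  have "of_nat (p ^ (e + 2)) * l (p ^ (e + 2) * n) + (of_int (- (int p + 1)) * (of_nat (p ^ (e + 1)) * l (p ^ (e + 1) * n))
     + of_int (int p) * (of_nat (p ^ e) * l (p ^ e * n))) = 0"
  proof (rule nform_zero_ord[OF G[unfolded k0] _ assms(2)])
    fix x y :: int assume xy: "x \<noteq> 0 \<or> y \<noteq> 0"
    have "(ordU p ^^ (e + 2)) \<epsilon> x y - (real p + 1) * (ordU p ^^ (e + 1)) \<epsilon> x y + p * (ordU p ^^ e) \<epsilon> x y = 0"
      by (rule ordU_iterate_relation[OF orders_by_denominator assms(1) _ xy])
         (unfold e_def, rule ord_denominator_prime_power[OF assms(1)])
    then show "(ordU p ^^ (e + 2)) \<epsilon> x y + (of_int (- (int p + 1)) * (ordU p ^^ (e + 1)) \<epsilon> x y +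
        of_int (int p) * (ordU p ^^ e) \<epsilon> x y) = 0"
      by (simp only: of_int_minus of_int_add of_int_of_nat_eq of_int_1 of_nat_add of_nat_1)
  qed
  then have "of_nat n * (of_nat (p ^ (e + 2)) * l (p ^ (e + 2) * n)) + of_nat n * (of_nat p * (of_nat (p ^ e) * l (p ^ e * n)))
     = of_nat n * ((of_nat p + 1) * (of_nat (p ^ (e + 1)) * l (p ^ (e + 1) * n)))"
    by (simp only: of_int_minus of_int_add of_int_of_nat_eq of_int_1 flip: distrib_left) (simp add: algebra_simps)
  then show ?thesis by (simp only: of_nat_mult) (simp only: mult_ac)
qed

end

section \<open>Periodicity and integrality of the product exponents\<close>

lemma divisors_prime_power_split:
  fixes p m :: nat
  assumes "prime p" "\<not> p dvd m" "m > 0" "j > 0"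
  shows "{d. d dvd p ^ j * m} = {d. d dvd p ^ (j - 1) * m} \<union> (\<lambda>d. p ^ j * d) ` {d. d dvd m}"
    and "{d. d dvd p ^ (j - 1) * m} \<inter> (\<lambda>d. p ^ j * d) ` {d. d dvd m} = {}"
proof -
  have p: "p > 1" using assms(1) prime_gt_1_nat by auto
  obtain i where j: "j = Suc i" using assms(4) by (cases j) auto
  show "{d. d dvd p ^ j * m} = {d. d dvd p ^ (j - 1) * m} \<union> (\<lambda>d. p ^ j * d) ` {d. d dvd m}"
  proof (intro equalityI subsetI)
    fix d assume "d \<in> {d. d dvd p ^ j * m}"
    then have d: "d dvd p ^ j * m" by simp
    then have d0: "d > 0" using assms(3) p by (intro dvd_pos_nat[OF _ d]) simp
    obtain d' where d': "d = p ^ multiplicity p d * d'" "\<not> p dvd d'"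
      by (rule multiplicity_decompose'[of d p]) (use d0 p in auto)
    have "d' dvd p ^ j * m" using d d'(1) by (metis dvd_mult_right)
    moreover have "coprime d' (p ^ j)" using prime_imp_coprime[OF assms(1) d'(2)] by (simp add: coprime_commute)
    ultimately have d'm: "d' dvd m" by (simp add: coprime_dvd_mult_right_iff)
    have "p ^ multiplicity p d dvd p ^ j * m" using d d'(1) by (metis dvd_mult_left)
    moreover have "coprime (p ^ multiplicity p d) m" using assms(1,2) by (simp add: prime_imp_coprime)
    ultimately have "p ^ multiplicity p d dvd p ^ j" by (simp add: coprime_dvd_mult_left_iff)
    then have le: "multiplicity p d \<le> j" using p by (simp add: dvd_power_iff_le)
    show "d \<in> {d. d dvd p ^ (j - 1) * m} \<union> (\<lambda>d. p ^ j * d) ` {d. d dvd m}"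
    proof (cases "multiplicity p d = j")
      case True
      then show ?thesis using d'(1) d'm by auto
    next
      case False
      then have "p ^ multiplicity p d dvd p ^ (j - 1)" using le by (intro le_imp_power_dvd) auto
      then show ?thesis using d'(1) d'm mult_dvd_mono by (metis UnI1 mem_Collect_eq)
    qed
  qed (auto simp: j mult.assoc intro: mult_dvd_mono)
  show "{d. d dvd p ^ (j - 1) * m} \<inter> (\<lambda>d. p ^ j * d) ` {d. d dvd m} = {}"
  proof (rule ccontr)
    assume "\<not> ?thesis"
    then obtain d where "p ^ j * d dvd p ^ (j - 1) * m" by auto
    then have "p ^ (j - 1) * p dvd p ^ (j - 1) * m" unfolding j by (metis diff_Suc_1 dvd_mult_left power_Suc2)
    then show False using assms(2) p by simp
  qed
qed

lemma sum_divisors_prime_power_diff: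
  fixes \<alpha> \<beta> :: "nat \<Rightarrow> complex"
  assumes "\<And>n. n > 0 \<Longrightarrow> \<alpha> n = (\<Sum>d | d dvd n. \<beta> d)" "prime p" "\<not> p dvd m" "m > 0"
  shows "\<alpha> (p ^ j * m) - (if j = 0 then 0 else \<alpha> (p ^ (j - 1) * m)) = (\<Sum>d | d dvd m. \<beta> (p ^ j * d))"
proof (cases "j = 0")
  case False
  have p: "p > 0" using assms(2) prime_gt_0_nat by auto
  have j0: "j > 0" using False by simp
  have "\<alpha> (p ^ j * m) = (\<Sum>d | d dvd p ^ j * m. \<beta> d)" using assms(1,4) p by simp
  also have "\<dots> = (\<Sum>d | d dvd p ^ (j - 1) * m. \<beta> d) + (\<Sum>d\<in>(\<lambda>d. p ^ j * d) ` {d. d dvd m}. \<beta> d)"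
    unfolding divisors_prime_power_split(1)[OF assms(2-4) j0]
    by (rule sum.union_disjoint)
       (use divisors_prime_power_split(2)[OF assms(2-4), of j] False assms(4) p in auto)
  also have "(\<Sum>d | d dvd p ^ (j - 1) * m. \<beta> d) = \<alpha> (p ^ (j - 1) * m)" using assms(1,4) p by simp
  also have "(\<Sum>d\<in>(\<lambda>d. p ^ j * d) ` {d. d dvd m}. \<beta> d) = (\<Sum>d | d dvd m. \<beta> (p ^ j * d))"
    by (subst sum.reindex) (use p in \<open>auto simp: inj_on_def\<close>)
  finally show ?thesis using False by simp
qed (use assms in simp)

lemma sum_divisors_coprime_zero:
  fixes \<beta> :: "nat \<Rightarrow> complex"
  assumes "\<And>m. m > 0 \<Longrightarrow> \<not> p dvd m \<Longrightarrow> (\<Sum>d | d dvd m. \<beta> d) = 0" "m > 0" "\<not> p dvd m"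
  shows "\<beta> m = 0"
  using assms(2,3)
proof (induction m rule: less_induct)
  case (less m)
  have "0 = (\<Sum>d | d dvd m. \<beta> d)" using assms(1)[OF less.prems] by simp
  also have "\<dots> = (\<Sum>d\<in>{m}. \<beta> d)"
  proof (rule sum.mono_neutral_right)
    show "\<forall>d\<in>{d. d dvd m} - {m}. \<beta> d = 0"
    proof
      fix d assume "d \<in> {d. d dvd m} - {m}"
      then have "d dvd m" "d < m" "d > 0" using less.prems(1) by (auto dest: dvd_imp_le intro: dvd_pos_nat simp: le_less)
      then show "\<beta> d = 0" using less.IH less.prems(2) dvd_trans by blast
    qed
  qed (use less.prems in auto)
  finally show ?case by simp
qed

text \<open>As a recursion in j the relation has the roots 1 and p. Taking differences in j removes
  the root 1 and leaves the divisors with the exact power p^j; the root p is the factor in the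
  conclusion. Induction over the divisors of m then isolates \<beta>.\<close>

lemma hecke_step:
  fixes \<alpha> \<beta> :: "nat \<Rightarrow> complex"
  assumes "\<And>n. n > 0 \<Longrightarrow> \<alpha> n = (\<Sum>d | d dvd n. \<beta> d)" "prime p"
    "\<And>m. m > 0 \<Longrightarrow> \<not> p dvd m \<Longrightarrow>
      \<alpha> (p ^ (j + 1) * m) + of_nat p * (if j = 0 then 0 else \<alpha> (p ^ (j - 1) * m)) = (of_nat p + 1) * \<alpha> (p ^ j * m)"
    "m > 0" "\<not> p dvd m"
  shows "\<beta> (p ^ (j + 1) * m) = of_nat p * \<beta> (p ^ j * m)"
proof -
  have "\<beta> (p ^ (j + 1) * m) - of_nat p * \<beta> (p ^ j * m) = 0"
  proof (rule sum_divisors_coprime_zero[OF _ assms(4,5), where \<beta> = "\<lambda>m. \<beta> (p ^ (j + 1) * m) - of_nat p * \<beta> (p ^ j * m)"])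
    fix m assume m: "m > 0" "\<not> p dvd m"
    have "(\<Sum>d | d dvd m. \<beta> (p ^ (j + 1) * d) - of_nat p * \<beta> (p ^ j * d)) =
        (\<Sum>d | d dvd m. \<beta> (p ^ (j + 1) * d)) - of_nat p * (\<Sum>d | d dvd m. \<beta> (p ^ j * d))"
      by (simp add: sum_subtractf sum_distrib_left)
    also have "\<dots> = (\<alpha> (p ^ (j + 1) * m) - \<alpha> (p ^ j * m)) -
        of_nat p * (\<alpha> (p ^ j * m) - (if j = 0 then 0 else \<alpha> (p ^ (j - 1) * m)))"
      using sum_divisors_prime_power_diff[OF assms(1,2) m(2,1), of "j + 1"]
        sum_divisors_prime_power_diff[OF assms(1,2) m(2,1), of j] by simp
    also have "\<dots> = 0" using assms(3)[OF m] by (simp add: algebra_simps)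
    finally show "(\<Sum>d | d dvd m. \<beta> (p ^ (j + 1) * d) - of_nat p * \<beta> (p ^ j * d)) = 0" .
  qed
  then show ?thesis by simp
qed

lemma multiplicity_int: "multiplicity (int p) (int n) = multiplicity p n"
proof -
  have "int p ^ i dvd int n \<longleftrightarrow> p ^ i dvd n" for i by (metis int_dvd_int_iff of_nat_power)
  then show ?thesis by (simp add: multiplicity_def)
qed

lemma gcd_prime_mult_eq:
  fixes n M p :: nat
  assumes "prime p" "M > 0" "n > 0" "multiplicity p M \<le> multiplicity p n"
  shows "gcd (p * n) M = gcd n M"
proof (rule dvd_antisym)
  show "gcd (p * n) M dvd gcd n M"
  proof (rule gcd_greatest)
    show "gcd (p * n) M dvd n"
    proof (rule multiplicity_le_imp_dvd)
      show "gcd (p * n) M \<noteq> 0" using assms(2) by simp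
      fix q :: nat assume q: "prime q"
      show "multiplicity q (gcd (p * n) M) \<le> multiplicity q n"
      proof (cases "q = p")
        case True
        have "multiplicity p (gcd (p * n) M) \<le> multiplicity p M"
          using assms(2) by (intro dvd_imp_multiplicity_le) auto
        then show ?thesis using assms(4) True by simp
      next
        case False
        have "multiplicity q (gcd (p * n) M) \<le> multiplicity q (p * n)"
          using assms prime_gt_0_nat by (intro dvd_imp_multiplicity_le) auto
        also have "\<dots> = multiplicity q n"
          using assms q False prime_gt_0_nat[OF assms(1)] primes_dvd_imp_eq[of q p]
          by (subst prime_elem_multiplicity_mult_distrib) (auto intro: not_dvd_imp_multiplicity_0)
        finally show ?thesis .
      qed
    qed
  qed simp
qed simp

text \<open>As long as n does not divide M, some prime occurs in n more often than in M; cancelling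
  it once changes neither \<gamma> nor the gcd.\<close>

lemma depends_on_gcd:
  fixes \<gamma> :: "nat \<Rightarrow> 'a"
  assumes "M > 0" "\<And>p n. prime p \<Longrightarrow> n > 0 \<Longrightarrow> multiplicity p M \<le> multiplicity p n \<Longrightarrow> \<gamma> (p * n) = \<gamma> n" "n > 0"
  shows "\<gamma> n = \<gamma> (gcd n M)"
  using assms(3)
proof (induction n rule: less_induct)
  case (less n)
  show ?case
  proof (cases "n dvd M")
    case True
    then show ?thesis by (simp add: gcd_nat.absorb1)
  next
    case False
    then obtain p where p: "prime p" "\<not> multiplicity p n \<le> multiplicity p M"
      using multiplicity_le_imp_dvd[of n M] less.prems by auto
    then have "p dvd n" by (metis le0 not_dvd_imp_multiplicity_0)
    then obtain n' where n': "n = p * n'" by (elim dvdE)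
    have n'0: "n' > 0" "n' < n" using less.prems prime_gt_1_nat[OF p(1)] by (auto simp: n')
    have "multiplicity p n = Suc (multiplicity p n')"
      unfolding n' using n'0 p(1) by (intro multiplicity_times_same) auto
    then have le: "multiplicity p M \<le> multiplicity p n'" using p(2) by simp
    have "\<gamma> n = \<gamma> n'" unfolding n' by (rule assms(2)[OF p(1) n'0(1) le])
    also have "\<dots> = \<gamma> (gcd n' M)" by (rule less.IH[OF n'0(2,1)])
    also have "gcd n' M = gcd n M" unfolding n' by (rule gcd_prime_mult_eq[OF p(1) assms(1) n'0(1) le, symmetric])
    finally show ?thesis .
  qed
qed

lemma (in integral_form) theta_log_depends_on_gcd:
  fixes \<beta> :: "nat \<Rightarrow> complex"
  assumes "\<And>n. n > 0 \<Longrightarrow> of_nat n * l n = (\<Sum>d | d dvd n. \<beta> d)" "n > 0"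
  shows "\<beta> n / of_nat n = \<beta> (gcd n (N\<^sup>2)) / of_nat (gcd n (N\<^sup>2))"
proof (rule depends_on_gcd[where \<gamma> = "\<lambda>n. \<beta> n / of_nat n", OF _ _ assms(2)])
  have N: "N > 0" using orders by (simp add: cusp_orders_def)
  then show "0 < N\<^sup>2" by simp
  define \<alpha> where "\<alpha> n = of_nat n * l n" for n
  have \<alpha>: "\<alpha> n = (\<Sum>d | d dvd n. \<beta> d)" if "n > 0" for n using assms(1)[OF that] by (simp add: \<alpha>_def)
  fix p n :: nat assume p: "prime p" and n: "n > 0" and mult: "multiplicity p (N\<^sup>2) \<le> multiplicity p n"
  have p0: "p > 0" using p prime_gt_0_nat by auto
  define j where "j = multiplicity p n"
  obtain m where m: "n = p ^ j * m" "\<not> p dvd m"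
    unfolding j_def by (rule multiplicity_decompose'[of n p]) (use n p in auto)
  have m0: "m > 0" using n m(1) by (cases m) auto
  have "\<beta> (p ^ (j + 1) * m) = of_nat p * \<beta> (p ^ j * m)"
  proof (rule hecke_step[OF \<alpha> p _ m0 m(2)])
    fix m :: nat assume m: "m > 0" "\<not> p dvd m"
    show "\<alpha> (p ^ (j + 1) * m) + of_nat p * (if j = 0 then 0 else \<alpha> (p ^ (j - 1) * m)) = (of_nat p + 1) * \<alpha> (p ^ j * m)"
    proof (cases "p dvd N")
      case False
      have "0 < p ^ j * m" using p0 m by simp
      from hecke_relation_coprime[OF p False this]
      have rel: "\<alpha> (p * (p ^ j * m)) + (if p dvd p ^ j * m then of_nat p * \<alpha> (p ^ j * m div p) else 0) =
          (of_nat p + 1) * \<alpha> (p ^ j * m)" unfolding \<alpha>_def .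
      show ?thesis
      proof (cases j)
        case 0
        then show ?thesis using rel m(2) by simp
      next
        case (Suc i)
        then show ?thesis using rel p0 by (simp add: mult.assoc)
      qed
    next
      case True
      define e where "e = multiplicity (int p) (int N)"
      have e_eq: "e = multiplicity p N" by (simp add: e_def multiplicity_int)
      have "e \<ge> 1" unfolding e_eq using True N p by (simp add: Suc_le_eq prime_multiplicity_gt_zero_iff)
      \<comment> \<open>For p dividing N the relation is available from j = e + 1 on. Since 2 e >= e
        + 1, the modulus N^2 covers the exceptions for all primes at once.\<close>
      moreover have "multiplicity p (N\<^sup>2) = 2 * e" unfolding e_eq
        using N p by (simp add: prime_elem_multiplicity_power_distrib)
      ultimately have "e + 1 \<le> j" using mult by (simp add: j_def)
      then obtain i where i: "j = e + 1 + i" using le_Suc_ex by blast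
      have "0 < p ^ i * m" using p0 m by simp
      from hecke_relation_dvd[OF p this, folded e_def]
      have "\<alpha> (p ^ (e + 2) * (p ^ i * m)) + of_nat p * \<alpha> (p ^ e * (p ^ i * m)) =
          (of_nat p + 1) * \<alpha> (p ^ (e + 1) * (p ^ i * m))" unfolding \<alpha>_def .
      then show ?thesis unfolding i by (simp add: power_add mult_ac)
    qed
  qed
  then have "\<beta> (p * n) = of_nat p * \<beta> n" unfolding m(1) by (simp add: mult.assoc)
  then show "\<beta> (p * n) / of_nat (p * n) = \<beta> n / of_nat n" using p0 by simp
qed

section \<open>Integrality of the exponents\<close>

lemma theta_log_exists:
  fixes G :: "int fps"
  assumes "fps_nth G 0 = 1"
  obtains A where "has_theta_log G A"
proof -
  have "G * fps_right_inverse G 1 = 1" by (rule fps_right_inverse) (simp add: assms)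
  then have "has_theta_log G (fps_X * fps_deriv G * fps_right_inverse G 1)"
    by (simp add: has_theta_log_def mult_ac)
  then show ?thesis using that by blast
qed

lemma has_theta_log_unique:
  fixes G :: "complex fps"
  assumes "has_theta_log G A" "has_theta_log G B" "fps_nth G 0 \<noteq> 0"
  shows "A = B"
proof -
  have "A * G = fps_X * fps_deriv G" using assms(1) by (simp only: has_theta_log_def)
  also have "\<dots> = B * G" using assms(2) by (simp only: has_theta_log_def)
  finally have "A * G = B * G" .
  moreover have "G \<noteq> 0" using assms(3) by auto
  ultimately show ?thesis using mult_right_cancel by blast
qed

text \<open>The substitution $q \mapsto cq$ turns $G / c$ into an integral series with constant term 1.\<close>

lemma scaled_theta_log_integral:
  fixes G :: "int fps"
  assumes "fps_nth G 0 = c" "c \<noteq> 0" "has_theta_log (fps_of_int_fps G) \<alpha>"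
  obtains A where "\<And>n. of_int (fps_nth A n) = of_int c ^ n * fps_nth \<alpha> n"
    "\<And>p n. prime p \<Longrightarrow> n > 0 \<Longrightarrow> int p dvd fps_nth A (p * n) - fps_nth A n"
proof -
  define H :: "int fps" where "H = Abs_fps (\<lambda>n. if n = 0 then 1 else c ^ (n - 1) * fps_nth G n)"
  have H0: "fps_nth H 0 = 1" by (simp add: H_def)
  have cH: "of_int c * fps_nth (fps_of_int_fps H) n = of_int c ^ n * fps_nth (fps_of_int_fps G) n" for n
    using assms(1) by (cases n) (auto simp: H_def)
  obtain A where A: "has_theta_log H A" using theta_log_exists[OF H0] .
  define B where "B = Abs_fps (\<lambda>n. of_int c ^ n * fps_nth \<alpha> n)"
  have "has_theta_log (fps_of_int_fps H) B" unfolding has_theta_log_def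
  proof (rule fps_ext)
    fix n
    have "of_int c * fps_nth (fps_X * fps_deriv (fps_of_int_fps H)) n = of_nat n * (of_int c * fps_nth (fps_of_int_fps H) n)"
      by (cases n) (simp_all add: mult_ac del: fps_of_int_fps_nth)
    also have "\<dots> = of_int c ^ n * (of_nat n * fps_nth (fps_of_int_fps G) n)"
      unfolding cH by (simp add: mult_ac)
    also have "of_nat n * fps_nth (fps_of_int_fps G) n = (\<Sum>i\<le>n. fps_nth \<alpha> i * fps_nth (fps_of_int_fps G) (n - i))"
      by (rule has_theta_log_nth[OF assms(3)])
    also have "of_int c ^ n * \<dots> = (\<Sum>i\<le>n. of_int c * (fps_nth B i * fps_nth (fps_of_int_fps H) (n - i)))"
      unfolding sum_distrib_left
    proof (rule sum.cong)
      fix i assume "i \<in> {..n}"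
      then have "of_int c ^ n = of_int c ^ i * (of_int c :: complex) ^ (n - i)" by (simp flip: power_add)
      then show "of_int c ^ n * (fps_nth \<alpha> i * fps_nth (fps_of_int_fps G) (n - i)) =
          of_int c * (fps_nth B i * fps_nth (fps_of_int_fps H) (n - i))"
        using cH[of "n - i"] by (simp add: B_def mult_ac del: fps_of_int_fps_nth)
    qed simp
    also have "\<dots> = of_int c * fps_nth (B * fps_of_int_fps H) n"
      by (simp only: fps_mult_nth atLeast0AtMost sum_distrib_left)
    finally show "fps_nth (fps_X * fps_deriv (fps_of_int_fps H)) n = fps_nth (B * fps_of_int_fps H) n"
      using assms(2) by simp
  qed
  then have "fps_of_int_fps A = B"
    using has_theta_log_unique[OF has_theta_log_fps_of_int_fps[OF A]] H0 by simp
  then have eq: "of_int (fps_nth A n) = of_int c ^ n * fps_nth \<alpha> n" for n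
    by (metis (no_types, lifting) B_def fps_nth_Abs_fps fps_of_int_fps_nth)
  show ?thesis by (rule that[OF eq]) (rule prime_dvd_theta_log_diff[OF H0 A])
qed

lemma common_denominator:
  assumes "finite S" "\<And>x. x \<in> S \<Longrightarrow> (g x :: complex) \<in> \<rat>"
  obtains r :: nat where "r > 0" "\<And>x. x \<in> S \<Longrightarrow> of_nat r * g x \<in> \<int>"
proof -
  have "\<exists>r::nat. r > 0 \<and> (\<forall>x\<in>S. of_nat r * g x \<in> \<int>)"
    using assms
  proof (induction S rule: finite_induct)
    case empty
    then show ?case by (intro exI[of _ 1]) simp
  next
    case (insert x S)
    then obtain r where r: "r > 0" "\<forall>x\<in>S. of_nat r * g x \<in> \<int>" by auto
    obtain a b where ab: "b > 0" "g x = of_int a / of_int b" using insert.prems[of x] by (auto elim!: Rats_cases')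
    show ?case
    proof (intro exI[of _ "r * nat b"] conjI ballI)
      show "r * nat b > 0" using r ab by simp
      fix y assume y: "y \<in> insert x S"
      have b: "of_nat (nat b) = (of_int b :: complex)" using ab(1) by simp
      show "of_nat (r * nat b) * g y \<in> \<int>"
      proof (cases "y = x")
        case True
        then have "of_nat (nat b) * g y = of_int a" using ab by (simp add: b)
        then have eq: "of_nat (r * nat b) * g y = of_nat r * of_int a" by (simp only: of_nat_mult mult.assoc)
        show ?thesis unfolding eq by simp
      next
        case False
        then have "of_int b * (of_nat r * g y) \<in> \<int>" using r y by simp
        then show ?thesis by (simp add: b mult_ac)
      qed
    qed
  qed
  then show ?thesis using that by blast
qed

lemma sum_in_Rats: "(\<And>x. x \<in> S \<Longrightarrow> g x \<in> \<rat>) \<Longrightarrow> sum g S \<in> (\<rat> :: 'a::field_char_0 set)"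
  by (induction S rule: infinite_finite_induct) auto

lemma divisor_inverse_Rats:
  assumes "\<And>n. n > 0 \<Longrightarrow> \<alpha> n \<in> (\<rat> :: complex set)" "n > 0"
  shows "divisor_inverse \<alpha> n \<in> \<rat>"
  using assms(2)
proof (induction n rule: less_induct)
  case (less n)
  show ?case unfolding divisor_inverse.simps[of \<alpha> n]
  proof (intro Rats_diff sum_in_Rats)
    fix d assume "d \<in> {d. d dvd n \<and> d < n}"
    then show "divisor_inverse \<alpha> d \<in> \<rat>" using less by (auto intro: dvd_pos_nat)
  qed (use assms(1) less.prems in auto)
qed

text \<open>A priori the exponents are rational, as powers of c have to be inverted. Being functions
  of gcd(n, M), they have a common denominator r, so (G / c)^r is an integral product. Gauss's lemma
  then gives c | G, and the integral series G / c with constant term 1 has integral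
  exponents.\<close>

theorem theta_log_coefficients_integral:
  fixes G :: "int fps"
  assumes "fps_nth G 0 = c" "c \<noteq> 0" "has_theta_log (fps_of_int_fps G) \<alpha>" "fps_nth \<alpha> 0 = 0"
    "M > 0" "\<And>n. n > 0 \<Longrightarrow> divisor_inverse (fps_nth \<alpha>) n / of_nat n =
        divisor_inverse (fps_nth \<alpha>) (gcd n M) / of_nat (gcd n M)"
  obtains B where "\<And>n. n > 0 \<Longrightarrow> divisor_inverse (fps_nth \<alpha>) n = of_nat n * of_int (B n)"
proof -
  define \<beta> where "\<beta> = divisor_inverse (fps_nth \<alpha>)"
  have \<beta>: "fps_nth \<alpha> n = (\<Sum>d | d dvd n. \<beta> d)" if "n > 0" for n
    unfolding \<beta>_def by (rule sum_divisor_inverse[OF that, symmetric])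
  define \<gamma> where "\<gamma> n = \<beta> n / of_nat n" for n
  have \<gamma>gcd: "\<gamma> n = \<gamma> (gcd n M)" if "n > 0" for n using assms(6)[OF that] by (simp add: \<gamma>_def \<beta>_def)
  have "fps_nth \<alpha> n \<in> \<rat>" for n
  proof -
    obtain A where "of_int (fps_nth A n) = of_int c ^ n * fps_nth \<alpha> n" using scaled_theta_log_integral[OF assms(1-3)] by metis
    then have "fps_nth \<alpha> n = of_int (fps_nth A n) / of_int (c ^ n)" using assms(2) by (simp add: field_simps)
    then show ?thesis by simp
  qed
  then have "\<beta> n \<in> \<rat>" if "n > 0" for n unfolding \<beta>_def using divisor_inverse_Rats that by blast
  then have "\<gamma> d \<in> \<rat>" if "d \<in> {d. d dvd M}" for d
    using that assms(5) unfolding \<gamma>_def by (auto intro!: Rats_divide intro: dvd_pos_nat)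
  then obtain r where r: "r > 0" "\<And>d. d \<in> {d. d dvd M} \<Longrightarrow> of_nat r * \<gamma> d \<in> \<int>"
    using common_denominator[of "{d. d dvd M}" \<gamma>] assms(5) by auto
  have "of_nat r * \<gamma> n \<in> \<int>" if "n > 0" for n using r(2)[of "gcd n M"] \<gamma>gcd[OF that] by simp
  then have "\<exists>z. of_nat r * \<gamma> n = of_int z" if "n > 0" for n using that by (auto elim!: Ints_cases)
  then obtain z where z: "\<And>n. n > 0 \<Longrightarrow> of_nat r * \<gamma> n = of_int (z n)" by metis
  define u where "u = fps_const (1 / of_int c ^ r) * fps_of_int_fps G ^ r"
  have "has_theta_log (fps_const (1 / of_int c ^ r)) (0 :: complex fps)" by (simp add: has_theta_log_def)
  from has_theta_log_mult[OF this has_theta_log_power[OF assms(3), of r]]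
  have u: "has_theta_log u (of_nat r * \<alpha>)" by (simp add: u_def)
  have "fps_nth u n \<in> \<int>" for n
  proof (rule integral_if_theta_log_integral[OF u])
    show "fps_nth u 0 = 1" using assms(1,2) by (simp add: u_def fps_nth_power_0)
    show "fps_nth (of_nat r * \<alpha>) 0 = 0" by (simp add: fps_of_nat[symmetric] assms(4))
    show "fps_nth (of_nat r * \<alpha>) n = of_int (\<Sum>d | d dvd n. int d * z d)" if "n > 0" for n
    proof -
      have "of_int (int d * z d) = of_nat r * \<beta> d" if "d \<in> {d. d dvd n}" for d
      proof -
        have "d > 0" using that \<open>n > 0\<close> by (auto intro: dvd_pos_nat)
        then show ?thesis using z[of d] by (simp add: \<gamma>_def field_simps)
      qed
      then have "(\<Sum>d | d dvd n. of_int (int d * z d)) = (\<Sum>d | d dvd n. of_nat r * \<beta> d)" by (intro sum.cong) auto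
      then show ?thesis using \<beta>[OF that] by (simp add: fps_of_nat[symmetric] sum_distrib_left)
    qed
  qed simp
  then have "\<exists>y. fps_nth u n = of_int y" for n by (meson Ints_cases)
  then obtain y where y: "\<And>n. fps_nth u n = of_int (y n)" by metis
  have "int (nat \<bar>c\<bar>) ^ r dvd fps_nth (G ^ r) n" for n
  proof -
    have "of_int (fps_nth (G ^ r) n) = fps_nth (fps_of_int_fps G ^ r) n"
      by (simp flip: fps_of_int_fps_power)
    also have "\<dots> = of_int c ^ r * fps_nth u n" using assms(2) by (simp add: u_def)
    also have "\<dots> = of_int (c ^ r * y n)" by (simp add: y)
    finally have "fps_nth (G ^ r) n = c ^ r * y n" by (simp only: of_int_eq_iff)
    moreover have "int (nat \<bar>c\<bar>) ^ r dvd c ^ r" by (simp add: dvd_power_same)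
    ultimately show ?thesis by simp
  qed
  then have "int (nat \<bar>c\<bar>) dvd fps_nth G n" for n
    using dvd_int_fps_power[of "nat \<bar>c\<bar>" r G] assms(2) r(1) by auto
  then have "c * (fps_nth G n div c) = fps_nth G n" for n by simp
  then have G: "G = fps_const c * Abs_fps (\<lambda>n. fps_nth G n div c)" (is "_ = _ * ?g")
    by (intro fps_ext) simp
  have g0: "fps_nth ?g 0 = 1" using assms(1,2) by simp
  obtain A where A: "has_theta_log ?g A" using theta_log_exists[OF g0] .
  have "has_theta_log (fps_const c) (0 :: int fps)" by (simp add: has_theta_log_def)
  from has_theta_log_mult[OF this A] have "has_theta_log G A" using G by simp
  then have A\<alpha>: "fps_of_int_fps A = \<alpha>"
    using has_theta_log_unique[OF has_theta_log_fps_of_int_fps assms(3)] assms(1,2) by simp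
  have \<beta>_int: "\<beta> n = of_int (divisor_inverse (fps_nth A) n)" if "n > 0" for n
  proof -
    have "fps_nth \<alpha> n = (\<Sum>d | d dvd n. of_int (divisor_inverse (fps_nth A) d))" if "n > 0" for n
      using sum_divisor_inverse[OF that, of "fps_nth A"] by (simp flip: A\<alpha> of_int_sum)
    from divisor_inverse_unique[OF this that] show ?thesis by (simp add: \<beta>_def)
  qed
  show ?thesis
  proof (rule that)
    fix n :: nat assume n: "n > 0"
    have "int n * (divisor_inverse (fps_nth A) n div int n) = divisor_inverse (fps_nth A) n"
      using dvd_divisor_inverse_theta_log[OF g0 A n] by simp
    then show "divisor_inverse (fps_nth \<alpha>) n = of_nat n * of_int (divisor_inverse (fps_nth A) n div int n)"
      using \<beta>_int[OF n] unfolding \<beta>_def by (metis of_int_mult of_int_of_nat_eq)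
  qed
qed

section \<open>Lambert series\<close>

text \<open>The divisor sum \<sigma>_(-1)(n), so that \<open>lambert\<close> is minus the logarithm
  of the Euler product. For n = 0 the sum over the infinite set of divisors is 0 by convention, as
  the vanishing constant term requires.\<close>

definition lambert_coeff :: "nat \<Rightarrow> complex" where
  "lambert_coeff n = (\<Sum>d | d dvd n. 1 / of_nat d)"

definition lambert :: "complex \<Rightarrow> complex" where
  "lambert w = (\<Sum>n. lambert_coeff n * w ^ n)"

lemma lambert_coeff_0 [simp]: "lambert_coeff 0 = 0"
  by (simp add: lambert_coeff_def)

lemma one_minus_power_nonzero:
  assumes "norm (w::complex) < 1"
  shows "1 - w ^ Suc n \<noteq> 0"
proof
  assume "1 - w ^ Suc n = 0"
  then have "norm (w ^ Suc n) = 1" by simp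
  moreover have "norm (w ^ Suc n) < 1" using assms by (simp add: norm_power power_less_one_iff del: power_Suc)
  ultimately show False by simp
qed

lemma geometric_Suc_sums:
  assumes "norm (x::'a::{real_normed_field, banach}) < 1"
  shows "(\<lambda>n. x ^ Suc n) sums (x / (1 - x))"
  using sums_mult[OF geometric_sums[OF assms], of x] by (simp add: mult_ac)

lemma minus_Ln_one_minus_sums:
  assumes "norm w < 1"
  shows "(\<lambda>n. w ^ Suc n / of_nat (Suc n)) sums (- Ln (1 - w))"
proof -
  have "(\<lambda>n. (- 1) ^ Suc n / of_nat n * (- w) ^ n) sums Ln (1 + - w)"
    by (rule Ln_series) (use assms in simp)
  then have "(\<lambda>n. - ((- 1) ^ Suc n / of_nat n * (- w) ^ n)) sums (- Ln (1 - w))" using sums_minus by fastforce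
  also have "(\<lambda>n. - ((- 1) ^ Suc n / of_nat n * (- w) ^ n)) = (\<lambda>n. w ^ n / of_nat n)"
  proof
    fix n
    have "(- 1) ^ n * (- w) ^ n = w ^ n" unfolding power_mult_distrib[symmetric] by simp
    then show "- ((- 1) ^ Suc n / of_nat n * (- w) ^ n) = w ^ n / of_nat n" by simp
  qed
  finally have "(\<lambda>n. w ^ n / of_nat n) sums (- Ln (1 - w))" .
  then show ?thesis by (subst sums_Suc_iff) simp
qed

text \<open>All three expansions of the Lambert series sum the family
  $w^{(n+1)(k+1)} / (k+1)$, over $n$ first, over $k$ first, and along $(n+1)(k+1)$.\<close>

lemma
  assumes w: "norm w < 1"
  shows lambert_sums: "(\<lambda>n. lambert_coeff n * w ^ n) sums lambert w"
    and lambert_series_sums: "(\<lambda>k. w ^ Suc k / (of_nat (Suc k) * (1 - w ^ Suc k))) sums lambert w"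
    and minus_Ln_sums_lambert: "(\<lambda>n. - Ln (1 - w ^ Suc n)) sums lambert w"
proof -
  define g where "g = (\<lambda>(k, n). w ^ (Suc n * Suc k) / of_nat (Suc k))"
  have small: "norm (w ^ Suc k) < 1" for k using w by (simp add: norm_power power_less_one_iff del: power_Suc)
  have inner: "(\<lambda>n. v ^ (Suc n * Suc k) / of_nat (Suc k)) sums (v ^ Suc k / (1 - v ^ Suc k) / of_nat (Suc k))"
    if "norm (v ^ Suc k) < 1" for v :: "'a :: {real_normed_field, banach}" and k
    using sums_divide[OF geometric_Suc_sums[OF that], of "of_nat (Suc k)"]
    by (simp only: power_mult[symmetric] mult.commute)
  have inner_abs: "summable (\<lambda>n. norm (g (k, n)))" for k
    using sums_summable[OF inner[of "norm w" k]] small[of k]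
    by (simp add: g_def norm_power norm_divide norm_mult del: power_Suc mult_Suc mult_Suc_right of_nat_Suc)
  define R where "R k = norm w ^ Suc k / (1 - norm w ^ Suc k) / of_nat (Suc k)" for k
  have innerR: "((\<lambda>n. norm (g (k, n))) has_sum R k) UNIV" for k
  proof (rule norm_summable_imp_has_sum)
    show "(\<lambda>n. norm (g (k, n))) sums R k"
      using inner[of "norm w" k] small[of k]
      by (simp add: g_def R_def norm_power norm_divide norm_mult del: power_Suc mult_Suc mult_Suc_right of_nat_Suc)
  qed (use inner_abs in simp)
  have "summable R"
  proof (rule summable_comparison_test')
    \<comment> \<open>A geometric majorant: 1 - |w|^(k+1) is at least 1 - |w|, and the factor
      1/(k+1) is at most 1.\<close>
    show "summable (\<lambda>k. norm w ^ Suc k * (1 / (1 - norm w)))"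
      using w by (intro summable_mult2) (simp add: summable_geometric)
    show "norm (R k) \<le> norm w ^ Suc k * (1 / (1 - norm w))" for k
    proof -
      have le: "norm w ^ Suc k \<le> norm w" using w power_Suc_le_self[of "norm w" k] by simp
      have p1: "norm w ^ Suc k < 1" using small[of k] by (simp add: norm_power del: power_Suc)
      have "norm w ^ Suc k / (1 - norm w ^ Suc k) \<le> norm w ^ Suc k / (1 - norm w)"
        using le w by (intro divide_left_mono) (auto intro!: mult_pos_pos simp del: power_Suc)
      moreover define X where "X = norm w ^ Suc k / (1 - norm w ^ Suc k)"
      moreover have X0: "X \<ge> 0" using p1 by (simp add: X_def del: power_Suc)
      have "X / real (Suc k) \<le> X / 1" using X0 by (intro divide_left_mono) auto
      moreover have "X / real (Suc k) \<ge> 0" using X0 by (intro divide_nonneg_nonneg) auto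
      ultimately have "norm w ^ Suc k / (1 - norm w ^ Suc k) \<le> norm w ^ Suc k / (1 - norm w)"
        "R k \<le> norm w ^ Suc k / (1 - norm w ^ Suc k)" "0 \<le> R k"
        by (simp_all add: R_def del: power_Suc of_nat_Suc)
      then show ?thesis by (simp del: power_Suc)
    qed
  qed
  moreover have "R k \<ge> 0" for k using innerR[of k] by (rule has_sum_nonneg) simp
  ultimately have "R summable_on UNIV" by (simp add: summable_on_UNIV_nonneg_real_iff)
  then have "(\<lambda>x. norm (g x)) summable_on (UNIV \<times> UNIV)"
    by (intro summable_on_SigmaI[OF innerR]) auto
  then have gsum: "g summable_on (UNIV \<times> UNIV)" by (rule abs_summable_summable)
  define S where "S = infsum g (UNIV \<times> UNIV)"
  have gS: "(g has_sum S) (UNIV \<times> UNIV)" unfolding S_def using gsum by (rule has_sum_infsum)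
  have "((\<lambda>k. w ^ Suc k / (1 - w ^ Suc k) / of_nat (Suc k)) has_sum S) UNIV"
  proof (rule has_sum_SigmaD[OF gS])
    show "((\<lambda>n. g (k, n)) has_sum w ^ Suc k / (1 - w ^ Suc k) / of_nat (Suc k)) UNIV" for k
      by (rule norm_summable_imp_has_sum[OF inner_abs]) (unfold g_def prod.case, rule inner[OF small])
  qed
  from has_sum_imp_sums[OF this]
  have A: "(\<lambda>k. w ^ Suc k / (of_nat (Suc k) * (1 - w ^ Suc k))) sums S"
    by (simp add: mult.commute del: power_Suc of_nat_Suc)
  have "((\<lambda>(n, k). g (k, n)) has_sum S) (UNIV \<times> UNIV)"
    using gS by (subst has_sum_reindex_bij_witness[where i = prod.swap and j = prod.swap and T = "UNIV \<times> UNIV" and h = g and s' = S]) auto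
  then have "((\<lambda>n. - Ln (1 - w ^ Suc n)) has_sum S) UNIV"
  proof (rule has_sum_SigmaD)
    fix n :: nat
    have "(\<lambda>k. (w ^ Suc n) ^ Suc k / of_nat (Suc k)) sums - Ln (1 - w ^ Suc n)"
      by (rule minus_Ln_one_minus_sums[OF small])
    moreover have "summable (\<lambda>k. norm ((w ^ Suc n) ^ Suc k / of_nat (Suc k)))"
    proof (rule summable_comparison_test')
      show "summable (\<lambda>k. norm (w ^ Suc n) ^ Suc k)"
        using geometric_Suc_sums[of "norm (w ^ Suc n)"] small[of n] by (simp add: sums_iff del: power_Suc)
      show "norm (norm ((w ^ Suc n) ^ Suc k / of_nat (Suc k))) \<le> norm (w ^ Suc n) ^ Suc k" for k
        by (simp add: norm_divide norm_power divide_le_eq mult_le_cancel_left1 del: power_Suc of_nat_Suc)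
    qed
    ultimately have "((\<lambda>k. (w ^ Suc n) ^ Suc k / of_nat (Suc k)) has_sum - Ln (1 - w ^ Suc n)) UNIV"
      by (intro norm_summable_imp_has_sum)
    then show "((\<lambda>k. case (n, k) of (n, k) \<Rightarrow> g (k, n)) has_sum - Ln (1 - w ^ Suc n)) UNIV"
      by (simp add: g_def power_mult del: power_Suc of_nat_Suc mult_Suc mult_Suc_right)
  qed
  from has_sum_imp_sums[OF this] have B: "(\<lambda>n. - Ln (1 - w ^ Suc n)) sums S" .
  \<comment> \<open>Regrouping along N + 1 = (n + 1)(k + 1). All indices are shifted by one, which
    accounts for \<open>Suc N div Suc k - 1\<close> and its inverse.\<close>
  have "((\<lambda>(N, k). w ^ Suc N / of_nat (Suc k)) has_sum S) (Sigma UNIV (\<lambda>N. {k. Suc k dvd Suc N}))"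
  proof (subst has_sum_reindex_bij_witness[where j = "\<lambda>(N, k). (k, Suc N div Suc k - 1)"
        and i = "\<lambda>(k, n). (Suc n * Suc k - 1, k)" and T = "UNIV \<times> UNIV" and h = g and s' = S])
    fix a assume a: "a \<in> Sigma UNIV (\<lambda>N. {k. Suc k dvd Suc N})"
    obtain N k where Nk: "a = (N, k)" by force
    have d: "Suc k dvd Suc N" using a by (simp add: Nk)
    then obtain j where j: "Suc N = Suc k * j" by (elim dvdE)
    then have "j > 0" by (cases j) auto
    then have j': "Suc (Suc N div Suc k - 1) = j"
      using nonzero_mult_div_cancel_left[of "Suc k" j] unfolding j by simp
    have eq: "Suc (Suc N div Suc k - 1) * Suc k = Suc N" unfolding j' using j by (simp only: mult.commute)
    show "(\<lambda>(k, n). (Suc n * Suc k - 1, k)) ((\<lambda>(N, k). (k, Suc N div Suc k - 1)) a) = a"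
      unfolding Nk prod.case eq by simp
    show "g ((\<lambda>(N, k). (k, Suc N div Suc k - 1)) a) = (\<lambda>(N, k). w ^ Suc N / of_nat (Suc k)) a"
      unfolding Nk prod.case g_def eq ..
  next
    fix b :: "nat \<times> nat"
    obtain k n where kn: "b = (k, n)" by force
    have eq: "Suc (Suc n * Suc k - 1) = Suc n * Suc k" by simp
    show "(\<lambda>(N, k). (k, Suc N div Suc k - 1)) ((\<lambda>(k, n). (Suc n * Suc k - 1, k)) b) = b"
      unfolding kn prod.case eq by (simp del: mult_Suc mult_Suc_right)
    show "(\<lambda>(k, n). (Suc n * Suc k - 1, k)) b \<in> Sigma UNIV (\<lambda>N. {k. Suc k dvd Suc N})"
      unfolding kn by (simp del: mult_Suc mult_Suc_right)
  qed (use gS in auto)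
  then have "((\<lambda>N. \<Sum>k | Suc k dvd Suc N. w ^ Suc N / of_nat (Suc k)) has_sum S) UNIV"
  proof (rule has_sum_SigmaD)
    fix N
    have "finite {k. Suc k dvd Suc N}" by (rule finite_subset[of _ "{..N}"]) (auto dest: dvd_imp_le)
    then show "((\<lambda>k. case (N, k) of (N, k) \<Rightarrow> w ^ Suc N / of_nat (Suc k)) has_sum
        (\<Sum>k | Suc k dvd Suc N. w ^ Suc N / of_nat (Suc k))) {k. Suc k dvd Suc N}"
      using has_sum_finite by fastforce
  qed
  from has_sum_imp_sums[OF this] have "(\<lambda>N. \<Sum>k | Suc k dvd Suc N. w ^ Suc N / of_nat (Suc k)) sums S" .
  moreover have "(\<Sum>k | Suc k dvd Suc N. w ^ Suc N / of_nat (Suc k)) = lambert_coeff (Suc N) * w ^ Suc N" for N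
  proof -
    have "{d. d dvd Suc N} = Suc ` {k. Suc k dvd Suc N}"
    proof
      show "{d. d dvd Suc N} \<subseteq> Suc ` {k. Suc k dvd Suc N}"
      proof
        fix d assume d: "d \<in> {d. d dvd Suc N}"
        then have "d \<noteq> 0" by (intro notI) simp
        then obtain k where "d = Suc k" by (cases d) auto
        with d show "d \<in> Suc ` {k. Suc k dvd Suc N}" by simp
      qed
    qed auto
    then have "lambert_coeff (Suc N) = (\<Sum>k | Suc k dvd Suc N. 1 / of_nat (Suc k))"
      unfolding lambert_coeff_def by (simp add: sum.reindex del: of_nat_Suc)
    then show ?thesis by (simp add: sum_distrib_right del: power_Suc of_nat_Suc)
  qed
  ultimately have "(\<lambda>N. lambert_coeff (Suc N) * w ^ Suc N) sums S" by simp
  then have C: "(\<lambda>n. lambert_coeff n * w ^ n) sums S" by (subst (asm) sums_Suc_iff) simp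
  then have "lambert w = S" unfolding lambert_def by (rule sums_unique[symmetric])
  with A B C show "(\<lambda>n. lambert_coeff n * w ^ n) sums lambert w"
    "(\<lambda>k. w ^ Suc k / (of_nat (Suc k) * (1 - w ^ Suc k))) sums lambert w"
    "(\<lambda>n. - Ln (1 - w ^ Suc n)) sums lambert w" by simp_all
qed

lemma euler_product_eq_exp_lambert:
  assumes "norm w < 1"
  shows "(\<Prod>n. 1 - w ^ Suc n) = exp (- lambert w)"
proof -
  have sums: "(\<lambda>n. Ln (1 - w ^ Suc n)) sums (- lambert w)"
    using sums_minus[OF minus_Ln_sums_lambert[OF assms]] by simp
  have "(\<Prod>n. exp (Ln (1 - w ^ Suc n))) = exp (\<Sum>n. Ln (1 - w ^ Suc n))"
    by (rule prodinf_exp) (use sums in \<open>simp add: sums_iff\<close>)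
  then show ?thesis using sums one_minus_power_nonzero[OF assms] by (simp add: sums_iff del: power_Suc)
qed

section \<open>Radial asymptotics at roots of unity\<close>

lemma exp_minus_over_one_minus_le:
  assumes "x > 0"
  shows "exp (- x) / (1 - exp (- x)) \<le> 1 / (x::real)"
proof -
  have "1 + x \<le> exp x" by (rule exp_ge_add_one_self)
  then have "exp (- x) * (1 + x) \<le> exp (- x) * exp x" by (intro mult_left_mono) auto
  then have "exp (- x) * x \<le> 1 - exp (- x)" by (simp add: algebra_simps flip: exp_add)
  then show ?thesis using assms by (simp add: divide_simps)
qed

text \<open>As $w$ tends radially to a root of unity of order $s$, only the terms of the Lambert series
  with $s \mid k$ contribute.\<close>

lemma lambert_asymptotics:
  assumes s: "s > 0" and \<zeta>: "\<And>k. \<zeta> ^ k = 1 \<longleftrightarrow> s dvd k"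
  shows "((\<lambda>t. of_real t * lambert (\<zeta> * of_real (exp (- t)))) \<longlongrightarrow> of_real (pi\<^sup>2 / (6 * (of_nat s)\<^sup>2))) (at_right 0)"
proof -
  have norm\<zeta>: "norm \<zeta> = 1"
  proof -
    have "norm \<zeta> ^ s = 1" using \<zeta>[of s] by (simp flip: norm_power)
    then show ?thesis using s by (metis norm_ge_zero power_eq_1_iff real_norm_def abs_norm_cancel not_gr_zero)
  qed
  define a where "a k t = of_real t * ((\<zeta> * of_real (exp (- t))) ^ Suc k /
      (of_nat (Suc k) * (1 - (\<zeta> * of_real (exp (- t))) ^ Suc k)))" for k and t :: real
  define b where "b k = (if s dvd Suc k then 1 / of_nat (Suc k) ^ 2 else 0 :: complex)" for k
  have w1: "norm (\<zeta> * of_real (exp (- t))) < 1" if "t > 0" for t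
    using that norm\<zeta> by (simp add: norm_mult)
  have pw: "(\<zeta> * of_real (exp (- t))) ^ Suc k = \<zeta> ^ Suc k * of_real (exp (- (Suc k * t)))" for t :: real and k
    by (simp only: power_mult_distrib of_real_power[symmetric] exp_of_nat_mult[symmetric]) simp
  \<comment> \<open>If s divides k + 1, the denominator 1 - exp(-(k+1) t) vanishes to first order
    and cancels the factor t. Otherwise it stays away from 0.\<close>
  have lim: "((\<lambda>t. a k t) \<longlongrightarrow> b k) (at_right 0)" for k
  proof (cases "s dvd Suc k")
    case True
    then have 1: "\<zeta> ^ Suc k = 1" using \<zeta> by blast
    have "((\<lambda>t. t * (exp (- (real (Suc k) * t)) / (real (Suc k) * (1 - exp (- (real (Suc k) * t)))))) \<longlongrightarrow> 1 / (real (Suc k))\<^sup>2) (at_right 0)"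
    proof -
      define x where "x = real (Suc k)"
      have "x > 0" by (simp add: x_def)
      then have "((\<lambda>t. t * (exp (- (x * t)) / (x * (1 - exp (- (x * t)))))) \<longlongrightarrow> inverse x * inverse x) (at_right 0)"
        by real_asymp
      moreover have "inverse x * inverse x = 1 / x\<^sup>2" by (simp add: power2_eq_square divide_inverse)
      ultimately show ?thesis by (simp only: x_def)
    qed
    from tendsto_of_real[OF this, where 'a = complex] show ?thesis
      using True unfolding a_def b_def pw 1 by (simp del: power_Suc of_nat_Suc)
  next
    case False
    then have nz: "1 - \<zeta> ^ Suc k * of_real (exp (- (real (Suc k) * 0))) \<noteq> 0" using \<zeta>[of "Suc k"] by auto
    have "((\<lambda>t::real. of_real t * (\<zeta> ^ Suc k * of_real (exp (- (Suc k * t))) /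
      (of_nat (Suc k) * (1 - \<zeta> ^ Suc k * of_real (exp (- (Suc k * t))))))) \<longlongrightarrow>
      of_real 0 * (\<zeta> ^ Suc k * of_real (exp (- (real (Suc k) * 0))) /
      (of_nat (Suc k) * (1 - \<zeta> ^ Suc k * of_real (exp (- (real (Suc k) * 0))))))) (at_right 0)"
      by (intro tendsto_intros) (use nz in \<open>simp_all del: power_Suc of_nat_Suc\<close>)
    then show ?thesis using False unfolding a_def b_def pw by (simp del: power_Suc of_nat_Suc)
  qed
  \<comment> \<open>A majorant independent of t, for Tannery's theorem. By the triangle inequality
    |1 - \<zeta>^(k+1) exp(-x)| is at least 1 - exp(-x), its value for \<zeta> = 1.\<close>
  have bound: "norm (a k t) \<le> 1 / (of_nat (Suc k))\<^sup>2" if t: "t > 0" for k t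
  proof -
    define x where "x = real (Suc k) * t"
    have x: "x > 0" using t by (simp add: x_def)
    have "norm (1 - \<zeta> ^ Suc k * of_real (exp (- x))) \<ge> norm (1::complex) - norm (\<zeta> ^ Suc k * of_real (exp (- x)))"
      by (rule norm_triangle_ineq2)
    then have d: "norm (1 - \<zeta> ^ Suc k * of_real (exp (- x))) \<ge> 1 - exp (- x)"
      using norm\<zeta> by (simp add: norm_mult norm_power del: power_Suc)
    have "norm (a k t) = t / real (Suc k) * (exp (- x) / norm (1 - \<zeta> ^ Suc k * of_real (exp (- x))))"
      unfolding a_def pw x_def[symmetric] using t norm\<zeta>
      by (simp add: norm_mult norm_divide norm_power del: power_Suc of_nat_Suc)
    also have "\<dots> \<le> t / real (Suc k) * (exp (- x) / (1 - exp (- x)))"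
      using d t x by (intro mult_left_mono divide_left_mono mult_pos_pos) (auto intro: less_le_trans[OF _ d] simp del: power_Suc)
    also have "\<dots> \<le> t / real (Suc k) * (1 / x)"
      using exp_minus_over_one_minus_le[OF x] t by (intro mult_left_mono) auto
    also have "\<dots> = 1 / (of_nat (Suc k))\<^sup>2" using t by (simp add: x_def power2_eq_square del: of_nat_Suc)
    finally show ?thesis .
  qed
  have summ: "summable (\<lambda>k. 1 / (of_nat (Suc k))\<^sup>2 :: real)"
    using inverse_squares_sums by (simp add: sums_iff add.commute)
  have ev: "eventually (\<lambda>(k, t). norm (a k t) \<le> 1 / (of_nat (Suc k))\<^sup>2) (at_top \<times>\<^sub>F at_right 0)"
    unfolding eventually_prod_filter
    by (rule exI[of _ "\<lambda>_. True"], rule exI[of _ "\<lambda>t. t > 0"])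
       (use bound eventually_at_right_less in \<open>auto simp del: of_nat_Suc\<close>)
  have tann: "((\<lambda>t. \<Sum>k. a k t) \<longlongrightarrow> (\<Sum>k. b k)) (at_right 0)"
    using tannerys_theorem[OF lim ev summ trivial_limit_at_right_real] by blast
  \<comment> \<open>Only the indices with k + 1 = s (n + 1) contribute, so the sum is zeta(2) /
    s^2.\<close>
  have "b sums of_real (pi\<^sup>2 / (6 * (of_nat s)\<^sup>2))"
  proof -
    have "(\<lambda>n. 1 / (real n + 1)\<^sup>2 / (real s)\<^sup>2) sums (pi\<^sup>2 / 6 / (real s)\<^sup>2)"
      using sums_divide[OF inverse_squares_sums, of "(real s)\<^sup>2"] by (simp add: add.commute)
    then have "(\<lambda>n. of_real (1 / (real n + 1)\<^sup>2 / (real s)\<^sup>2)) sums (of_real (pi\<^sup>2 / (6 * (of_nat s)\<^sup>2)) :: complex)"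
      by (subst sums_of_real_iff) simp
    moreover have "of_real (1 / (real n + 1)\<^sup>2 / (real s)\<^sup>2) = b (s * (n + 1) - 1)" for n
    proof -
      have Suc: "Suc (s * (n + 1) - 1) = s * (n + 1)" using s by simp
      have sq: "(of_nat (s * (n + 1)) :: complex)\<^sup>2 = (of_nat n + 1)\<^sup>2 * (of_nat s)\<^sup>2"
        unfolding power_mult_distrib[symmetric] by (simp add: algebra_simps)
      show ?thesis unfolding b_def Suc sq by simp
    qed
    ultimately have "(\<lambda>n. b (s * (n + 1) - 1)) sums of_real (pi\<^sup>2 / (6 * (of_nat s)\<^sup>2))" by simp
    then show ?thesis
    proof (subst (asm) sums_mono_reindex)
      show "strict_mono (\<lambda>n. s * (n + 1) - 1)"
      proof (rule strict_monoI)
        fix i j :: nat assume "i < j"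
        then have "s * (i + 1) < s * (j + 1)" using s by simp
        moreover have "0 < s * (i + 1)" using s by simp
        ultimately show "s * (i + 1) - 1 < s * (j + 1) - 1" by linarith
      qed
      fix k assume k: "k \<notin> range (\<lambda>n. s * (n + 1) - 1)"
      have "\<not> s dvd Suc k"
      proof
        assume "s dvd Suc k"
        then obtain j where j: "Suc k = s * j" by (elim dvdE)
        then obtain i where "j = i + 1" by (cases j) auto
        then have "k = s * (i + 1) - 1" using j by simp
        then show False using k by blast
      qed
      then show "b k = 0" by (simp add: b_def)
    qed
  qed
  then have "(\<Sum>k. b k) = of_real (pi\<^sup>2 / (6 * (of_nat s)\<^sup>2))" by (rule sums_unique[symmetric])
  moreover have "\<forall>\<^sub>F t in at_right 0. (\<Sum>k. a k t) = of_real t * lambert (\<zeta> * of_real (exp (- t)))"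
    using eventually_at_right_less[of 0]
  proof eventually_elim
    case (elim t)
    then show ?case using sums_mult[OF lambert_series_sums[OF w1[OF elim]], of "of_real t"]
      by (simp add: sums_iff a_def)
  qed
  ultimately show ?thesis using tann tendsto_cong by fastforce
qed

section \<open>Eta-quotients\<close>

text \<open>The zero-free function \<Phi> = f / q^m has a holomorphic logarithm on the disc.
  Differentiating \<Phi> = exp \<Lambda> identifies n l(n) as the formal logarithmic derivative of
  G. The leading coefficient survives as exp(l 0) and becomes the constant c of the result.\<close>

lemma integral_form_expansion:
  assumes "integral_q_expansion f" "\<And>z. z \<in> upper_half_plane \<Longrightarrow> f z \<noteq> 0"
  obtains m :: nat and G :: "int fps" and l \<Lambda> where "fps_nth G 0 \<noteq> 0" "exp (l 0) = of_int (fps_nth G 0)"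
    "\<And>w. w \<in> ball 0 1 \<Longrightarrow> (\<lambda>n. l n * w ^ n) sums \<Lambda> w"
    "\<And>z. z \<in> upper_half_plane \<Longrightarrow> f z = exp (2 * of_real pi * \<i> * of_nat m * z + \<Lambda> (qh 1 z))"
    "has_theta_log (fps_of_int_fps G) (Abs_fps (\<lambda>n. of_nat n * l n))"
proof -
  obtain a where a: "range a \<subseteq> \<int>" "has_q_expansion f 1 a"
    using assms(1) unfolding integral_q_expansion_def by blast
  then have "\<forall>n. \<exists>b. a n = of_int b" by (meson Ints_cases range_subsetD)
  then obtain b where b: "\<And>n. a n = of_int (b n)" by metis
  obtain m \<Phi> where \<Phi>: "a m \<noteq> 0" "\<And>n. n < m \<Longrightarrow> a n = 0" "\<Phi> holomorphic_on ball 0 1" "\<And>w. w \<in> ball 0 1 \<Longrightarrow> \<Phi> w \<noteq> 0"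
    "\<And>w. w \<in> ball 0 1 \<Longrightarrow> (\<lambda>n. a (n + m) * w ^ n) sums \<Phi> w"
    "\<And>z. z \<in> upper_half_plane \<Longrightarrow> f z = qh 1 z ^ m * \<Phi> (qh 1 z)"
    by (rule q_expansion_factor[OF zero_less_one a(2)], rule assms(2), assumption, rule that) simp_all
  obtain \<Lambda> where \<Lambda>: "\<Lambda> holomorphic_on ball 0 1" "\<And>w. w \<in> ball 0 1 \<Longrightarrow> \<Phi> w = exp (\<Lambda> w)"
    using contractible_imp_holomorphic_log[OF \<Phi>(3) convex_imp_contractible[OF convex_ball] \<Phi>(4)] by blast
  define l where "l n = (deriv ^^ n) \<Lambda> 0 / fact n" for n
  have l: "(\<lambda>n. l n * w ^ n) sums \<Lambda> w" if "w \<in> ball 0 1" for w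
    using holomorphic_power_series[OF \<Lambda>(1) that] by (simp add: l_def)
  define G where "G = Abs_fps (\<lambda>n. b (n + m))"
  have evb: "\<forall>\<^sub>F w in nhds 0. w \<in> ball (0::complex) 1" by (intro eventually_nhds_in_open) auto
  have G_exp: "\<Phi> has_fps_expansion fps_of_int_fps G"
    by (rule has_fps_expansionI) (use evb in eventually_elim, use \<Phi>(5) b in \<open>simp add: G_def\<close>)
  have L_exp: "\<Lambda> has_fps_expansion Abs_fps l"
    by (rule has_fps_expansionI) (use evb in eventually_elim, use l in simp)
  have "deriv \<Phi> has_fps_expansion fps_deriv (fps_of_int_fps G)"
    by (rule has_fps_expansion_deriv[OF G_exp])
  moreover have ev: "\<forall>\<^sub>F w in nhds 0. deriv \<Phi> w = deriv \<Lambda> w * \<Phi> w"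
    using evb
  proof eventually_elim
    case (elim w)
    have "(\<Lambda> has_field_derivative deriv \<Lambda> w) (at w)"
      using holomorphic_derivI[OF \<Lambda>(1) open_ball elim] .
    then have "((\<lambda>w. exp (\<Lambda> w)) has_field_derivative exp (\<Lambda> w) * deriv \<Lambda> w) (at w)"
      by (rule DERIV_chain2[OF DERIV_exp])
    then have "(\<Phi> has_field_derivative exp (\<Lambda> w) * deriv \<Lambda> w) (at w)"
      by (rule has_field_derivative_transform_within_open[OF _ open_ball elim]) (simp add: \<Lambda>(2))
    then show ?case using \<Lambda>(2)[OF elim] by (simp add: DERIV_imp_deriv)
  qed
  ultimately have "(\<lambda>w. deriv \<Lambda> w * \<Phi> w) has_fps_expansion fps_deriv (fps_of_int_fps G)"
    using has_fps_expansion_cong[OF ev refl] by blast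
  moreover have "(\<lambda>w. deriv \<Lambda> w * \<Phi> w) has_fps_expansion fps_deriv (Abs_fps l) * fps_of_int_fps G"
    by (intro has_fps_expansion_mult has_fps_expansion_deriv L_exp G_exp)
  ultimately have der: "fps_deriv (fps_of_int_fps G) = fps_deriv (Abs_fps l) * fps_of_int_fps G"
    by (rule fps_expansion_unique_complex)
  have "Abs_fps (\<lambda>n. of_nat n * l n) = fps_X * fps_deriv (Abs_fps l)"
  proof (rule fps_ext)
    show "fps_nth (Abs_fps (\<lambda>n. of_nat n * l n)) n = fps_nth (fps_X * fps_deriv (Abs_fps l)) n" for n
      by (cases n) simp_all
  qed
  then have log: "has_theta_log (fps_of_int_fps G) (Abs_fps (\<lambda>n. of_nat n * l n))"
    unfolding has_theta_log_def using der by (simp add: mult.assoc)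
  have zero: "w0 = c 0" if "(\<lambda>n. c n * 0 ^ n) sums w0" for c :: "nat \<Rightarrow> complex" and w0
    using that powser_sums_zero[of c] sums_unique2 by blast
  have "exp (l 0) = of_int (fps_nth G 0)"
    using zero[OF l[of 0]] zero[OF \<Phi>(5)[of 0]] \<Lambda>(2)[of 0] b by (simp add: G_def)
  moreover have "fps_nth G 0 \<noteq> 0" using \<Phi>(1) b by (simp add: G_def)
  moreover have "f z = exp (2 * of_real pi * \<i> * of_nat m * z + \<Lambda> (qh 1 z))" if z: "z \<in> upper_half_plane" for z
  proof -
    have "qh 1 z ^ m = exp (2 * of_real pi * \<i> * of_nat m * z)"
      by (simp add: qh_def mult_ac flip: exp_of_nat_mult)
    then show ?thesis using \<Phi>(6)[OF z] \<Lambda>(2)[OF qh_in_ball[OF z zero_less_one]] by (simp add: exp_add)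
  qed
  ultimately show ?thesis using that l log by blast
qed

text \<open>A second inversion: \<gamma>(d) is the sum of its divisor inverse over the \<delta>
  dividing gcd(d, M). So the infinite product with exponents \<gamma>(n) splits into Euler products
  in q^\<delta>, one for each divisor of M.\<close>

lemma sum_divisors_theta_log:
  fixes \<gamma> :: "nat \<Rightarrow> int"
  assumes "M > 0" "n > 0" "\<And>n. n > 0 \<Longrightarrow> \<gamma> n = \<gamma> (gcd n M)"
    "of_nat n * x = (\<Sum>d | d dvd n. of_nat d * of_int (\<gamma> d) :: complex)"
  shows "x = (\<Sum>\<delta> | \<delta> dvd M. of_int (divisor_inverse \<gamma> \<delta>) * (if \<delta> dvd n then lambert_coeff (n div \<delta>) else 0))"
proof -
  have fin: "finite {d. d dvd n}" "finite {d. d dvd M}" using assms(1,2) by auto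
  have \<gamma>: "\<gamma> d = (\<Sum>\<delta>\<in>{\<delta>. \<delta> dvd M}. if \<delta> dvd d then divisor_inverse \<gamma> \<delta> else 0)" if "d dvd n" for d
  proof -
    have "d > 0" using that assms(2) by (rule dvd_pos_nat[rotated])
    then have "\<gamma> d = (\<Sum>\<delta> | \<delta> dvd gcd d M. divisor_inverse \<gamma> \<delta>)"
      using assms(3)[of d] sum_divisor_inverse[of "gcd d M" \<gamma>] by simp
    also have "{\<delta>. \<delta> dvd gcd d M} = {\<delta>. \<delta> dvd M} \<inter> {\<delta>. \<delta> dvd d}" by auto
    finally show ?thesis using fin by (simp add: sum.inter_restrict)
  qed
  have inner: "(\<Sum>d\<in>{d. d dvd n}. if \<delta> dvd d then of_nat d / of_nat n else 0) =
      (if \<delta> dvd n then lambert_coeff (n div \<delta>) else 0)" for \<delta>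
  proof (cases "\<delta> dvd n")
    case True
    then obtain j where j: "n = \<delta> * j" by (elim dvdE)
    have \<delta>0: "\<delta> > 0" "j > 0" using j assms(2) by auto
    have "(\<Sum>d\<in>{d. d dvd n}. if \<delta> dvd d then of_nat d / of_nat n else 0) =
        (\<Sum>d\<in>{d. d dvd n} \<inter> {d. \<delta> dvd d}. of_nat d / of_nat n :: complex)"
      using fin(1) by (simp add: sum.inter_restrict)
    \<comment> \<open>With n = d e the fraction d / n is 1 / e, and \<delta> divides d exactly when
      e divides j.\<close>
    also have "\<dots> = (\<Sum>e | e dvd j. 1 / of_nat e)"
    proof (rule sum.reindex_bij_witness[where i = "\<lambda>e. n div e" and j = "\<lambda>d. n div d"])
      fix d assume d: "d \<in> {d. d dvd n} \<inter> {d. \<delta> dvd d}"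
      then obtain e where e: "n = d * e" by (auto elim: dvdE)
      obtain i where i: "d = \<delta> * i" using d by (auto elim: dvdE)
      have pos: "d > 0" "e > 0" using e assms(2) by auto
      have "n div d = e" "n div e = d" using e pos by auto
      moreover have "e dvd j"
      proof -
        have "\<delta> * j = \<delta> * (i * e)" using j e i by (metis mult.assoc)
        then have "j = i * e" using \<delta>0(1) by (metis mult_cancel1 less_irrefl)
        then show ?thesis by simp
      qed
      ultimately show "n div (n div d) = d" "n div d \<in> {e. e dvd j}" "1 / of_nat (n div d) = of_nat d / (of_nat n :: complex)"
        using e pos by (simp_all add: field_simps)
    next
      fix e assume "e \<in> {e. e dvd j}"
      then obtain i where i: "j = e * i" by (auto elim: dvdE)
      have pos: "e > 0" "i > 0" using i \<delta>0 by auto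
      have n: "n = e * (\<delta> * i)" by (simp add: j i)
      then have "n div e = \<delta> * i" "n div (\<delta> * i) = e" using pos \<delta>0 by auto
      then show "n div (n div e) = e" "n div e \<in> {d. d dvd n} \<inter> {d. \<delta> dvd d}" using n by auto
    qed
    also have "\<dots> = lambert_coeff (n div \<delta>)" using j \<delta>0 by (simp add: lambert_coeff_def)
    finally show ?thesis using True by simp
  next
    case False
    then have "\<not> \<delta> dvd d" if "d dvd n" for d using that dvd_trans by blast
    then show ?thesis using False by simp
  qed
  have "x = (\<Sum>d | d dvd n. of_nat d / of_nat n * of_int (\<gamma> d))"
    using assms(2,4) by (simp add: sum_divide_distrib[symmetric] field_simps)
  also have "\<dots> = (\<Sum>d | d dvd n. \<Sum>\<delta> | \<delta> dvd M. of_int (divisor_inverse \<gamma> \<delta>) * (if \<delta> dvd d then of_nat d / of_nat n else 0))"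
  proof (rule sum.cong)
    fix d assume "d \<in> {d. d dvd n}"
    then have "\<gamma> d = (\<Sum>\<delta>\<in>{\<delta>. \<delta> dvd M}. if \<delta> dvd d then divisor_inverse \<gamma> \<delta> else 0)" using \<gamma> by simp
    then have "of_nat d / of_nat n * of_int (\<gamma> d) =
      (\<Sum>\<delta>\<in>{\<delta>. \<delta> dvd M}. of_nat d / of_nat n * of_int (if \<delta> dvd d then divisor_inverse \<gamma> \<delta> else 0) :: complex)"
      by (simp only: of_int_sum sum_distrib_left)
    also have "\<dots> = (\<Sum>\<delta> | \<delta> dvd M. of_int (divisor_inverse \<gamma> \<delta>) * (if \<delta> dvd d then of_nat d / of_nat n else 0))"
      by (rule sum.cong) auto
    finally show "of_nat d / of_nat n * of_int (\<gamma> d) =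
      (\<Sum>\<delta> | \<delta> dvd M. of_int (divisor_inverse \<gamma> \<delta>) * (if \<delta> dvd d then of_nat d / of_nat n else 0) :: complex)" .
  qed simp
  also have "\<dots> = (\<Sum>\<delta> | \<delta> dvd M. of_int (divisor_inverse \<gamma> \<delta>) * (\<Sum>d | d dvd n. if \<delta> dvd d then of_nat d / of_nat n else 0))"
    by (subst sum.swap) (simp only: sum_distrib_left)
  finally show ?thesis unfolding inner .
qed

lemma log_eq_sum_lambert:
  assumes "\<And>w. w \<in> ball 0 1 \<Longrightarrow> (\<lambda>n. l n * w ^ n) sums \<Lambda> w" "M > 0"
    "\<And>n. n > 0 \<Longrightarrow> l n = (\<Sum>\<delta> | \<delta> dvd M. \<rho> \<delta> * (if \<delta> dvd n then lambert_coeff (n div \<delta>) else 0))"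
    "w \<in> ball 0 1"
  shows "\<Lambda> w = l 0 + (\<Sum>\<delta> | \<delta> dvd M. \<rho> \<delta> * lambert (w ^ \<delta>))"
proof -
  have S: "(\<lambda>n. (if \<delta> dvd n then lambert_coeff (n div \<delta>) else 0) * w ^ n) sums lambert (w ^ \<delta>)"
    if "\<delta> > 0" for \<delta>
  proof -
    have "norm (w ^ \<delta>) < 1" using power_in_ball[OF assms(4) that] by simp
    from lambert_sums[OF this]
    have "(\<lambda>n. (if \<delta> dvd \<delta> * n then lambert_coeff (\<delta> * n div \<delta>) else 0) * w ^ (\<delta> * n)) sums lambert (w ^ \<delta>)"
      using that by (simp add: power_mult)
    then show ?thesis
      by (subst (asm) sums_mono_reindex[where f = "\<lambda>n. (if \<delta> dvd n then lambert_coeff (n div \<delta>) else 0) * w ^ n"])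
         (use that in \<open>auto simp: strict_mono_def\<close>)
  qed
  have "(\<lambda>n. (if n = 0 then l 0 else 0) + (\<Sum>\<delta> | \<delta> dvd M. \<rho> \<delta> * ((if \<delta> dvd n then lambert_coeff (n div \<delta>) else 0) * w ^ n)))
      sums (l 0 + (\<Sum>\<delta> | \<delta> dvd M. \<rho> \<delta> * lambert (w ^ \<delta>)))"
  proof (intro sums_add sums_sum sums_mult S)
    show "(\<lambda>n. if n = 0 then l 0 else 0) sums l 0" using sums_single[of 0 "\<lambda>_. l 0"] by simp
  qed (use assms(2) in \<open>auto intro: dvd_pos_nat\<close>)
  also have "(\<lambda>n. (if n = 0 then l 0 else 0) + (\<Sum>\<delta> | \<delta> dvd M. \<rho> \<delta> * ((if \<delta> dvd n then lambert_coeff (n div \<delta>) else 0) * w ^ n))) =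
      (\<lambda>n. l n * w ^ n)"
  proof
    fix n
    show "(if n = 0 then l 0 else 0) + (\<Sum>\<delta> | \<delta> dvd M. \<rho> \<delta> * ((if \<delta> dvd n then lambert_coeff (n div \<delta>) else 0) * w ^ n)) = l n * w ^ n"
      using assms(3)[of n] by (cases "n = 0") (simp_all add: sum_distrib_right mult.assoc)
  qed
  finally show ?thesis using assms(1)[OF assms(4)] sums_unique2 by blast
qed

lemma dedekind_eta_eq:
  assumes "z \<in> upper_half_plane" "\<delta> > 0"
  shows "dedekind_eta (of_nat \<delta> * z) = exp (2 * of_real pi * \<i> * of_nat \<delta> * z / 24 - lambert (qh 1 z ^ \<delta>))"
proof -
  have q: "exp (2 * of_real pi * \<i> * (of_nat \<delta> * z)) = qh 1 z ^ \<delta>"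
    by (simp add: qh_def mult_ac flip: exp_of_nat_mult)
  have "norm (qh 1 z ^ \<delta>) < 1" using power_in_ball[OF qh_in_ball[OF assms(1) zero_less_one] assms(2)] by simp
  from euler_product_eq_exp_lambert[OF this] show ?thesis
    unfolding dedekind_eta_def q by (simp only: mult_exp_exp) (simp add: mult.assoc)
qed

text \<open>The exponent of $q$ is forced by comparing the growth of $f$ at the cusp $1/M$, computed from
  the Lambert series, with the growth at infinity transported by a matrix of \<open>\<Gamma>\<^sub>0(N)\<close>.\<close>

lemma order_at_infinity:
  assumes f: "\<And>z. z \<in> upper_half_plane \<Longrightarrow> f z = exp (2 * of_real pi * \<i> * of_nat m * z + \<Lambda> (qh 1 z))"
    and \<Lambda>: "\<And>w. w \<in> ball 0 1 \<Longrightarrow> \<Lambda> w = l0 + (\<Sum>\<delta> | \<delta> dvd M. of_int (\<rho> \<delta>) * lambert (w ^ \<delta>))"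
    and hol: "\<Lambda> holomorphic_on ball 0 1" and M: "M > 0"
    and inv: "\<And>z. z \<in> upper_half_plane \<Longrightarrow> mslash k f 1 0 (int M) 1 z = f z"
  shows "(\<Sum>\<delta> | \<delta> dvd M. of_int (\<rho> \<delta>) * real \<delta>) = - 24 * real m"
proof -
  define \<zeta> where "\<zeta> = exp (2 * of_real pi * \<i> / of_nat M)"
  \<comment> \<open>The matrix (1, 0; M, 1) carries v(y) to u(y). As y tends to 0, u(y) descends
    vertically to the cusp 1/M, while v(y) rises to infinity on the line Re z = -1/M.\<close>
  define u where "u y = 1 / of_nat M + \<i> * of_real y" for y :: real
  define v where "v y = \<i> / of_real ((real M)\<^sup>2 * y) - 1 / of_nat M" for y :: real
  \<comment> \<open>The limit of y times the Lambert part at u(y): with t = 2 pi \<delta> y and s =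
    M / \<delta>, the asymptotics give (pi^2 / (6 s^2)) / (2 pi \<delta>) for each \<delta>.\<close>
  define L where "L = (\<Sum>\<delta> | \<delta> dvd M. of_int (\<rho> \<delta>) * (pi * real \<delta> / (12 * (real M)\<^sup>2)))"
  have Imu: "Im (u y) = y" and Imv: "Im (v y) = 1 / ((real M)\<^sup>2 * y)" for y
    by (simp_all add: u_def v_def Im_divide_of_nat Im_divide_of_real)
  have normf: "norm (f z) = exp (- 2 * pi * m * Im z + Re (\<Lambda> (qh 1 z)))" if "z \<in> upper_half_plane" for z
    using f[OF that] by (simp add: norm_exp_eq_Re)
  have qu: "qh 1 (u y) = \<zeta> * of_real (exp (- (2 * pi * y)))" for y
  proof -
    have "2 * of_real pi * \<i> * u y / of_nat 1 = 2 * of_real pi * \<i> / of_nat M + of_real (- (2 * pi * y))"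
      by (simp add: u_def ring_distribs mult_ac)
    then show ?thesis unfolding qh_def \<zeta>_def by (simp only: exp_add exp_of_real)
  qed
  \<comment> \<open>Logarithms of absolute values in the transformation law, multiplied by y so that
    every term has a limit. The weight enters only through y ln(M y), which tends to 0.\<close>
  have eq: "y * (real_of_int k * ln (real M * y)) - 2 * pi * m * y\<^sup>2 + y * Re (\<Lambda> (qh 1 (u y))) =
      - 2 * pi * m / (real M)\<^sup>2 + y * Re (\<Lambda> (qh 1 (v y)))" if y: "y > 0" for y
  proof -
    have uH: "u y \<in> upper_half_plane" and vH: "v y \<in> upper_half_plane"
      using y M by (simp_all add: in_H Imu Imv)
    have c: "of_int (int M) * v y + of_int 1 = \<i> / of_real (real M * y)"
      using y M by (simp add: v_def field_simps power2_eq_square)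
    have "(of_int 1 * v y + of_int 0) / (of_int (int M) * v y + of_int 1) = u y"
      unfolding c using y M by (simp add: v_def u_def field_simps power2_eq_square)
    then have "(\<i> / of_real (real M * y)) powi (- k) * f (u y) = f (v y)"
      using inv[OF vH] unfolding mslash_def c by simp
    then have "norm ((\<i> / of_real (real M * y)) powi (- k) * f (u y)) = norm (f (v y))" by simp
    then have "(1 / (real M * y)) powi (- k) * norm (f (u y)) = norm (f (v y))"
      using y by (simp add: norm_mult norm_power_int norm_divide)
    moreover have "(1 / (real M * y)) powi (- k) = exp (real_of_int k * ln (real M * y))"
    proof -
      have "exp (ln (real M * y)) powi k = exp (real_of_int k * ln (real M * y))" by (rule exp_power_int)
      then show ?thesis using y M by (simp add: power_int_minus power_int_divide_distrib)
    qed
    ultimately have "exp (real_of_int k * ln (real M * y) + (- 2 * pi * m * y + Re (\<Lambda> (qh 1 (u y))))) =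
        exp (- 2 * pi * m * (1 / ((real M)\<^sup>2 * y)) + Re (\<Lambda> (qh 1 (v y))))"
      unfolding normf[OF uH] normf[OF vH] Imu Imv by (simp add: exp_add)
    then have "real_of_int k * ln (real M * y) + (- 2 * pi * m * y + Re (\<Lambda> (qh 1 (u y)))) =
        - 2 * pi * m * (1 / ((real M)\<^sup>2 * y)) + Re (\<Lambda> (qh 1 (v y)))" by (simp only: exp_inj_iff)
    then have "y * (real_of_int k * ln (real M * y) + (- 2 * pi * m * y + Re (\<Lambda> (qh 1 (u y))))) =
        y * (- 2 * pi * m * (1 / ((real M)\<^sup>2 * y)) + Re (\<Lambda> (qh 1 (v y))))" by simp
    then show ?thesis using y M by (simp add: algebra_simps power2_eq_square)
  qed
  have lim_lambert: "((\<lambda>y. of_real y * lambert (qh 1 (u y) ^ \<delta>)) \<longlongrightarrow> of_real (pi * real \<delta> / (12 * (real M)\<^sup>2))) (at_right 0)"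
    if dvd: "\<delta> dvd M" for \<delta>
  proof -
    obtain s where s: "M = \<delta> * s" using dvd by (elim dvdE)
    have \<delta>: "\<delta> > 0" "s > 0" using s M by auto
    \<comment> \<open>Along u(y) the variable q^\<delta> tends radially to \<zeta>^\<delta>, a root
      of unity of exact order s = M / \<delta>.\<close>
    have \<zeta>: "(\<zeta> ^ \<delta>) ^ j = 1 \<longleftrightarrow> s dvd j" for j
    proof -
      have "(\<zeta> ^ \<delta>) ^ j = exp (2 * of_real pi * \<i> * of_nat (\<delta> * j) / of_nat M)"
        by (simp add: \<zeta>_def mult_ac flip: exp_of_nat_mult)
      also have "\<dots> = 1 \<longleftrightarrow> M dvd \<delta> * j"
        using complex_root_unity_eq_1[of M "\<delta> * j"] M by (simp add: mult_ac)
      finally show ?thesis using s \<delta> by simp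
    qed
    have "filterlim (\<lambda>y. 2 * pi * real \<delta> * y) (at_right 0) (at_right 0)" using \<delta> by real_asymp
    from filterlim_compose[OF lambert_asymptotics[OF \<delta>(2) \<zeta>] this]
    have "((\<lambda>y. of_real (2 * pi * real \<delta> * y) * lambert (\<zeta> ^ \<delta> * of_real (exp (- (2 * pi * real \<delta> * y))))) \<longlongrightarrow>
        of_real (pi\<^sup>2 / (6 * (real s)\<^sup>2))) (at_right 0)" .
    from tendsto_divide[OF this tendsto_const[of "of_real (2 * pi * real \<delta>)"]]
    have "((\<lambda>y. of_real y * lambert (\<zeta> ^ \<delta> * of_real (exp (- (2 * pi * real \<delta> * y))))) \<longlongrightarrow>
        of_real (pi\<^sup>2 / (6 * (real s)\<^sup>2)) / of_real (2 * pi * real \<delta>)) (at_right 0)"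
      using \<delta> by (simp add: mult.assoc)
    moreover have "of_real (pi\<^sup>2 / (6 * (real s)\<^sup>2)) / of_real (2 * pi * real \<delta>) = (of_real (pi * real \<delta> / (12 * (real M)\<^sup>2)) :: complex)"
      unfolding of_real_divide[symmetric] s using \<delta> by (simp add: power2_eq_square field_simps)
    moreover have "\<zeta> ^ \<delta> * of_real (exp (- (2 * pi * real \<delta> * y))) = qh 1 (u y) ^ \<delta>" for y
      unfolding qu power_mult_distrib of_real_power[symmetric] exp_of_nat_mult[symmetric] by (simp add: mult_ac)
    ultimately show ?thesis by simp
  qed
  have "((\<lambda>y. of_real y * l0 + (\<Sum>\<delta> | \<delta> dvd M. of_int (\<rho> \<delta>) * (of_real y * lambert (qh 1 (u y) ^ \<delta>)))) \<longlongrightarrow>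
      of_real 0 * l0 + (\<Sum>\<delta> | \<delta> dvd M. of_int (\<rho> \<delta>) * of_real (pi * real \<delta> / (12 * (real M)\<^sup>2)))) (at_right 0)"
    by (intro tendsto_intros lim_lambert) auto
  moreover have "of_real 0 * l0 + (\<Sum>\<delta> | \<delta> dvd M. of_int (\<rho> \<delta>) * of_real (pi * real \<delta> / (12 * (real M)\<^sup>2))) = of_real L"
    by (simp add: L_def)
  ultimately have "((\<lambda>y. of_real y * l0 + (\<Sum>\<delta> | \<delta> dvd M. of_int (\<rho> \<delta>) * (of_real y * lambert (qh 1 (u y) ^ \<delta>)))) \<longlongrightarrow> of_real L) (at_right 0)"
    by (simp only:)
  moreover have "\<forall>\<^sub>F y in at_right 0. of_real y * l0 + (\<Sum>\<delta> | \<delta> dvd M. of_int (\<rho> \<delta>) * (of_real y * lambert (qh 1 (u y) ^ \<delta>))) =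
      of_real y * \<Lambda> (qh 1 (u y))"
    using eventually_at_right_less[of 0]
  proof eventually_elim
    case (elim y)
    then have "qh 1 (u y) \<in> ball 0 1" by (intro qh_in_ball) (simp_all add: in_H Imu)
    then show ?case by (simp add: \<Lambda> ring_distribs sum_distrib_left mult_ac)
  qed
  ultimately have "((\<lambda>y. of_real y * \<Lambda> (qh 1 (u y))) \<longlongrightarrow> of_real L) (at_right 0)"
    by (rule Lim_transform_eventually)
  from tendsto_Re[OF this] have lim_u: "((\<lambda>y. y * Re (\<Lambda> (qh 1 (u y)))) \<longlongrightarrow> L) (at_right 0)" by simp
  have "isCont \<Lambda> 0"
    using hol by (metis at_within_open centre_in_ball continuous_on_eq_continuous_within holomorphic_on_imp_continuous_on open_ball zero_less_one)
  moreover have "((\<lambda>y. qh 1 (v y)) \<longlongrightarrow> 0) (at_right 0)"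
  proof (rule tendsto_norm_zero_cancel)
    have "((\<lambda>y. exp (- 2 * pi * (1 / ((real M)\<^sup>2 * y)))) \<longlongrightarrow> 0) (at_right 0)" using M by real_asymp
    then show "((\<lambda>y. norm (qh 1 (v y))) \<longlongrightarrow> 0) (at_right 0)" by (simp add: norm_qh Imv)
  qed
  ultimately have "((\<lambda>y. \<Lambda> (qh 1 (v y))) \<longlongrightarrow> \<Lambda> 0) (at_right 0)" by (rule isCont_tendsto_compose)
  then have "((\<lambda>y. y * Re (\<Lambda> (qh 1 (v y)))) \<longlongrightarrow> 0 * Re (\<Lambda> 0)) (at_right 0)" by (intro tendsto_intros)
  then have "((\<lambda>y. - 2 * pi * m / (real M)\<^sup>2 + y * Re (\<Lambda> (qh 1 (v y)))) \<longlongrightarrow> - 2 * pi * m / (real M)\<^sup>2 + 0) (at_right 0)"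
    by (intro tendsto_add tendsto_const) simp
  moreover have "\<forall>\<^sub>F y in at_right 0. - 2 * pi * m / (real M)\<^sup>2 + y * Re (\<Lambda> (qh 1 (v y))) =
      y * (real_of_int k * ln (real M * y)) - 2 * pi * m * y\<^sup>2 + y * Re (\<Lambda> (qh 1 (u y)))"
    using eventually_at_right_less[of 0] by eventually_elim (simp only: eq)
  ultimately have 1: "((\<lambda>y. y * (real_of_int k * ln (real M * y)) - 2 * pi * m * y\<^sup>2 + y * Re (\<Lambda> (qh 1 (u y)))) \<longlongrightarrow>
      - 2 * pi * m / (real M)\<^sup>2 + 0) (at_right 0)" by (rule Lim_transform_eventually)
  have "((\<lambda>y. y * (real_of_int k * ln (real M * y)) - 2 * pi * m * y\<^sup>2) \<longlongrightarrow> 0) (at_right 0)"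
  proof -
    define M' k' m' where "M' = real M" and "k' = real_of_int k" and "m' = real m"
    have "M' > 0" using M by (simp add: M'_def)
    then have "((\<lambda>y. y * ln (M' * y)) \<longlongrightarrow> 0) (at_right 0)" by real_asymp
    then have "((\<lambda>y. k' * (y * ln (M' * y)) - 2 * pi * m' * y\<^sup>2) \<longlongrightarrow> k' * 0 - 2 * pi * m' * 0\<^sup>2) (at_right 0)"
      by (intro tendsto_intros)
    then show ?thesis by (simp add: M'_def k'_def m'_def mult_ac)
  qed
  from tendsto_add[OF this lim_u]
  have "((\<lambda>y. y * (real_of_int k * ln (real M * y)) - 2 * pi * m * y\<^sup>2 + y * Re (\<Lambda> (qh 1 (u y)))) \<longlongrightarrow> L) (at_right 0)" by simp
  from tendsto_unique[OF _ this 1] have "L = - 2 * pi * m / (real M)\<^sup>2" by simp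
  moreover have "L = (\<Sum>\<delta> | \<delta> dvd M. of_int (\<rho> \<delta>) * real \<delta>) * (pi / (12 * (real M)\<^sup>2))"
    by (simp add: L_def sum_distrib_left sum_distrib_right sum_divide_distrib mult_ac)
  ultimately have "(\<Sum>\<delta> | \<delta> dvd M. of_int (\<rho> \<delta>) * real \<delta>) * (pi / (12 * (real M)\<^sup>2)) = - 24 * real m * (pi / (12 * (real M)\<^sup>2))"
    by simp
  moreover have "pi / (12 * (real M)\<^sup>2) \<noteq> 0" using M by simp
  ultimately show ?thesis using mult_right_cancel by blast
qed

theorem theorem7:
  fixes N :: nat and k :: int and f :: "complex \<Rightarrow> complex"
  assumes "N > 0"
    and "f \<in> modular_forms k N"
    and "integral_q_expansion f"
    and "\<forall>z\<in>upper_half_plane. f z \<noteq> 0"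
  shows "\<exists>(c :: int) g. eta_quotient g \<and> (\<forall>z\<in>upper_half_plane. f z = of_int c * g z)"
proof -
  obtain m G l \<Lambda> where E: "fps_nth G 0 \<noteq> 0" "exp (l 0) = of_int (fps_nth G 0)"
    "\<And>w. w \<in> ball 0 1 \<Longrightarrow> (\<lambda>n. l n * w ^ n) sums \<Lambda> w"
    "\<And>z. z \<in> upper_half_plane \<Longrightarrow> f z = exp (2 * of_real pi * \<i> * of_nat m * z + \<Lambda> (qh 1 z))"
    "has_theta_log (fps_of_int_fps G) (Abs_fps (\<lambda>n. of_nat n * l n))"
    by (rule integral_form_expansion[OF assms(3)], rule assms(4)[rule_format], assumption, rule that) simp_all
  define c where "c = fps_nth G 0"
  define \<alpha> where "\<alpha> = Abs_fps (\<lambda>n. of_nat n * l n)"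
  define M where "M = N\<^sup>2"
  have M: "M > 0" using assms(1) by (simp add: M_def)
  have c0: "c \<noteq> 0" using E(1) by (simp add: c_def)
  obtain A where A: "\<And>n. of_int (fps_nth A n) = of_int c ^ n * fps_nth \<alpha> n"
    "\<And>p n. prime p \<Longrightarrow> n > 0 \<Longrightarrow> int p dvd fps_nth A (p * n) - fps_nth A n"
    by (rule scaled_theta_log_integral[OF c_def[symmetric] c0 E(5)[folded \<alpha>_def]], rule that) blast+
  obtain \<epsilon> where \<epsilon>: "vform k f \<epsilon>" using modular_forms_vform[OF assms(1,2,4)] .
  have logexp: "logexp f (real m) l"
    by (rule logexpI[where C = 1 and \<Lambda> = \<Lambda>]) (use E in auto)
  have orders: "cusp_orders (int N) \<epsilon>"
  proof
    show "0 < int N" using assms(1) by simp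
    show "\<epsilon> (t * x) (t * y) = (of_int t)\<^sup>2 * \<epsilon> x y" if "t > 0" "x \<noteq> 0 \<or> y \<noteq> 0" for t x y
      by (rule vform_homogeneous[OF \<epsilon> that])
    show "\<epsilon> (a * x + b * y) (c * x + d * y) = \<epsilon> x y"
      if "a * d - b * c = 1" "int N dvd c" "x \<noteq> 0 \<or> y \<noteq> 0" for a b c d x y
      by (rule vform_invariant[OF \<epsilon> that(1) modular_forms_mslash_invariant[OF assms(2) that(1,2)] that(3)])
  qed
  interpret integral_form k N f \<epsilon> "real m" l c "fps_nth A"
  proof (rule integral_form.intro[OF _ orders c0])
    show "nform k f \<epsilon> (real m) l" using \<epsilon> logexp by (simp add: nform_def)
    show "of_int (fps_nth A n) = of_int c ^ n * (of_nat n * l n)" for n using A(1) by (simp add: \<alpha>_def)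
  qed (rule A(2))
  define \<beta> where "\<beta> = divisor_inverse (fps_nth \<alpha>)"
  have \<beta>: "of_nat n * l n = (\<Sum>d | d dvd n. \<beta> d)" if "n > 0" for n
    using sum_divisor_inverse[OF that, of "fps_nth \<alpha>"] by (simp add: \<beta>_def \<alpha>_def)
  have gcd: "\<beta> n / of_nat n = \<beta> (gcd n M) / of_nat (gcd n M)" if "n > 0" for n
    unfolding M_def by (rule theta_log_depends_on_gcd[OF \<beta> that])
  obtain B where B: "\<And>n. n > 0 \<Longrightarrow> \<beta> n = of_nat n * of_int (B n)"
    using theta_log_coefficients_integral[OF c_def[symmetric] c_nonzero E(5)[folded \<alpha>_def] _ M gcd[unfolded \<beta>_def]]
    unfolding \<beta>_def by (auto simp: \<alpha>_def)
  have Bgcd: "B n = B (gcd n M)" if "n > 0" for n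
    using gcd[OF that] B[OF that] B[of "gcd n M"] that by simp
  define \<rho> where "\<rho> = divisor_inverse B"
  have l: "l n = (\<Sum>\<delta> | \<delta> dvd M. of_int (\<rho> \<delta>) * (if \<delta> dvd n then lambert_coeff (n div \<delta>) else 0))" if "n > 0" for n
    unfolding \<rho>_def
  proof (rule sum_divisors_theta_log[where \<gamma> = B, OF M that Bgcd])
    show "of_nat n * l n = (\<Sum>d | d dvd n. of_nat d * of_int (B d))"
      unfolding \<beta>[OF that] by (rule sum.cong) (use B that in \<open>auto intro: dvd_pos_nat\<close>)
  qed
  have \<Lambda>: "\<Lambda> w = l 0 + (\<Sum>\<delta> | \<delta> dvd M. of_int (\<rho> \<delta>) * lambert (w ^ \<delta>))" if "w \<in> ball 0 1" for w
    by (rule log_eq_sum_lambert[OF E(3) M l that])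
  have hol: "\<Lambda> holomorphic_on ball 0 1"
    by (rule power_series_holomorphic[where a = l]) (use E(3) in simp)
  have "mslash k f 1 0 (int M) 1 z = f z" if "z \<in> upper_half_plane" for z
    by (rule modular_forms_mslash_invariant[OF assms(2) _ _ that]) (simp_all add: M_def)
  from order_at_infinity[OF E(4) \<Lambda> hol M this]
  have m: "(\<Sum>\<delta> | \<delta> dvd M. of_int (\<rho> \<delta>) * real \<delta>) = - 24 * real m" .
  \<comment> \<open>The Lambert series is minus the logarithm of the Euler product, hence the
    exponents - \<rho>(\<delta>).\<close>
  define g where "g z = (\<Prod>\<delta> | \<delta> dvd M. dedekind_eta (of_nat \<delta> * z) powi (- \<rho> \<delta>))" for z
  have "eta_quotient g" unfolding eta_quotient_def
    by (intro exI[of _ M] conjI exI[of _ "\<lambda>\<delta>. - \<rho> \<delta>"] M) (simp add: g_def)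
  moreover have "f z = of_int c * g z" if z: "z \<in> upper_half_plane" for z
  proof -
    \<comment> \<open>By the value of this sum the factors q^(\<delta>/24) of the eta functions
      multiply exactly to q^m.\<close>
    have "of_real (\<Sum>\<delta> | \<delta> dvd M. of_int (\<rho> \<delta>) * real \<delta>) = (of_real (- 24 * real m) :: complex)" by (simp only: m)
    then have mc: "(\<Sum>\<delta> | \<delta> dvd M. of_int (\<rho> \<delta>) * of_nat \<delta>) = (- 24 * of_nat m :: complex)" by simp
    have "g z = (\<Prod>\<delta> | \<delta> dvd M. exp (of_int (- \<rho> \<delta>) * (2 * of_real pi * \<i> * of_nat \<delta> * z / 24 - lambert (qh 1 z ^ \<delta>))))"
      unfolding g_def
    proof (rule prod.cong)
      fix \<delta> assume "\<delta> \<in> {\<delta>. \<delta> dvd M}"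
      then have "\<delta> > 0" using M by (auto intro: dvd_pos_nat)
      then show "dedekind_eta (of_nat \<delta> * z) powi (- \<rho> \<delta>) =
          exp (of_int (- \<rho> \<delta>) * (2 * of_real pi * \<i> * of_nat \<delta> * z / 24 - lambert (qh 1 z ^ \<delta>)))"
        by (simp only: dedekind_eta_eq[OF z] exp_power_int)
    qed simp
    also have "\<dots> = exp (\<Sum>\<delta> | \<delta> dvd M. of_int (- \<rho> \<delta>) * (2 * of_real pi * \<i> * of_nat \<delta> * z / 24 - lambert (qh 1 z ^ \<delta>)))"
      by (rule exp_sum[symmetric]) (use M in simp)
    also have "(\<Sum>\<delta> | \<delta> dvd M. of_int (- \<rho> \<delta>) * (2 * of_real pi * \<i> * of_nat \<delta> * z / 24 - lambert (qh 1 z ^ \<delta>))) =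
        (\<Sum>\<delta> | \<delta> dvd M. of_int (\<rho> \<delta>) * of_nat \<delta>) * (- (2 * of_real pi * \<i> * z / 24)) +
        (\<Sum>\<delta> | \<delta> dvd M. of_int (\<rho> \<delta>) * lambert (qh 1 z ^ \<delta>))"
      unfolding sum_distrib_right sum.distrib[symmetric] by (rule sum.cong) (simp_all add: algebra_simps)
    also have "\<dots> = 2 * of_real pi * \<i> * of_nat m * z + (\<Sum>\<delta> | \<delta> dvd M. of_int (\<rho> \<delta>) * lambert (qh 1 z ^ \<delta>))"
      unfolding mc by simp
    finally have "g z = exp (2 * of_real pi * \<i> * of_nat m * z + (\<Sum>\<delta> | \<delta> dvd M. of_int (\<rho> \<delta>) * lambert (qh 1 z ^ \<delta>)))" .
    then show ?thesis
      using E(4)[OF z] \<Lambda>[OF qh_in_ball[OF z zero_less_one]] E(2) by (simp add: c_def exp_add mult_ac)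
  qed
  ultimately show ?thesis by blast
qed

end
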